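(* Let $G$ be a polycyclic group and $\phi:G\to G$ a group endomorphism. Then the ascending HNN extension $G\ast_{\phi}$ is in the class $\mathcal{G}$.
   Context: For a group endomorphism $\phi:G\to G$ (not necessarily injective), the ascending HNN extension of $G$ with respect to $\phi$ is the group given by the presentation $G\ast_{\phi}=\langle G, t \mid t^{-1}gt=\phi(g)\ \text{for all } g\in G\rangle$. For an abstract group $H$, $\hat{H}$ denotes its profinite completion and $c_H:H\to\hat{H}$ the canonical completion map. The cohomology of an abstract group is ordinary group cohomology; the cohomology of a profinite group is continuous cohomology. A discrete $\hat{H}$-module is regarded as an $H$-module via $c_H$. The class $\mathcal{G}$ consists of all groups $H$ such that, for each $n\geq 0$ and each finite, discrete $\hat{H}$-module $A$: (i) the group $H^n(H,A)$ is finite; and (ii) the map $c_H:H\to\hat{H}$ induces an isomorphism $H^n(\hat{H},A)\to H^n(H,A)$. *)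

theory Defs
  imports
    "HOL-Algebra.FiniteProduct"
    "HOL-Algebra.Elementary_Groups"
    "HOL-Algebra.Product_Groups"
    "HOL-Algebra.Bij"
    "HOL-Analysis.Function_Topology"
    "HOL-Analysis.Product_Topology"
begin

section \<open>Polycyclic groups\<close>

definition polycyclic_group :: "('a, 'm) monoid_scheme \<Rightarrow> bool" where
  "polycyclic_group G \<longleftrightarrow> group G \<and>
     (\<exists>(n::nat) K. K 0 = {\<one>\<^bsub>G\<^esub>} \<and> K n = carrier G \<and>
        (\<forall>i\<le>n. subgroup (K i) G) \<and>
        (\<forall>i<n. K i \<lhd> G\<lparr>carrier := K (Suc i)\<rparr> \<and>
               cyclic_group (G\<lparr>carrier := K (Suc i)\<rparr> Mod K i)))"

section \<open>Groups given by a presentation\<close>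

text \<open>
  In a word, the letter \<open>(s, True)\<close> stands for the generator \<open>s\<close> and
  \<open>(s, False)\<close> for its formal inverse. A pair \<open>(r, r')\<close> of words is the
  relation \<open>r = r'\<close>.
\<close>

type_synonym 's word = "('s \<times> bool) list"

definition words :: "'s set \<Rightarrow> 's word set" where
  "words S = lists (S \<times> UNIV)"

inductive word_cong :: "'s set \<Rightarrow> ('s word \<times> 's word) set \<Rightarrow> 's word \<Rightarrow> 's word \<Rightarrow> bool"
  for S R where
  refl: "w \<in> words S \<Longrightarrow> word_cong S R w w"
| sym: "word_cong S R v w \<Longrightarrow> word_cong S R w v"
| trans: "word_cong S R u v \<Longrightarrow> word_cong S R v w \<Longrightarrow> word_cong S R u w"
| cancel: "u \<in> words S \<Longrightarrow> v \<in> words S \<Longrightarrow> s \<in> S \<Longrightarrow>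
    word_cong S R (u @ [(s, b), (s, \<not> b)] @ v) (u @ v)"
| relation: "u \<in> words S \<Longrightarrow> v \<in> words S \<Longrightarrow> (r, r') \<in> R \<Longrightarrow>
    r \<in> words S \<Longrightarrow> r' \<in> words S \<Longrightarrow> word_cong S R (u @ r @ v) (u @ r' @ v)"

definition presented_group :: "'s set \<Rightarrow> ('s word \<times> 's word) set \<Rightarrow> 's word set monoid" where
  "presented_group S R =
     \<lparr>carrier = words S // {(v, w). word_cong S R v w},
      mult = (\<lambda>X Y. {w. \<exists>u\<in>X. \<exists>v\<in>Y. word_cong S R (u @ v) w}),
      one = {w. word_cong S R [] w}\<rparr>"

section \<open>Ascending HNN extensions\<close>

datatype 'a hnn_gen = Base 'a | Stable

text \<open>
  The first set of relations is the multiplication table of \<open>G\<close>, which presents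
  \<open>G\<close> itself; the second is \<open>t\<inverse> g t = \<phi> g\<close>, where \<open>t\<close> is
  the generator \<open>Stable\<close>.
\<close>

definition ascending_hnn ::
    "('a, 'm) monoid_scheme \<Rightarrow> ('a \<Rightarrow> 'a) \<Rightarrow> 'a hnn_gen word set monoid" where
  "ascending_hnn G \<phi> = presented_group (insert Stable (Base ` carrier G))
     ({([(Base g, True), (Base h, True)], [(Base (g \<otimes>\<^bsub>G\<^esub> h), True)]) | g h.
         g \<in> carrier G \<and> h \<in> carrier G} \<union>
      {([(Stable, False), (Base g, True), (Stable, True)], [(Base (\<phi> g), True)]) | g.
         g \<in> carrier G})"

section \<open>Profinite completion\<close>

definition finite_index_normals :: "('h, 'm) monoid_scheme \<Rightarrow> 'h set set" where
  "finite_index_normals H = {N. N \<lhd> H \<and> finite (rcosets\<^bsub>H\<^esub> N)}"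

text \<open>
  The inverse limit of the quotients \<open>H Mod N\<close>. For \<open>N \<subseteq> M\<close>, the
  transition map \<open>H Mod N \<rightarrow> H Mod M\<close> sends a coset \<open>X\<close> of \<open>N\<close> to the
  coset \<open>M <#> X\<close> of \<open>M\<close>.
\<close>

definition profinite_completion :: "('h, 'm) monoid_scheme \<Rightarrow> ('h set \<Rightarrow> 'h set) monoid" where
  "profinite_completion H =
     (product_group (finite_index_normals H) (\<lambda>N. H Mod N))
       \<lparr>carrier := {x \<in> (\<Pi>\<^sub>E N\<in>finite_index_normals H. carrier (H Mod N)).
          \<forall>N\<in>finite_index_normals H. \<forall>M\<in>finite_index_normals H.
            N \<subseteq> M \<longrightarrow> M <#>\<^bsub>H\<^esub> x N = x M}\<rparr>"

definition profinite_topology :: "('h, 'm) monoid_scheme \<Rightarrow> ('h set \<Rightarrow> 'h set) topology" where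
  "profinite_topology H =
     subtopology
       (product_topology (\<lambda>N. discrete_topology (carrier (H Mod N))) (finite_index_normals H))
       (carrier (profinite_completion H))"

definition completion_map :: "('h, 'm) monoid_scheme \<Rightarrow> 'h \<Rightarrow> 'h set \<Rightarrow> 'h set" where
  "completion_map H h = (\<lambda>N\<in>finite_index_normals H. N #>\<^bsub>H\<^esub> h)"

section \<open>Cohomology by inhomogeneous cochains\<close>

text \<open>
  Coefficient modules are abelian groups \<open>A\<close> in multiplicative notation, with a left
  action given by a homomorphism from the acting group to \<open>AutoGroup A\<close>. An
  \<open>n\<close>-tuple of group elements is an extensional function on \<open>{..<n}\<close>.
\<close>

definition discrete_module ::
    "('g, 'm) monoid_scheme \<Rightarrow> 'g topology \<Rightarrow> ('b, 'k) monoid_scheme \<Rightarrow> ('g \<Rightarrow> 'b \<Rightarrow> 'b) \<Rightarrow> bool"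
  where
  "discrete_module P T A act \<longleftrightarrow> comm_group A \<and> act \<in> hom P (AutoGroup A) \<and>
     continuous_map (prod_topology T (discrete_topology (carrier A)))
       (discrete_topology (carrier A)) (\<lambda>(g, a). act g a)"

definition tuples :: "('g, 'm) monoid_scheme \<Rightarrow> nat \<Rightarrow> (nat \<Rightarrow> 'g) set" where
  "tuples P n = (\<Pi>\<^sub>E i\<in>{..<n}. carrier P)"

definition cochain_group ::
    "('g, 'm) monoid_scheme \<Rightarrow> ('b, 'k) monoid_scheme \<Rightarrow> nat \<Rightarrow> ((nat \<Rightarrow> 'g) \<Rightarrow> 'b) monoid" where
  "cochain_group P A n = product_group (tuples P n) (\<lambda>_. A)"

definition continuous_cochains ::
    "('g, 'm) monoid_scheme \<Rightarrow> 'g topology \<Rightarrow> ('b, 'k) monoid_scheme \<Rightarrow> nat \<Rightarrow>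
     ((nat \<Rightarrow> 'g) \<Rightarrow> 'b) set" where
  "continuous_cochains P T A n = {f \<in> carrier (cochain_group P A n).
     continuous_map (product_topology (\<lambda>_. T) {..<n}) (discrete_topology (carrier A)) f}"

text \<open>
  Written additively, and with the entries of the tuple numbered from \<open>0\<close> to \<open>n\<close>:
  \<open>(d f)(x\<^sub>0, \<dots>, x\<^sub>n) = x\<^sub>0 f(x\<^sub>1, \<dots>, x\<^sub>n)
    + (\<Sum>j<n. (-1)^(j+1) f(x\<^sub>0, \<dots>, x\<^sub>j x\<^bsub>j+1\<^esub>, \<dots>, x\<^sub>n))
    + (-1)^(n+1) f(x\<^sub>0, \<dots>, x\<^bsub>n-1\<^esub>)\<close>.
\<close>

definition coboundary ::
    "('g, 'm) monoid_scheme \<Rightarrow> ('b, 'k) monoid_scheme \<Rightarrow> ('g \<Rightarrow> 'b \<Rightarrow> 'b) \<Rightarrow> nat \<Rightarrow>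
     ((nat \<Rightarrow> 'g) \<Rightarrow> 'b) \<Rightarrow> (nat \<Rightarrow> 'g) \<Rightarrow> 'b" where
  "coboundary P A act n f = (\<lambda>x\<in>tuples P (Suc n).
     act (x 0) (f (\<lambda>i\<in>{..<n}. x (Suc i)))
     \<otimes>\<^bsub>A\<^esub> (\<Otimes>\<^bsub>A\<^esub>j\<in>{..<n}.
          f (\<lambda>i\<in>{..<n}. if i < j then x i
                        else if i = j then x j \<otimes>\<^bsub>P\<^esub> x (Suc j)
                        else x (Suc i)) [^]\<^bsub>A\<^esub> ((- 1) ^ Suc j :: int))
     \<otimes>\<^bsub>A\<^esub> f (\<lambda>i\<in>{..<n}. x i) [^]\<^bsub>A\<^esub> ((- 1) ^ Suc n :: int))"

text \<open>
  Cocycles, coboundaries and cohomology of the complex whose \<open>n\<close>-cochains are the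
  elements of \<open>C n\<close>.
\<close>

definition cocycles ::
    "('g, 'm) monoid_scheme \<Rightarrow> ('b, 'k) monoid_scheme \<Rightarrow> ('g \<Rightarrow> 'b \<Rightarrow> 'b) \<Rightarrow>
     (nat \<Rightarrow> ((nat \<Rightarrow> 'g) \<Rightarrow> 'b) set) \<Rightarrow> nat \<Rightarrow> ((nat \<Rightarrow> 'g) \<Rightarrow> 'b) set" where
  "cocycles P A act C n =
     {f \<in> C n. coboundary P A act n f = \<one>\<^bsub>cochain_group P A (Suc n)\<^esub>}"

definition coboundaries ::
    "('g, 'm) monoid_scheme \<Rightarrow> ('b, 'k) monoid_scheme \<Rightarrow> ('g \<Rightarrow> 'b \<Rightarrow> 'b) \<Rightarrow>
     (nat \<Rightarrow> ((nat \<Rightarrow> 'g) \<Rightarrow> 'b) set) \<Rightarrow> nat \<Rightarrow> ((nat \<Rightarrow> 'g) \<Rightarrow> 'b) set" where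
  "coboundaries P A act C n =
     (case n of 0 \<Rightarrow> {\<one>\<^bsub>cochain_group P A 0\<^esub>} | Suc m \<Rightarrow> coboundary P A act m ` C m)"

definition cohomology ::
    "('g, 'm) monoid_scheme \<Rightarrow> ('b, 'k) monoid_scheme \<Rightarrow> ('g \<Rightarrow> 'b \<Rightarrow> 'b) \<Rightarrow>
     (nat \<Rightarrow> ((nat \<Rightarrow> 'g) \<Rightarrow> 'b) set) \<Rightarrow> nat \<Rightarrow> ((nat \<Rightarrow> 'g) \<Rightarrow> 'b) set monoid" where
  "cohomology P A act C n =
     (cochain_group P A n)\<lparr>carrier := cocycles P A act C n\<rparr> Mod coboundaries P A act C n"

definition group_cohomology ::
    "('g, 'm) monoid_scheme \<Rightarrow> ('b, 'k) monoid_scheme \<Rightarrow> ('g \<Rightarrow> 'b \<Rightarrow> 'b) \<Rightarrow> nat \<Rightarrow>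
     ((nat \<Rightarrow> 'g) \<Rightarrow> 'b) set monoid" where
  "group_cohomology P A act = cohomology P A act (\<lambda>n. carrier (cochain_group P A n))"

definition continuous_cohomology ::
    "('g, 'm) monoid_scheme \<Rightarrow> 'g topology \<Rightarrow> ('b, 'k) monoid_scheme \<Rightarrow> ('g \<Rightarrow> 'b \<Rightarrow> 'b) \<Rightarrow> nat \<Rightarrow>
     ((nat \<Rightarrow> 'g) \<Rightarrow> 'b) set monoid" where
  "continuous_cohomology P T A act = cohomology P A act (continuous_cochains P T A)"

text \<open>
  For a homomorphism \<open>c\<close> from \<open>H\<close> to the group acting on \<open>A\<close>, pullback of
  cochains along \<open>c\<close>, and the map it induces on cohomology: the class of a cocycle
  \<open>f\<close> goes to the class of its pullback. Here \<open>X\<close> is a class, that is, a coset of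
  the coboundaries; multiplying its image by the coboundaries of \<open>H\<close> gives a full coset.
\<close>

definition pullback_cochain ::
    "('h, 'm) monoid_scheme \<Rightarrow> ('h \<Rightarrow> 'g) \<Rightarrow> nat \<Rightarrow> ((nat \<Rightarrow> 'g) \<Rightarrow> 'b) \<Rightarrow> (nat \<Rightarrow> 'h) \<Rightarrow> 'b" where
  "pullback_cochain H c n f = (\<lambda>x\<in>tuples H n. f (\<lambda>i\<in>{..<n}. c (x i)))"

definition cohomology_map ::
    "('h, 'm) monoid_scheme \<Rightarrow> ('h \<Rightarrow> 'g) \<Rightarrow> ('b, 'k) monoid_scheme \<Rightarrow> ('g \<Rightarrow> 'b \<Rightarrow> 'b) \<Rightarrow> nat \<Rightarrow>
     ((nat \<Rightarrow> 'g) \<Rightarrow> 'b) set \<Rightarrow> ((nat \<Rightarrow> 'h) \<Rightarrow> 'b) set" where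
  "cohomology_map H c A act n X =
     coboundaries H A (act \<circ> c) (\<lambda>n. carrier (cochain_group H A n)) n
       <#>\<^bsub>cochain_group H A n\<^esub> (pullback_cochain H c n ` X)"

section \<open>The class of groups\<close>

text \<open>
  The type argument only says where the elements of the coefficient modules live: HOL cannot quantify over
  types inside a definition, so the class is indexed by the type \<open>'b\<close> of module elements
  and results should be stated for every \<open>'b\<close>. Every finite module has an isomorphic
  copy over any infinite type, such as \<open>nat\<close>.
\<close>

definition in_class_G :: "'b itself \<Rightarrow> ('h, 'm) monoid_scheme \<Rightarrow> bool" where
  "in_class_G (_ :: 'b itself) H \<longleftrightarrow> group H \<and>
     (\<forall>(n::nat) (A :: 'b monoid) act.
        discrete_module (profinite_completion H) (profinite_topology H) A act \<and>
        finite (carrier A) \<longrightarrow>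
          finite (carrier (group_cohomology H A (act \<circ> completion_map H) n)) \<and>
          cohomology_map H (completion_map H) A act n \<in>
            iso (continuous_cohomology (profinite_completion H) (profinite_topology H) A act n)
                (group_cohomology H A (act \<circ> completion_map H) n))"

end

theory Submission
  imports Defs
begin

text \<open>
  Call a subgroup \<open>S\<close> effaceable if, in positive degree, the cocycles of every subgroup of finite
  index in \<open>S\<close> become coboundaries on a smaller subgroup of finite index. If \<open>L\<close> is finitely
  generated and effaceable and \<open>t\<inverse> L t \<subseteq> L\<close>, then the group generated by \<open>L\<close> and \<open>t\<close> is
  effaceable: cocycles become coboundaries on \<open>M' = \<Union>\<^sub>i t\<^sup>i L' t\<^sup>-\<^sup>i\<close> by compactness of the space of
  cochains, where \<open>L'\<close> is a subgroup of finite index in \<open>L\<close> with \<open>t\<inverse> L' t \<subseteq> L'\<close>, and then on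
  \<open>M' \<rtimes> \<langle>t\<^sup>m\<rangle>\<close> by the Wang sequence. A polycyclic group arises from the trivial group by such steps, and
  the ascending HNN extension arises from the image of \<open>G\<close> by one more, whether or not
  \<open>\<phi>\<close> is injective. The cochains of all subgroups are functions of tuples in the fixed group
  \<open>H = G \<^bold>*\<^sub>\<phi>\<close> with values in a fixed module.

  Continuous cochains of the profinite completion are the cochains of \<open>H\<close> that factor through a finite
  quotient. If \<open>H\<close> is effaceable, then a cochain whose coboundary factors through a
  finite quotient can be corrected by coboundaries, one variable after the other, until it
  factors through a finite quotient that does not depend on the cochain. This gives the
  isomorphism in cohomology, and the finiteness as well.
\<close>

text \<open>Two obstacles shape the argument. The inclusion \<open>t^-1 L t \<subseteq> L\<close>
  may be strict, and then the union of the conjugates \<open>t^i L t^-i\<close> is not finitely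
  generated, so stable subgroups of finite index cannot be sought in it directly. They are found in
  the finitely generated \<open>L\<close>, where finitely many generators leave finitely many
  preimages to intersect, and are carried to the union by conjugation. Secondly, the Wang sequence
  leaves a second obstruction one degree lower. In degree at least two it is killed by effaceability
  once more. In degree one it is an invariant element of the module, which no smaller subgroup
  removes; as the module is finite, a power of \<open>t\<close> does.

  Effaceability asks for one subgroup that serves all cocycles at once. This uniformity gives the
  final finite quotient that is independent of the cochain, and with it the finiteness of
  cohomology. Correcting one variable at a time plays the role of the spectral sequence of a group
  extension: in each step the cocycles to be killed are those of a subgroup of finite index, with
  the variables already treated as parameters.\<close>

section \<open>Abelian groups as values of cochains\<close>

text \<open>The product of all abelian groups with elements in \<open>'b\<close>. It is an instance of
  \<^class>\<open>ab_group_add\<close> and contains every such group as a factor, so that cochains can take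
  their values in a type.\<close>

typedef 'b ab_prod = "{f :: 'b monoid \<Rightarrow> 'b. \<forall>A. f A \<in> (if comm_group A then carrier A else {undefined})}"
  morphisms ab_coord Abs_ab_prod
  by (rule exI[of _ "\<lambda>A. if comm_group A then \<one>\<^bsub>A\<^esub> else undefined"])
    (auto simp: comm_group_def group.is_monoid monoid.one_closed)

lemma ab_coord_closed: "comm_group A \<Longrightarrow> ab_coord v A \<in> carrier A"
  using ab_coord[of v] by (auto dest: spec[of _ A])

lemma ab_coord_undefined: "\<not> comm_group A \<Longrightarrow> ab_coord v A = undefined"
  using ab_coord[of v] by (auto dest: spec[of _ A])

lemma ab_prod_eqI: "(\<And>A. comm_group A \<Longrightarrow> ab_coord v A = ab_coord w A) \<Longrightarrow> v = w"
  by (metis ab_coord_inject ab_coord_undefined ext)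

definition mk_ab_prod :: "('b monoid \<Rightarrow> 'b) \<Rightarrow> 'b ab_prod" where
  "mk_ab_prod f = Abs_ab_prod (\<lambda>A. if comm_group A then f A else undefined)"

lemma ab_coord_mk:
  assumes "\<And>A. comm_group A \<Longrightarrow> f A \<in> carrier A" and "comm_group A"
  shows "ab_coord (mk_ab_prod f) A = f A"
  using assms by (simp add: mk_ab_prod_def Abs_ab_prod_inverse)

instantiation ab_prod :: (type) ab_group_add
begin

definition "0 = mk_ab_prod (\<lambda>A. \<one>\<^bsub>A\<^esub>)"
definition "v + w = mk_ab_prod (\<lambda>A. ab_coord v A \<otimes>\<^bsub>A\<^esub> ab_coord w A)"
definition "- v = mk_ab_prod (\<lambda>A. inv\<^bsub>A\<^esub> ab_coord v A)"
definition "v - w = v + (- w :: 'a ab_prod)"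

lemma ab_coord_zero: "comm_group A \<Longrightarrow> ab_coord 0 A = \<one>\<^bsub>A\<^esub>"
  unfolding zero_ab_prod_def
  by (subst ab_coord_mk) (auto simp: comm_group_def group.is_monoid monoid.one_closed)

lemma ab_coord_plus: "comm_group A \<Longrightarrow> ab_coord (v + w) A = ab_coord v A \<otimes>\<^bsub>A\<^esub> ab_coord w A"
  unfolding plus_ab_prod_def
  by (subst ab_coord_mk) (auto simp: comm_group_def group.is_monoid ab_coord_closed monoid.m_closed)

lemma ab_coord_uminus: "comm_group A \<Longrightarrow> ab_coord (- v) A = inv\<^bsub>A\<^esub> ab_coord v A"
  unfolding uminus_ab_prod_def
  by (subst ab_coord_mk) (auto simp: comm_group_def ab_coord_closed group.inv_closed)

instance
proof
  fix u v w :: "'a ab_prod"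
  have *: "comm_monoid A" "group A" if "comm_group A" for A :: "'a monoid"
    using that by (auto simp: comm_group_def)
  show "u + v + w = u + (v + w)"
    by (rule ab_prod_eqI)
      (simp add: ab_coord_plus ab_coord_closed monoid.m_assoc comm_monoid.axioms *)
  show "u + v = v + u"
    by (rule ab_prod_eqI) (simp add: ab_coord_plus ab_coord_closed comm_monoid.m_comm *)
  show "0 + u = u"
    by (rule ab_prod_eqI)
      (simp add: ab_coord_plus ab_coord_zero ab_coord_closed comm_monoid.axioms monoid.l_one *)
  show "- u + u = 0"
    by (rule ab_prod_eqI)
      (simp add: ab_coord_plus ab_coord_zero ab_coord_uminus ab_coord_closed group.l_inv *)
  show "u - v = u + - v" by (simp add: minus_ab_prod_def)
qed

end

definition ab_in :: "'b monoid \<Rightarrow> 'b \<Rightarrow> 'b ab_prod" where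
  "ab_in A a = mk_ab_prod (\<lambda>B. if B = A then a else \<one>\<^bsub>B\<^esub>)"

text \<open>The other coordinates are kept, not set to the unit: \<open>fin_module\<close> asks that
  the unit of the group fix every element of the type, also outside the embedded module.\<close>

definition ab_map :: "'b monoid \<Rightarrow> ('b \<Rightarrow> 'b) \<Rightarrow> 'b ab_prod \<Rightarrow> 'b ab_prod" where
  "ab_map A f v = mk_ab_prod (\<lambda>B. if B = A then f (ab_coord v A) else ab_coord v B)"

context
  fixes A :: "'b monoid"
  assumes A: "comm_group A"
begin

interpretation A: comm_group A by (rule A)

lemma ab_coord_in:
  assumes "a \<in> carrier A" "comm_group B"
  shows "ab_coord (ab_in A a) B = (if B = A then a else \<one>\<^bsub>B\<^esub>)"
  unfolding ab_in_def using assms A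
  by (subst ab_coord_mk) (auto simp: comm_group_def group.is_monoid monoid.one_closed)

lemma ab_coord_in_same [simp]: "a \<in> carrier A \<Longrightarrow> ab_coord (ab_in A a) A = a"
  by (simp add: ab_coord_in A)

lemma ab_in_mult:
  assumes "a \<in> carrier A" "b \<in> carrier A"
  shows "ab_in A (a \<otimes>\<^bsub>A\<^esub> b) = ab_in A a + ab_in A b"
proof (rule ab_prod_eqI)
  fix B :: "'b monoid" assume B: "comm_group B"
  then show "ab_coord (ab_in A (a \<otimes>\<^bsub>A\<^esub> b)) B = ab_coord (ab_in A a + ab_in A b) B"
    using assms by (auto simp: ab_coord_plus ab_coord_in comm_group_def group.is_monoid monoid.l_one monoid.one_closed)
qed

lemma ab_in_one: "ab_in A \<one>\<^bsub>A\<^esub> = 0"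
  by (rule ab_prod_eqI) (auto simp: ab_coord_zero ab_coord_in)

lemma ab_in_inv:
  assumes "a \<in> carrier A"
  shows "ab_in A (inv\<^bsub>A\<^esub> a) = - ab_in A a"
proof -
  have "ab_in A (inv\<^bsub>A\<^esub> a) + ab_in A a = 0"
    using ab_in_mult[of "inv\<^bsub>A\<^esub> a" a] assms by (simp add: ab_in_one)
  then show ?thesis by (simp add: eq_neg_iff_add_eq_0)
qed

lemma ab_coord_map:
  assumes "f \<in> carrier A \<rightarrow> carrier A" "comm_group B"
  shows "ab_coord (ab_map A f v) B = (if B = A then f (ab_coord v A) else ab_coord v B)"
  unfolding ab_map_def using assms
  by (subst ab_coord_mk) (auto simp: ab_coord_closed)

lemma ab_map_in:
  assumes "f \<in> hom A A" "a \<in> carrier A"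
  shows "ab_map A f (ab_in A a) = ab_in A (f a)"
proof (rule ab_prod_eqI)
  fix B :: "'b monoid" assume B: "comm_group B"
  have "f a \<in> carrier A" using assms by (auto simp: hom_def)
  then show "ab_coord (ab_map A f (ab_in A a)) B = ab_coord (ab_in A (f a)) B"
    using assms B by (auto simp: ab_coord_map ab_coord_in hom_def A)
qed

lemma ab_map_add:
  assumes "f \<in> hom A A"
  shows "ab_map A f (v + w) = ab_map A f v + ab_map A f w"
  using assms by (intro ab_prod_eqI) (auto simp: ab_coord_map ab_coord_plus hom_def ab_coord_closed A)

lemma ab_map_comp:
  assumes "f \<in> hom A A" "g \<in> hom A A" "\<And>a. a \<in> carrier A \<Longrightarrow> h a = f (g a)"
  shows "ab_map A h v = ab_map A f (ab_map A g v)"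
proof (rule ab_prod_eqI)
  fix B :: "'b monoid" assume B: "comm_group B"
  have h: "h \<in> carrier A \<rightarrow> carrier A" using assms by (auto simp: hom_def)
  show "ab_coord (ab_map A h v) B = ab_coord (ab_map A f (ab_map A g v)) B"
    using assms B h by (auto simp: ab_coord_map hom_def ab_coord_closed A)
qed

lemma ab_map_ident:
  assumes "\<And>a. a \<in> carrier A \<Longrightarrow> h a = a"
  shows "ab_map A h v = v"
  using assms by (intro ab_prod_eqI) (auto simp: ab_coord_map ab_coord_closed A)

end

section \<open>Subgroups of finite index\<close>

context group
begin

lemma inv_mult_cancel:
  "x \<in> carrier G \<Longrightarrow> y \<in> carrier G \<Longrightarrow> inv x \<otimes> (x \<otimes> y) = y"
  "x \<in> carrier G \<Longrightarrow> y \<in> carrier G \<Longrightarrow> x \<otimes> (inv x \<otimes> y) = y"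
  by (simp_all flip: m_assoc)

lemmas group_simps = m_assoc inv_mult_group inv_mult_cancel

lemma r_coset_eqD:
  assumes "subgroup S G" "x \<in> carrier G" "y \<in> carrier G" "S #> x = S #> y"
  shows "x \<otimes> inv y \<in> S"
proof -
  have "x \<in> S #> y" using assms rcos_self by blast
  then obtain h where h: "h \<in> S" "x = h \<otimes> y" by (auto simp: r_coset_def)
  have "h \<in> carrier G" using subgroup.mem_carrier[OF assms(1) h(1)] .
  then have "x \<otimes> inv y = h" using assms(3) by (simp add: h(2) m_assoc)
  then show ?thesis using h(1) by simp
qed

lemma r_coset_eqI:
  assumes "subgroup S G" "x \<in> carrier G" "y \<in> carrier G" "x \<otimes> inv y \<in> S"
  shows "S #> x = S #> y"
proof -
  have "x = (x \<otimes> inv y) \<otimes> y" using assms by (simp add: m_assoc)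
  then have "x \<in> S #> y" using assms(4) unfolding r_coset_def by blast
  then show ?thesis using assms repr_independence by metis
qed

text \<open>Cosets are formed in the ambient group, so chains of subgroups are handled as sets
  without changing the group structure.\<close>

definition fin_ind :: "'a set \<Rightarrow> 'a set \<Rightarrow> bool" where
  "fin_ind R S \<longleftrightarrow> subgroup R G \<and> subgroup S G \<and> R \<subseteq> S \<and> finite ((\<lambda>x. R #> x) ` S)"

text \<open>The label \<open>\<kappa>\<close> need not be constant on cosets. Each of its fibres
  lies in one coset, so one representative per label reaches every coset.\<close>

lemma fin_indI:
  assumes "subgroup R G" "subgroup S G" "R \<subseteq> S" "finite (\<kappa> ` S)"
    and "\<And>x y. x \<in> S \<Longrightarrow> y \<in> S \<Longrightarrow> \<kappa> x = \<kappa> y \<Longrightarrow> x \<otimes> inv y \<in> R"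
  shows "fin_ind R S"
proof -
  have *: "R #> x = R #> (SOME y. y \<in> S \<and> \<kappa> y = \<kappa> x)" if x: "x \<in> S" for x
  proof -
    let ?y = "SOME y. y \<in> S \<and> \<kappa> y = \<kappa> x"
    have "?y \<in> S \<and> \<kappa> ?y = \<kappa> x" by (rule someI[of _ x]) (simp add: x)
    then show ?thesis using assms x
      by (intro r_coset_eqI assms(1,5)) (auto intro: subgroup.mem_carrier[OF assms(2)])
  qed
  have "(\<lambda>x. R #> x) ` S \<subseteq> (\<lambda>c. R #> (SOME y. y \<in> S \<and> \<kappa> y = c)) ` (\<kappa> ` S)"
  proof
    fix c assume "c \<in> (\<lambda>x. R #> x) ` S"
    then obtain x where x: "x \<in> S" "c = R #> x" by blast
    then have "c = R #> (SOME y. y \<in> S \<and> \<kappa> y = \<kappa> x)" using * by simp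
    then show "c \<in> (\<lambda>c. R #> (SOME y. y \<in> S \<and> \<kappa> y = c)) ` (\<kappa> ` S)" using x(1) by blast
  qed
  from finite_surj[OF assms(4) this] show ?thesis using assms(1-3) by (simp add: fin_ind_def)
qed

lemma fin_indD:
  assumes "fin_ind R S"
  shows "subgroup R G" "subgroup S G" "R \<subseteq> S" "finite ((\<lambda>x. R #> x) ` S)"
  using assms by (auto simp: fin_ind_def)

lemma fin_ind_coset:
  assumes "fin_ind R S" "x \<in> S" "y \<in> S" "R #> x = R #> y"
  shows "x \<otimes> inv y \<in> R"
  using fin_indD[OF assms(1)] assms subgroup.mem_carrier by (metis r_coset_eqD)

lemma fin_ind_refl: "subgroup S G \<Longrightarrow> fin_ind S S"
  by (rule fin_indI[where \<kappa> = "\<lambda>_. ()"]) (auto intro: subgroup.m_closed subgroup.m_inv_closed)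

lemma fin_ind_trans:
  assumes "fin_ind Q R" "fin_ind R S"
  shows "fin_ind Q S"
proof -
  note QR = fin_indD[OF assms(1)] and RS = fin_indD[OF assms(2)]
  define r where "r x = (SOME y. y \<in> S \<and> R #> y = R #> x)" for x
  have r: "r x \<in> S \<and> R #> r x = R #> x" if "x \<in> S" for x
    unfolding r_def by (rule someI[of _ x]) (simp add: that)
  have rR: "x \<otimes> inv (r x) \<in> R" if "x \<in> S" for x
    using r[OF that] that by (metis fin_ind_coset[OF assms(2)])
  \<comment> \<open>An element is located by its coset of \<open>R\<close> and by the coset of
    \<open>Q\<close> of its remainder in \<open>R\<close>. The representative depends on the coset
    of \<open>R\<close> alone, so it cancels in the quotient of two elements with the same
    label.\<close>
  show ?thesis
  proof (rule fin_indI[where \<kappa> = "\<lambda>x. (R #> x, Q #> (x \<otimes> inv (r x)))"])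
    have "(\<lambda>x. (R #> x, Q #> (x \<otimes> inv (r x)))) ` S \<subseteq> (\<lambda>x. R #> x) ` S \<times> (\<lambda>x. Q #> x) ` R"
      using rR by auto
    then show "finite ((\<lambda>x. (R #> x, Q #> (x \<otimes> inv (r x)))) ` S)"
      using QR RS by (meson finite_SigmaI finite_subset)
  next
    fix x y assume xy: "x \<in> S" "y \<in> S"
      and "(R #> x, Q #> (x \<otimes> inv (r x))) = (R #> y, Q #> (y \<otimes> inv (r y)))"
    then have eq: "R #> x = R #> y" "Q #> (x \<otimes> inv (r x)) = Q #> (y \<otimes> inv (r y))" by auto
    have rr: "r y = r x" using eq by (simp add: r_def)
    have "(x \<otimes> inv (r x)) \<otimes> inv (y \<otimes> inv (r x)) \<in> Q"
      using fin_ind_coset[OF assms(1) rR[OF xy(1)] rR[OF xy(2)] eq(2)] rr by simp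
    moreover have "x \<in> carrier G" "y \<in> carrier G" "r x \<in> carrier G"
      using xy r RS subgroup.mem_carrier by metis+
    ultimately show "x \<otimes> inv y \<in> Q"
      by (simp add: inv_mult_group m_assoc flip: m_assoc[of "inv (r x)" "r x" "inv y"])
  qed (use QR RS in auto)
qed

lemma fin_ind_Int:
  assumes "fin_ind Q S" "fin_ind R S"
  shows "fin_ind (Q \<inter> R) S"
proof (rule fin_indI[where \<kappa> = "\<lambda>x. (Q #> x, R #> x)"])
  have "(\<lambda>x. (Q #> x, R #> x)) ` S \<subseteq> (\<lambda>x. Q #> x) ` S \<times> (\<lambda>x. R #> x) ` S" by auto
  then show "finite ((\<lambda>x. (Q #> x, R #> x)) ` S)"
    using assms fin_indD by (meson finite_SigmaI finite_subset)
qed (use fin_indD[OF assms(1)] fin_indD[OF assms(2)] fin_ind_coset[OF assms(1)] fin_ind_coset[OF assms(2)]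
    in \<open>auto intro!: subgroups_Inter_pair\<close>)

lemma fin_ind_Int_subgroup:
  assumes "fin_ind Q S" "subgroup R G" "R \<subseteq> S"
  shows "fin_ind (Q \<inter> R) R"
proof (rule fin_indI[where \<kappa> = "\<lambda>x. Q #> x"])
  show "finite ((\<lambda>x. Q #> x) ` R)"
    using assms fin_indD(4) by (meson finite_subset image_mono)
  show "x \<otimes> inv y \<in> Q \<inter> R" if "x \<in> R" "y \<in> R" "Q #> x = Q #> y" for x y
    using fin_ind_coset[OF assms(1) _ _ that(3)] that(1,2) assms(3)
    by (auto intro: subgroup.m_closed[OF assms(2)] subgroup.m_inv_closed[OF assms(2)])
qed (use assms fin_indD in \<open>auto intro!: subgroups_Inter_pair\<close>)

lemma fin_ind_Inter:
  assumes "finite I" "I \<noteq> {}" "\<And>Q. Q \<in> I \<Longrightarrow> fin_ind Q S"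
  shows "fin_ind (\<Inter>I) S"
  using assms by (induction I rule: finite_ne_induct) (auto intro: fin_ind_Int)

lemma fin_ind_mono:
  assumes "fin_ind Q S" "subgroup R G" "Q \<subseteq> R" "R \<subseteq> S"
  shows "fin_ind R S" "fin_ind Q R"
proof -
  show "fin_ind R S"
    by (rule fin_indI[where \<kappa> = "\<lambda>x. Q #> x"])
      (use assms fin_indD[OF assms(1)] fin_ind_coset[OF assms(1)] in auto)
  have "Q \<inter> R = Q" using assms by auto
  then show "fin_ind Q R" using fin_ind_Int_subgroup[OF assms(1,2,4)] by simp
qed

lemma fin_ind_pow:
  assumes "fin_ind R S" "x \<in> S"
  obtains m :: nat where "m > 0" "x [^] m \<in> R"
proof -
  note R = fin_indD[OF assms(1)]
  have x: "x \<in> carrier G" using assms R subgroup.mem_carrier by metis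
  have pow: "x [^] (m::nat) \<in> S" for m
    using assms(2) R(2) by (induction m) (auto intro: subgroup.m_closed subgroup.one_closed)
  have "(\<lambda>m::nat. R #> x [^] m) ` UNIV \<subseteq> (\<lambda>x. R #> x) ` S" using pow by auto
  then have "finite ((\<lambda>m::nat. R #> x [^] m) ` UNIV)" using R(4) finite_subset by blast
  then have "\<not> inj (\<lambda>m::nat. R #> x [^] m)" using finite_imageD by blast
  then obtain i j :: nat where ij: "i < j" "R #> x [^] i = R #> x [^] j"
    unfolding inj_def by (metis nat_neq_iff)
  have "x [^] j \<otimes> inv (x [^] i) \<in> R"
    by (rule fin_ind_coset[OF assms(1)]) (use pow ij in auto)
  moreover have "x [^] j = x [^] (j - i) \<otimes> x [^] i" using ij x by (simp add: nat_pow_mult)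
  ultimately have "x [^] (j - i) \<in> R" using x by (simp add: m_assoc)
  then show ?thesis using that[of "j - i"] ij by simp
qed

section \<open>Endomorphisms and stable subgroups of finite index\<close>

definition endo_on :: "'a set \<Rightarrow> ('a \<Rightarrow> 'a) \<Rightarrow> bool" where
  "endo_on L \<phi> \<longleftrightarrow> (\<forall>x\<in>L. \<phi> x \<in> L) \<and> (\<forall>x\<in>L. \<forall>y\<in>L. \<phi> (x \<otimes> y) = \<phi> x \<otimes> \<phi> y)"

lemma endo_on_funpow:
  assumes "endo_on L \<phi>" "subgroup L G"
  shows "endo_on L (\<phi> ^^ j)"
  using assms by (induction j) (auto simp: endo_on_def intro: subgroup.m_closed)

lemma endo_on_inv:
  assumes "endo_on L \<phi>" "subgroup L G" "x \<in> L"
  shows "\<phi> (inv x) = inv (\<phi> x)"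
proof -
  note c = subgroup.mem_carrier[OF assms(2)]
  have m: "\<phi> y \<in> L" if "y \<in> L" for y using assms that by (auto simp: endo_on_def)
  have 1: "\<one> \<in> L" "inv x \<in> L" using assms subgroup.one_closed subgroup.m_inv_closed by metis+
  have "\<phi> \<one> \<otimes> \<phi> \<one> = \<phi> (\<one> \<otimes> \<one>)" using assms 1 unfolding endo_on_def by metis
  also have "\<dots> = \<phi> \<one>" by simp
  finally have "\<phi> \<one> = \<one>" using m[OF 1(1)] c by (metis l_cancel_one)
  moreover have "\<phi> (inv x) \<otimes> \<phi> x = \<phi> (inv x \<otimes> x)" using assms 1 unfolding endo_on_def by metis
  ultimately have "\<phi> (inv x) \<otimes> \<phi> x = \<one>" using c assms(3) by simp
  then show ?thesis using m c 1 assms(3) by (metis inv_equality)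
qed

lemma endo_on_one:
  assumes "endo_on L \<phi>" "subgroup L G"
  shows "\<phi> \<one> = \<one>"
proof -
  have 1: "\<one> \<in> L" using assms subgroup.one_closed by metis
  have c: "\<phi> \<one> \<in> carrier G" using assms 1 subgroup.mem_carrier unfolding endo_on_def by metis
  have "\<phi> \<one> \<otimes> \<phi> \<one> = \<phi> (\<one> \<otimes> \<one>)" using assms 1 unfolding endo_on_def by metis
  then show ?thesis using c by (metis l_cancel_one l_one one_closed)
qed

lemma endo_on_preimage_fin_ind:
  assumes "endo_on L \<phi>" "fin_ind R L"
  shows "fin_ind {x\<in>L. \<phi> x \<in> R} L"
proof (rule fin_indI[where \<kappa> = "\<lambda>x. R #> \<phi> x"])
  note R = fin_indD[OF assms(2)]
  have m: "\<phi> y \<in> L" if "y \<in> L" for y using assms that by (auto simp: endo_on_def)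
  have mu: "\<phi> (x \<otimes> y) = \<phi> x \<otimes> \<phi> y" if "x \<in> L" "y \<in> L" for x y
    using assms that by (auto simp: endo_on_def)
  show "subgroup {x\<in>L. \<phi> x \<in> R} G"
  proof (rule subgroupI)
    show "{x\<in>L. \<phi> x \<in> R} \<subseteq> carrier G" using R subgroup.subset by blast
    have "\<one> \<in> {x\<in>L. \<phi> x \<in> R}"
      using endo_on_one[OF assms(1) R(2)] R by (auto simp: subgroup.one_closed)
    then show "{x\<in>L. \<phi> x \<in> R} \<noteq> {}" by blast
  qed (use R m mu endo_on_inv[OF assms(1) R(2)] in
      \<open>auto intro: subgroup.m_inv_closed subgroup.m_closed\<close>)
  have "(\<lambda>x. R #> \<phi> x) ` L \<subseteq> (\<lambda>x. R #> x) ` L" using m by auto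
  then show "finite ((\<lambda>x. R #> \<phi> x) ` L)" using R finite_subset by blast
  fix x y assume xy: "x \<in> L" "y \<in> L" "R #> \<phi> x = R #> \<phi> y"
  then have "\<phi> x \<otimes> inv (\<phi> y) \<in> R" by (intro fin_ind_coset[OF assms(2)] m)
  moreover have i: "inv y \<in> L" using xy R by (auto intro: subgroup.m_inv_closed)
  ultimately show "x \<otimes> inv y \<in> {x\<in>L. \<phi> x \<in> R}"
    using xy mu[OF _ i] endo_on_inv[OF assms(1) R(2)] R by (auto intro: subgroup.m_closed)
qed (use fin_indD[OF assms(2)] in auto)

definition fin_gen :: "'a set \<Rightarrow> bool" where
  "fin_gen L \<longleftrightarrow> (\<exists>X. finite X \<and> X \<subseteq> carrier G \<and> L = generate G X)"

lemma r_coset_mult_cancel: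
  assumes "C \<subseteq> carrier G" "x \<in> carrier G"
  shows "(C #> x) #> inv x = C" "(C #> inv x) #> x = C"
  using assms by (auto simp: coset_mult_assoc)

text \<open>The subgroups \<open>\<phi>\<^sup>-\<^sup>j R\<close> are stabilizers for actions of the finitely generated
  group \<open>L\<close> on one and the same finite set \<open>L / R\<close>, so there are only finitely many of them.\<close>

lemma invariant_fin_ind:
  assumes "endo_on L \<phi>" "fin_ind R L" "fin_gen L"
  obtains Q where "fin_ind Q L" "Q \<subseteq> R" "\<And>x. x \<in> Q \<Longrightarrow> \<phi> x \<in> Q"
proof -
  note R = fin_indD[OF assms(2)]
  obtain X where X: "finite X" "X \<subseteq> carrier G" "L = generate G X"
    using assms(3) by (auto simp: fin_gen_def)
  have XL: "X \<subseteq> L" using X generate.incl by (metis subsetI)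
  define C where "C = (\<lambda>x. R #> x) ` L"
  have finC: "finite C" using R by (simp add: C_def)
  have Ccl: "c #> x \<in> C" if "c \<in> C" "x \<in> L" for c x
  proof -
    obtain y where "y \<in> L" "c = R #> y" using \<open>c \<in> C\<close> by (auto simp: C_def)
    then have "c #> x = R #> (y \<otimes> x)"
      using that R by (auto simp: coset_mult_assoc subgroup.subset subgroup.mem_carrier)
    then show ?thesis unfolding C_def using \<open>y \<in> L\<close> that R by (auto intro!: imageI subgroup.m_closed)
  qed
  have Csub: "c \<subseteq> carrier G" if "c \<in> C" for c
    using that R by (auto simp: C_def r_coset_def dest: subgroup.mem_carrier)
  note e = endo_on_funpow[OF assms(1) R(2)]
  have eL: "(\<phi> ^^ j) x \<in> L" if "x \<in> L" for j x using e[of j] that by (auto simp: endo_on_def)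
  have em: "(\<phi> ^^ j) (x \<otimes> y) = (\<phi> ^^ j) x \<otimes> (\<phi> ^^ j) y" if "x \<in> L" "y \<in> L" for j x y
    using e[of j] that unfolding endo_on_def by blast
  note carr = subgroup.mem_carrier[OF R(2)]
  define E where "E j = {x\<in>L. (\<phi> ^^ j) x \<in> R}" for j
  \<comment> \<open>The action of \<open>x\<close> on cosets through \<open>\<phi>^j x\<close>,
    recorded on the generators only. Finite generation enters here: there are finitely many possible
    records.\<close>
  define \<tau> where "\<tau> j = (\<lambda>s\<in>X. \<lambda>c\<in>C. c #> (\<phi> ^^ j) s)" for j
  have "\<tau> j \<in> (\<Pi>\<^sub>E s\<in>X. \<Pi>\<^sub>E c\<in>C. C)" for j using Ccl eL XL by (auto simp: \<tau>_def)
  then have "range \<tau> \<subseteq> (\<Pi>\<^sub>E s\<in>X. \<Pi>\<^sub>E c\<in>C. C)" by blast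
  then have fin\<tau>: "finite (range \<tau>)"
    by (rule finite_subset) (auto intro!: finite_PiE X finC)
  have E_eq: "E i = E j" if ij: "\<tau> i = \<tau> j" for i j
  proof -
    have gen: "\<forall>c\<in>C. c #> (\<phi> ^^ i) s = c #> (\<phi> ^^ j) s" if "s \<in> X" for s
    proof
      fix c assume c: "c \<in> C"
      have "\<tau> i s c = \<tau> j s c" using ij by simp
      then show "c #> (\<phi> ^^ i) s = c #> (\<phi> ^^ j) s" using that c by (simp add: \<tau>_def)
    qed
    have all: "\<forall>c\<in>C. c #> (\<phi> ^^ i) x = c #> (\<phi> ^^ j) x" if "x \<in> generate G X" for x
      using that
    proof (induction rule: generate.induct)
      case one
      then show ?case using endo_on_one[OF e R(2)] by metis
    next
      case (incl h)
      then show ?case using gen by blast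
    next
      case (inv h)
      have hL: "h \<in> L" using inv XL by blast
      show ?case
      proof
        fix c assume c: "c \<in> C"
        let ?p = "(\<phi> ^^ i) h" and ?q = "(\<phi> ^^ j) h"
        have p: "?p \<in> L" "?q \<in> L" using eL hL by auto
        \<comment> \<open>Agreement on \<open>h\<close> is applied at \<open>c #> inv ?p\<close>
          instead of \<open>c\<close>; cancelling on the right turns it into agreement on
          \<open>inv h\<close>.\<close>
        let ?d = "c #> inv ?p"
        have d: "?d \<in> C" using Ccl[OF c] p R by (auto intro: subgroup.m_inv_closed)
        then have "?d #> ?p = ?d #> ?q" using gen[OF inv(1)] by blast
        then have "c = ?d #> ?q" using r_coset_mult_cancel[of c ?p] Csub[OF c] carr p by metis
        then have "c #> inv ?q = ?d"
          using r_coset_mult_cancel[of ?d ?q] Csub[OF d] carr p by metis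
        then show "c #> (\<phi> ^^ i) (inv h) = c #> (\<phi> ^^ j) (inv h)"
          using endo_on_inv[OF e R(2) hL] by simp
      qed
    next
      case (eng h1 h2)
      then have h: "h1 \<in> L" "h2 \<in> L" using X by auto
      show ?case
      proof
        fix c assume c: "c \<in> C"
        have "c #> (\<phi> ^^ k) (h1 \<otimes> h2) = (c #> (\<phi> ^^ k) h1) #> (\<phi> ^^ k) h2" for k
          using em[OF h] coset_mult_assoc[OF Csub[OF c]] carr eL h by simp
        then show "c #> (\<phi> ^^ i) (h1 \<otimes> h2) = c #> (\<phi> ^^ j) (h1 \<otimes> h2)"
          using eng.IH c Ccl[OF c eL[OF h(1)]] by metis
      qed
    qed
    have "R \<in> C"
      unfolding C_def using R
      by (intro image_eqI[where x = \<one>]) (auto simp: subgroup.one_closed subgroup.subset)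
    then have k: "R #> (\<phi> ^^ i) x = R #> (\<phi> ^^ j) x" if "x \<in> L" for x using all X that by blast
    have "x \<in> R \<longleftrightarrow> R #> x = R" if "x \<in> L" for x
      using that R carr by (metis coset_join1 coset_join2 subgroup.subset)
    then show ?thesis using k eL unfolding E_def by blast
  qed
  have "finite (range E)"
  proof -
    have "range E \<subseteq> (\<lambda>c. E (SOME j. \<tau> j = c)) ` range \<tau>"
    proof
      fix S assume "S \<in> range E"
      then obtain j where j: "S = E j" by blast
      have "\<tau> (SOME i. \<tau> i = \<tau> j) = \<tau> j" by (rule someI) simp
      then have "S = E (SOME i. \<tau> i = \<tau> j)" using E_eq j by metis
      then show "S \<in> (\<lambda>c. E (SOME j. \<tau> j = c)) ` range \<tau>" by blast
    qed
    then show ?thesis using fin\<tau> finite_surj by blast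
  qed
  moreover have "fin_ind (E j) L" for j
    unfolding E_def by (rule endo_on_preimage_fin_ind[OF e assms(2)])
  ultimately have 1: "fin_ind (\<Inter>(range E)) L" by (intro fin_ind_Inter) auto
  have 2: "\<Inter>(range E) \<subseteq> R"
  proof
    fix x assume "x \<in> \<Inter>(range E)"
    then have "x \<in> E 0" by blast
    then show "x \<in> R" by (simp add: E_def)
  qed
  \<comment> \<open>For \<open>x\<close> in \<open>L\<close>, lying in \<open>E (Suc j)\<close>
    means that \<open>\<phi> x\<close> lies in \<open>E j\<close>. The intersection over all
    \<open>j\<close> is therefore stable.\<close>
  have 3: "\<phi> x \<in> \<Inter>(range E)" if x: "x \<in> \<Inter>(range E)" for x
  proof (rule InterI)
    fix S assume "S \<in> range E"
    then obtain j where j: "S = E j" by blast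
    have "x \<in> E (Suc j)" "x \<in> E 0" using x by auto
    then show "\<phi> x \<in> S"
      using assms(1) unfolding j E_def by (auto simp: endo_on_def funpow_swap1)
  qed
  show ?thesis by (rule that[OF 1 2 3])
qed

text \<open>The core is the kernel of right multiplication on the finite set of cosets of
  \<open>R\<close>. Elements that permute the cosets in the same way lie in one coset of the kernel,
  and there are finitely many permutations.\<close>

lemma normal_core_fin_ind:
  assumes "fin_ind R (carrier G)"
  obtains N where "N \<lhd> G" "N \<subseteq> R" "fin_ind N (carrier G)"
proof -
  note R = fin_indD[OF assms]
  define C where "C = (\<lambda>x. R #> x) ` carrier G"
  have finC: "finite C" using R by (simp add: C_def)
  have Csub: "c \<subseteq> carrier G" if "c \<in> C" for c
    using that R by (auto simp: C_def r_coset_def dest: subgroup.mem_carrier)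
  have Ccl: "c #> x \<in> C" if "c \<in> C" "x \<in> carrier G" for c x
    using that R by (auto simp: C_def coset_mult_assoc subgroup.subset)
  define N where "N = {x\<in>carrier G. \<forall>c\<in>C. c #> x = c}"
  have inv: "c #> inv x = c" if "c \<in> C" "x \<in> N" for c x
    using that r_coset_mult_cancel[of c x] Csub unfolding N_def by auto
  have sub: "subgroup N G"
  proof (rule subgroupI)
    have "\<one> \<in> N" using Csub by (auto simp: N_def)
    then show "N \<noteq> {}" by blast
    show "inv x \<in> N" if "x \<in> N" for x using inv that by (auto simp: N_def)
    show "x \<otimes> y \<in> N" if "x \<in> N" "y \<in> N" for x y
      using that Csub by (simp add: N_def flip: coset_mult_assoc)
  qed (auto simp: N_def)
  have "N \<lhd> G"
  proof (rule normal_invI[OF sub])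
    fix x h assume x: "x \<in> carrier G" and h: "h \<in> N"
    have hc: "h \<in> carrier G" using h by (simp add: N_def)
    have "c #> (x \<otimes> h \<otimes> inv x) = c" if c: "c \<in> C" for c
    proof -
      have "c #> (x \<otimes> h \<otimes> inv x) = ((c #> x) #> h) #> inv x"
        using x hc Csub[OF c] by (simp add: coset_mult_assoc r_coset_subset_G m_assoc)
      also have "(c #> x) #> h = c #> x" using h Ccl[OF c x] by (simp add: N_def)
      finally show ?thesis using r_coset_mult_cancel Csub[OF c] x by simp
    qed
    then show "x \<otimes> h \<otimes> inv x \<in> N" using x hc by (simp add: N_def)
  qed
  moreover have "N \<subseteq> R"
  proof
    fix x assume x: "x \<in> N"
    have "R \<in> C"
      unfolding C_def using R
      by (intro image_eqI[where x = \<one>]) (auto simp: subgroup.subset)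
    then have "R #> x = R" using x by (simp add: N_def)
    then show "x \<in> R" using x R by (metis (lifting) N_def coset_join1 mem_Collect_eq subgroup.subset)
  qed
  moreover have "fin_ind N (carrier G)"
  proof (rule fin_indI[where \<kappa> = "\<lambda>x. \<lambda>c\<in>C. c #> x"])
    have "(\<lambda>x. \<lambda>c\<in>C. c #> x) ` carrier G \<subseteq> (\<Pi>\<^sub>E c\<in>C. C)" using Ccl by auto
    then show "finite ((\<lambda>x. \<lambda>c\<in>C. c #> x) ` carrier G)"
      by (rule finite_subset) (auto intro!: finite_PiE finC)
    fix x y assume xy: "x \<in> carrier G" "y \<in> carrier G" "(\<lambda>c\<in>C. c #> x) = (\<lambda>c\<in>C. c #> y)"
    have "c #> (x \<otimes> inv y) = c" if c: "c \<in> C" for c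
    proof -
      have "c #> x = c #> y" using fun_cong[OF xy(3), of c] c by simp
      then have "(c #> x) #> inv y = c" using r_coset_mult_cancel Csub[OF c] xy by simp
      then show ?thesis using xy Csub[OF c] by (simp add: coset_mult_assoc)
    qed
    then show "x \<otimes> inv y \<in> N" using xy by (simp add: N_def)
  qed (use sub R in \<open>auto simp: N_def\<close>)
  ultimately show ?thesis using that by blast
qed

end

section \<open>Homogeneous cochains\<close>

text \<open>The simplicial differential on functions of a tuple, which is here a list. A cochain of degree
  \<open>n\<close> is a function of lists of length \<open>n + 1\<close>; the empty list gives an augmented complex.\<close>

fun cdiff :: "('a list \<Rightarrow> 'v::ab_group_add) \<Rightarrow> 'a list \<Rightarrow> 'v" where
  "cdiff f [] = 0"
| "cdiff f (x # xs) = f xs - cdiff (\<lambda>ys. f (x # ys)) xs"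

lemma cdiff_add: "cdiff (\<lambda>ys. f ys + g ys) xs = cdiff f xs + cdiff g xs"
  by (induction xs arbitrary: f g) auto

lemma cdiff_diff: "cdiff (\<lambda>ys. f ys - g ys) xs = cdiff f xs - cdiff g xs"
  by (induction xs arbitrary: f g) auto

lemma cdiff_cdiff: "cdiff (cdiff f) xs = 0"
  by (induction xs arbitrary: f) (auto simp: cdiff_diff)

lemma cdiff_cong:
  assumes "\<And>ys. Suc (length ys) = length xs \<Longrightarrow> set ys \<subseteq> set xs \<Longrightarrow> f ys = g ys"
  shows "cdiff f xs = cdiff g xs"
  using assms
proof (induction xs arbitrary: f g)
  case (Cons x xs)
  have "cdiff (\<lambda>ys. f (x # ys)) xs = cdiff (\<lambda>ys. g (x # ys)) xs"
    by (rule Cons.IH, rule Cons.prems) auto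
  moreover have "f xs = g xs" by (rule Cons.prems) auto
  ultimately show ?case by simp
qed simp

lemma cdiff_map: "cdiff (\<lambda>ys. f (map k ys)) xs = cdiff f (map k xs)"
  by (induction xs arbitrary: f) auto

lemma cdiff_hom:
  assumes "\<And>u v. \<alpha> (u - v) = \<alpha> u - \<alpha> v"
  shows "cdiff (\<lambda>ys. \<alpha> (f ys)) xs = \<alpha> (cdiff f xs)"
proof -
  have "\<alpha> 0 = 0" using assms[of 0 0] by simp
  then show ?thesis by (induction xs arbitrary: f) (auto simp: assms)
qed

text \<open>Faces that omit an entry of \<open>ys\<close> are separated from those that omit an
  entry of \<open>zs\<close>; the latter carry the sign accumulated along \<open>ys\<close>. This
  allows the leading entries to be treated as parameters.\<close>

lemma cdiff_append:
  "cdiff f (ys @ zs) =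
     cdiff (\<lambda>us. f (us @ zs)) ys + (if even (length ys) then id else uminus) (cdiff (\<lambda>vs. f (ys @ vs)) zs)"
  by (induction ys arbitrary: f) auto

text \<open>The values lie in a finite set \<open>V\<close> inside a type. Additivity of the action
  is asked on the whole type, so that \<open>cdiff\<close> commutes with it without tracking
  membership in \<open>V\<close>.\<close>

locale fin_module = group G for G :: "('a, 'm) monoid_scheme" (structure) +
  fixes V :: "'v::ab_group_add set" and act :: "'a \<Rightarrow> 'v \<Rightarrow> 'v"
  assumes finite_V: "finite V"
    and zero_V: "0 \<in> V"
    and diff_V: "u \<in> V \<Longrightarrow> v \<in> V \<Longrightarrow> u - v \<in> V"
    and act_V: "s \<in> carrier G \<Longrightarrow> v \<in> V \<Longrightarrow> act s v \<in> V"
    and act_diff: "s \<in> carrier G \<Longrightarrow> act s (u - v) = act s u - act s v"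
    and act_mult: "s \<in> carrier G \<Longrightarrow> t \<in> carrier G \<Longrightarrow> act (s \<otimes> t) v = act s (act t v)"
    and act_one: "act \<one> v = v"
begin

lemma add_V: "u \<in> V \<Longrightarrow> v \<in> V \<Longrightarrow> u + v \<in> V"
  using diff_V[of u "0 - v"] diff_V[of 0 v] zero_V by simp

lemma uminus_V: "v \<in> V \<Longrightarrow> - v \<in> V"
  using diff_V[of 0 v] zero_V by simp

lemma act_zero: "s \<in> carrier G \<Longrightarrow> act s 0 = 0"
  using act_diff[of s 0 0] by simp

lemma act_uminus: "s \<in> carrier G \<Longrightarrow> act s (- v) = - act s v"
  using act_diff[of s 0 v] by (simp add: act_zero)

lemma act_add: "s \<in> carrier G \<Longrightarrow> act s (u + v) = act s u + act s v"
  using act_diff[of s u "- v"] by (simp add: act_uminus)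

lemma act_act_inv: "s \<in> carrier G \<Longrightarrow> act s (act (inv s) v) = v"
  by (simp add: act_one flip: act_mult)

definition tup :: "nat \<Rightarrow> 'a list set" where
  "tup n = {xs. length xs = n \<and> set xs \<subseteq> carrier G}"

definition shift :: "'a \<Rightarrow> 'a list \<Rightarrow> 'a list" where
  "shift s xs = map (\<lambda>x. s \<otimes> x) xs"

lemma shift_tup: "s \<in> carrier G \<Longrightarrow> xs \<in> tup n \<Longrightarrow> shift s xs \<in> tup n"
  by (auto simp: tup_def shift_def)

lemma shift_simps [simp]:
  "shift s [] = []" "shift s (x # xs) = (s \<otimes> x) # shift s xs"
  "shift s (xs @ ys) = shift s xs @ shift s ys" "length (shift s xs) = length xs"
  by (auto simp: shift_def)

lemma shift_mult:
  "s \<in> carrier G \<Longrightarrow> t \<in> carrier G \<Longrightarrow> xs \<in> tup n \<Longrightarrow> shift (s \<otimes> t) xs = shift s (shift t xs)"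
  by (auto simp: tup_def shift_def m_assoc)

lemma shift_one: "xs \<in> tup n \<Longrightarrow> shift \<one> xs = xs"
  by (auto simp: tup_def shift_def intro!: map_idI)

lemma shift_inv: 
  "s \<in> carrier G \<Longrightarrow> xs \<in> tup n \<Longrightarrow> shift (inv s) (shift s xs) = xs"
  "s \<in> carrier G \<Longrightarrow> xs \<in> tup n \<Longrightarrow> shift s (shift (inv s) xs) = xs"
  by (simp_all add: shift_one flip: shift_mult)

lemma tup_Cons: "x # xs \<in> tup (Suc n) \<longleftrightarrow> x \<in> carrier G \<and> xs \<in> tup n"
  by (auto simp: tup_def)

lemma tup_SucE:
  assumes "xs \<in> tup (Suc n)"
  obtains y ys where "xs = y # ys" "y \<in> carrier G" "ys \<in> tup n"
  using assms by (cases xs) (auto simp: tup_def)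

text \<open>The index \<open>n\<close> in \<open>coch n S\<close>, \<open>zc n S\<close> and \<open>bc n S\<close> is the number of arguments, hence the degree
  plus one. As \<open>G\<close> is a free \<open>S\<close>-set, \<open>S\<close>-equivariant functions of tuples in \<open>G\<close>, and not only
  in \<open>S\<close>, compute the cohomology of \<open>S\<close>.\<close>

definition coch :: "nat \<Rightarrow> 'a set \<Rightarrow> ('a list \<Rightarrow> 'v) set" where
  "coch n S = {f. \<forall>xs\<in>tup n. f xs \<in> V \<and> (\<forall>s\<in>S. f (shift s xs) = act s (f xs))}"

definition zc :: "nat \<Rightarrow> 'a set \<Rightarrow> ('a list \<Rightarrow> 'v) set" where
  "zc n S = {f \<in> coch n S. \<forall>xs\<in>tup (Suc n). cdiff f xs = 0}"

definition bc :: "nat \<Rightarrow> 'a set \<Rightarrow> ('a list \<Rightarrow> 'v) set" where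
  "bc n S = {f. \<exists>g\<in>coch (n - 1) S. \<forall>xs\<in>tup n. f xs = cdiff g xs}"

lemma cochI:
  assumes "\<And>xs. xs \<in> tup n \<Longrightarrow> f xs \<in> V"
    and "\<And>xs s. xs \<in> tup n \<Longrightarrow> s \<in> S \<Longrightarrow> f (shift s xs) = act s (f xs)"
  shows "f \<in> coch n S"
  using assms by (auto simp: coch_def)

lemma coch_V: "f \<in> coch n S \<Longrightarrow> xs \<in> tup n \<Longrightarrow> f xs \<in> V"
  and coch_shift: "f \<in> coch n S \<Longrightarrow> xs \<in> tup n \<Longrightarrow> s \<in> S \<Longrightarrow> f (shift s xs) = act s (f xs)"
  by (auto simp: coch_def)

lemma coch_mono: "R \<subseteq> S \<Longrightarrow> coch n S \<subseteq> coch n R"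
  by (auto simp: coch_def)

lemma zc_mono: "R \<subseteq> S \<Longrightarrow> zc n S \<subseteq> zc n R"
  using coch_mono[of R S n] by (auto simp: zc_def)

lemma bc_mono: "R \<subseteq> S \<Longrightarrow> bc n S \<subseteq> bc n R"
  using coch_mono[of R S "n - 1"] by (auto simp: bc_def)

lemma coch_cong:
  assumes "f \<in> coch n S" "S \<subseteq> carrier G" "\<And>xs. xs \<in> tup n \<Longrightarrow> g xs = f xs"
  shows "g \<in> coch n S"
  using assms shift_tup by (auto simp: coch_def subset_iff)

lemma coch_diff:
  assumes "f \<in> coch n S" "g \<in> coch n S" "S \<subseteq> carrier G"
  shows "(\<lambda>xs. f xs - g xs) \<in> coch n S"
  using assms by (auto simp: coch_def diff_V act_diff subset_iff)

lemma coch_add: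
  assumes "f \<in> coch n S" "g \<in> coch n S" "S \<subseteq> carrier G"
  shows "(\<lambda>xs. f xs + g xs) \<in> coch n S"
  using assms by (auto simp: coch_def add_V act_add subset_iff)

lemma coch_zero: "S \<subseteq> carrier G \<Longrightarrow> (\<lambda>xs. 0) \<in> coch n S"
  by (auto simp: coch_def zero_V act_zero)

lemma cdiff_tup_cong:
  assumes "xs \<in> tup (Suc n)" "\<And>ys. ys \<in> tup n \<Longrightarrow> f ys = g ys"
  shows "cdiff f xs = cdiff g xs"
  by (rule cdiff_cong) (use assms in \<open>auto simp: tup_def\<close>)

lemma cdiff_V:
  assumes "xs \<in> tup (Suc n)" "\<And>ys. ys \<in> tup n \<Longrightarrow> f ys \<in> V"
  shows "cdiff f xs \<in> V"
  using assms
proof (induction n arbitrary: xs f)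
  case 0
  then show ?case by (cases xs) (auto simp: tup_def)
next
  case (Suc n)
  from Suc.prems(1) obtain y ys where y: "xs = y # ys" "y \<in> carrier G" "ys \<in> tup (Suc n)"
    by (rule tup_SucE)
  have "cdiff (\<lambda>zs. f (y # zs)) ys \<in> V"
    by (rule Suc.IH) (use y Suc.prems in \<open>auto simp: tup_Cons\<close>)
  then show ?case using y Suc.prems(2) by (auto intro: diff_V)
qed

lemma cdiff_shift:
  assumes "s \<in> carrier G" "xs \<in> tup (Suc n)" "\<And>ys. ys \<in> tup n \<Longrightarrow> f (shift s ys) = act s (f ys)"
  shows "cdiff f (shift s xs) = act s (cdiff f xs)"
proof -
  have "cdiff f (shift s xs) = cdiff (\<lambda>ys. f (shift s ys)) xs"
    by (simp add: shift_def cdiff_map)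
  also have "\<dots> = cdiff (\<lambda>ys. act s (f ys)) xs"
    by (rule cdiff_tup_cong) (use assms in auto)
  finally show ?thesis using cdiff_hom[of "act s" f] act_diff[OF assms(1)] by simp
qed

lemma cdiff_coch:
  assumes "f \<in> coch n S" "S \<subseteq> carrier G"
  shows "cdiff f \<in> coch (Suc n) S"
  by (rule cochI) (use assms in \<open>auto intro!: cdiff_V cdiff_shift simp: coch_V coch_shift\<close>)

section \<open>Translation of cochains\<close>

text \<open>The conjugation action on cochains: it carries equivariance under \<open>S\<close> to
  equivariance under \<open>s S s^-1\<close>, and its fixed points under \<open>s\<close> are the
  cochains equivariant under \<open>s\<close>.\<close>

definition tr :: "'a \<Rightarrow> ('a list \<Rightarrow> 'v) \<Rightarrow> 'a list \<Rightarrow> 'v" where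
  "tr s f xs = act s (f (shift (inv s) xs))"

lemma tr_coch:
  assumes "f \<in> coch n S" "s \<in> carrier G" "R \<subseteq> carrier G" "\<And>x. x \<in> R \<Longrightarrow> inv s \<otimes> x \<otimes> s \<in> S"
  shows "tr s f \<in> coch n R"
proof (rule cochI)
  fix xs assume xs: "xs \<in> tup n"
  show "tr s f xs \<in> V"
    unfolding tr_def using assms xs by (auto intro!: act_V coch_V[of f n S] shift_tup)
  fix x assume x: "x \<in> R"
  then have xc: "x \<in> carrier G" using assms by auto
  have "shift (inv s) (shift x xs) = shift (inv s \<otimes> x \<otimes> s) (shift (inv s) xs)"
  proof -
    have "shift (inv s \<otimes> x \<otimes> s) (shift (inv s) xs) = shift (inv s \<otimes> x) (shift s (shift (inv s) xs))"
      using assms(2) xs xc by (intro shift_mult) (auto intro: shift_tup)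
    also have "\<dots> = shift (inv s) (shift x xs)"
      using assms(2) xs xc by (simp add: shift_inv shift_mult[where n = n])
    finally show ?thesis by simp
  qed
  then have "f (shift (inv s) (shift x xs)) = act (inv s \<otimes> x \<otimes> s) (f (shift (inv s) xs))"
    using coch_shift[OF assms(1) _ assms(4)[OF x]] shift_tup[of "inv s" xs n] xs assms(2) by simp
  then show "tr s f (shift x xs) = act x (tr s f xs)"
    using assms(2) xc by (simp add: tr_def m_assoc flip: act_mult)
      (simp flip: m_assoc)
qed

lemma cdiff_tr: "s \<in> carrier G \<Longrightarrow> cdiff (tr s f) xs = tr s (cdiff f) xs"
  unfolding tr_def shift_def
  by (subst cdiff_hom) (simp_all add: act_diff cdiff_map)

lemma tr_invariant:
  assumes "f \<in> coch n S" "s \<in> S" "S \<subseteq> carrier G" "xs \<in> tup n"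
  shows "tr s f xs = f xs"
proof -
  have "s \<in> carrier G" using assms by auto
  then have "act s (f (shift (inv s) xs)) = f (shift s (shift (inv s) xs))"
    using assms by (subst coch_shift[OF assms(1)]) (auto intro: shift_tup)
  then show ?thesis using assms \<open>s \<in> carrier G\<close> by (simp add: tr_def shift_inv)
qed

lemma tr_mult:
  assumes "s \<in> carrier G" "t \<in> carrier G" "xs \<in> tup n"
  shows "tr (s \<otimes> t) f xs = tr s (tr t f) xs"
  using assms shift_tup[of "inv s" xs n]
  by (simp add: tr_def act_mult inv_mult_group shift_mult)

lemma tr_one: "xs \<in> tup n \<Longrightarrow> tr \<one> f xs = f xs"
  by (simp add: tr_def shift_one act_one)

lemma tr_cong: "s \<in> carrier G \<Longrightarrow> xs \<in> tup n \<Longrightarrow> (\<And>ys. ys \<in> tup n \<Longrightarrow> f ys = g ys) \<Longrightarrow> tr s f xs = tr s g xs"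
  by (simp add: tr_def shift_tup)

lemma tr_diff: "s \<in> carrier G \<Longrightarrow> tr s (\<lambda>ys. f ys - g ys) xs = tr s f xs - tr s g xs"
  by (simp add: tr_def act_diff)

text \<open>Equivariance amounts to being fixed by translations. As the translations that fix
  \<open>f\<close> form a group, it suffices to test generators, or to pass to powers of one
  element.\<close>

lemma stabilizer_subgroup:
  "subgroup {s \<in> carrier G. \<forall>xs\<in>tup n. tr s f xs = f xs} G"
proof (rule subgroupI)
  have "\<one> \<in> {s \<in> carrier G. \<forall>xs\<in>tup n. tr s f xs = f xs}" by (simp add: tr_one)
  then show "{s \<in> carrier G. \<forall>xs\<in>tup n. tr s f xs = f xs} \<noteq> {}" by blast
next
  fix s assume s: "s \<in> {s \<in> carrier G. \<forall>xs\<in>tup n. tr s f xs = f xs}"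
  then have sc: "s \<in> carrier G" by simp
  have "tr (inv s) f xs = f xs" if xs: "xs \<in> tup n" for xs
  proof -
    have "tr (inv s) f xs = tr (inv s) (tr s f) xs"
      using s xs by (intro tr_cong) auto
    also have "\<dots> = f xs" using sc xs by (simp add: tr_one flip: tr_mult[where n = n])
    finally show ?thesis .
  qed
  then show "inv s \<in> {s \<in> carrier G. \<forall>xs\<in>tup n. tr s f xs = f xs}" using sc by simp
next
  fix s t assume "s \<in> {s \<in> carrier G. \<forall>xs\<in>tup n. tr s f xs = f xs}"
    "t \<in> {s \<in> carrier G. \<forall>xs\<in>tup n. tr s f xs = f xs}"
  then have st: "s \<in> carrier G" "t \<in> carrier G" "\<And>xs. xs \<in> tup n \<Longrightarrow> tr s f xs = f xs"
      "\<And>xs. xs \<in> tup n \<Longrightarrow> tr t f xs = f xs" by auto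
  have "tr (s \<otimes> t) f xs = f xs" if xs: "xs \<in> tup n" for xs
    using tr_mult[OF st(1,2) xs] tr_cong[OF st(1) xs, of "tr t f" f] st(3,4) xs by simp
  then show "s \<otimes> t \<in> {s \<in> carrier G. \<forall>xs\<in>tup n. tr s f xs = f xs}" using st by simp
qed auto

lemma coch_iff_tr:
  assumes "subgroup S G"
  shows "f \<in> coch n S \<longleftrightarrow> (\<forall>xs\<in>tup n. f xs \<in> V) \<and> (\<forall>s\<in>S. \<forall>xs\<in>tup n. tr s f xs = f xs)"
proof safe
  note c = subgroup.mem_carrier[OF assms]
  assume f: "f \<in> coch n S"
  show "f xs \<in> V" if "xs \<in> tup n" for xs using f that by (simp add: coch_V)
  show "tr s f xs = f xs" if "s \<in> S" "xs \<in> tup n" for s xs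
    using tr_invariant f that subgroup.subset[OF assms] by blast
next
  note c = subgroup.mem_carrier[OF assms]
  assume V: "\<forall>xs\<in>tup n. f xs \<in> V" and t: "\<forall>s\<in>S. \<forall>xs\<in>tup n. tr s f xs = f xs"
  show "f \<in> coch n S"
  proof (rule cochI)
    fix xs s assume "xs \<in> tup n" "s \<in> S"
    then have "tr s f (shift s xs) = f (shift s xs)" using t shift_tup c by blast
    then show "f (shift s xs) = act s (f xs)"
      using \<open>xs \<in> tup n\<close> \<open>s \<in> S\<close> c by (simp add: tr_def shift_inv)
  qed (use V in auto)
qed

text \<open>Degree 0 is harmless because the complex is augmented: a cocycle is a constant function,
  and its value, invariant under \<open>S\<close>, is a cochain on the empty list.\<close>

lemma zc_one_bc:
  assumes "f \<in> zc 1 S" "S \<subseteq> carrier G"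
  shows "f \<in> bc 1 S"
proof -
  have eq: "f [x] = f [y]" if "x \<in> carrier G" "y \<in> carrier G" for x y
  proof -
    have "[x, y] \<in> tup (Suc 1)" using that by (simp add: tup_def)
    then have "cdiff f [x, y] = 0" using assms(1) unfolding zc_def by blast
    then show ?thesis by simp
  qed
  have f: "f \<in> coch 1 S" using assms by (simp add: zc_def)
  let ?g = "\<lambda>xs :: 'a list. f [\<one>]"
  have "?g \<in> coch 0 S"
  proof (rule cochI)
    show "f [\<one>] \<in> V" using coch_V[OF f, of "[\<one>]"] by (simp add: tup_def)
    fix s assume "s \<in> S"
    then show "f [\<one>] = act s (f [\<one>])"
      using coch_shift[OF f, of "[\<one>]" s] eq[of s \<one>] assms by (auto simp: tup_def)
  qed
  moreover have "f xs = cdiff ?g xs" if "xs \<in> tup 1" for xs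
    using that eq by (cases xs) (auto simp: tup_def)
  ultimately show ?thesis by (auto simp: bc_def)
qed

text \<open>Inserting the unit in front is the usual contracting homotopy. It is not equivariant
  under translations, which does no harm for the trivial group.\<close>

lemma zc_trivial_bc:
  assumes "f \<in> zc (Suc n) {\<one>}"
  shows "f \<in> bc (Suc n) {\<one>}"
proof -
  have f: "f \<in> coch (Suc n) {\<one>}" using assms by (simp add: zc_def)
  let ?g = "\<lambda>ys. f (\<one> # ys)"
  have "?g \<in> coch n {\<one>}"
    by (rule cochI) (auto simp: shift_one act_one intro!: coch_V[OF f] simp: tup_Cons)
  moreover have "f xs = cdiff ?g xs" if "xs \<in> tup (Suc n)" for xs
  proof -
    have "\<one> # xs \<in> tup (Suc (Suc n))" using that by (simp add: tup_Cons)
    then have "cdiff f (\<one> # xs) = 0" using assms by (auto simp: zc_def)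
    then show ?thesis by simp
  qed
  ultimately show ?thesis by (auto simp: bc_def)
qed

end

section \<open>Compactness of the space of cochains\<close>

lemma continuous_map_discrete_bin:
  assumes "continuous_map X (discrete_topology UNIV) f" "continuous_map X (discrete_topology UNIV) g"
  shows "continuous_map X (discrete_topology UNIV) (\<lambda>x. F (f x) (g x))"
proof -
  have "continuous_map X (prod_topology (discrete_topology UNIV) (discrete_topology UNIV)) (\<lambda>x. (f x, g x))"
    using assms by (simp add: continuous_map_pairwise o_def)
  then have "continuous_map X (discrete_topology UNIV) ((\<lambda>p. F (fst p) (snd p)) \<circ> (\<lambda>x. (f x, g x)))"
    by (rule continuous_map_compose) (simp flip: prod_topology_discrete_topology)
  then show ?thesis by (simp add: o_def)
qed

lemma closedin_discrete_eq:
  assumes "continuous_map X (discrete_topology UNIV) f" "continuous_map X (discrete_topology UNIV) g"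
  shows "closedin X {x \<in> topspace X. f x = g x}"
proof -
  have "continuous_map X (discrete_topology UNIV) (\<lambda>x. f x = g x)"
    using continuous_map_discrete_bin[OF assms, of "(=)"] .
  from closedin_continuous_map_preimage[OF this, of "{True}"] show ?thesis by simp
qed

context fin_module
begin

text \<open>The primitives of \<open>f\<close> invariant under \<open>S i\<close> form a decreasing sequence of nonempty closed
  sets in the compact space of all \<open>V\<close>-valued cochains.\<close>

lemma bc_ascending_union:
  fixes S :: "nat \<Rightarrow> 'a set"
  assumes "\<And>i. S i \<subseteq> S (Suc i)" "\<And>i. S i \<subseteq> carrier G" "\<And>i. f \<in> bc (Suc n) (S i)"
  shows "f \<in> bc (Suc n) (\<Union>i. S i)"
proof -
  define X where "X = product_topology (\<lambda>_ :: 'a list. discrete_topology V) (tup n)"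
  define K where "K i = {g \<in> topspace X. g \<in> coch n (S i) \<and> (\<forall>xs\<in>tup (Suc n). f xs = cdiff g xs)}" for i
  have topX: "topspace X = (\<Pi>\<^sub>E xs\<in>tup n. V)" by (simp add: X_def)
  have cont: "continuous_map X (discrete_topology UNIV) (\<lambda>g. g xs)" if "xs \<in> tup n" for xs
  proof -
    have "continuous_map X (discrete_topology V) (\<lambda>g. g xs)"
      unfolding X_def by (rule continuous_map_product_projection[OF that])
    then have "continuous_map X (subtopology (discrete_topology UNIV) V) (\<lambda>g. g xs)"
      by (simp add: subtopology_discrete_topology)
    then show ?thesis by (rule continuous_map_into_fulltopology)
  qed
  \<comment> \<open>The prefix \<open>ys\<close> generalizes the induction: the recursion of
    \<open>cdiff\<close> moves the head of its argument into the function.\<close>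
  have cont_cdiff: "continuous_map X (discrete_topology UNIV) (\<lambda>g. cdiff (\<lambda>zs. g (ys @ zs)) xs)"
    if "ys @ xs \<in> tup (Suc n)" for xs ys
    using that
  proof (induction xs arbitrary: ys)
    case (Cons x xs)
    have "continuous_map X (discrete_topology UNIV) (\<lambda>g. cdiff (\<lambda>zs. g ((ys @ [x]) @ zs)) xs)"
      using Cons by (intro Cons.IH) simp
    moreover have "continuous_map X (discrete_topology UNIV) (\<lambda>g. g (ys @ xs))"
      using Cons.prems by (intro cont) (auto simp: tup_def)
    ultimately show ?case using continuous_map_discrete_bin[of X _ _ "(-)"] by simp
  qed simp
  have "closedin X (K i)" for i
  proof -
    \<comment> \<open>Each condition on \<open>g\<close> involves finitely many coordinates and so
      is closed; there may be infinitely many conditions.\<close>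
    have "K i = topspace X \<inter>
        \<Inter> ({{g \<in> topspace X. g (shift s xs) = act s (g xs)} | s xs. s \<in> S i \<and> xs \<in> tup n} \<union>
           {{g \<in> topspace X. f xs = cdiff g xs} | xs. xs \<in> tup (Suc n)})"
      (is "_ = _ \<inter> \<Inter>?F")
    proof (intro equalityI subsetI)
      fix g assume "g \<in> K i"
      then show "g \<in> topspace X \<inter> \<Inter>?F" by (auto simp: K_def coch_shift)
    next
      fix g assume g: "g \<in> topspace X \<inter> \<Inter>?F"
      then have gF: "g \<in> T" if "T \<in> ?F" for T using that by blast
      have "g (shift s xs) = act s (g xs)" if "s \<in> S i" "xs \<in> tup n" for s xs
        using gF[of "{g \<in> topspace X. g (shift s xs) = act s (g xs)}"] that by blast
      then have "g \<in> coch n (S i)"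
        using g by (intro cochI) (auto simp: topX)
      moreover have "f xs = cdiff g xs" if "xs \<in> tup (Suc n)" for xs
        using gF[of "{g \<in> topspace X. f xs = cdiff g xs}"] that by blast
      ultimately show "g \<in> K i" using g by (simp add: K_def)
    qed
    moreover have "closedin X T" if "T \<in> ?F" for T
      using that
    proof (elim UnE CollectE exE conjE)
      fix s xs assume T: "T = {g \<in> topspace X. g (shift s xs) = act s (g xs)}" "s \<in> S i" "xs \<in> tup n"
      have "s \<in> carrier G" using assms(2) T by blast
      then have "continuous_map X (discrete_topology UNIV) (\<lambda>g. g (shift s xs))"
        using T by (intro cont shift_tup)
      moreover have "continuous_map X (discrete_topology UNIV) (\<lambda>g. act s (g xs))"
        using continuous_map_discrete_bin[OF cont[OF T(3)] cont[OF T(3)], of "\<lambda>u v. act s u"] .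
      ultimately show "closedin X T" unfolding T by (rule closedin_discrete_eq)
    next
      fix xs assume T: "T = {g \<in> topspace X. f xs = cdiff g xs}" "xs \<in> tup (Suc n)"
      have "continuous_map X (discrete_topology UNIV) (\<lambda>g. f xs)" by simp
      moreover have "continuous_map X (discrete_topology UNIV) (\<lambda>g. cdiff g xs)"
        using cont_cdiff[of "[]" xs] T by simp
      ultimately show "closedin X T" unfolding T by (rule closedin_discrete_eq)
    qed
    then have "closedin X (\<Inter>(insert (topspace X) ?F))"
      by (intro closedin_Inter) blast+
    ultimately show ?thesis by simp
  qed
  moreover have "K i \<noteq> {}" for i
  proof -
    from assms(3)[of i] obtain g where g: "g \<in> coch n (S i)" "\<And>xs. xs \<in> tup (Suc n) \<Longrightarrow> f xs = cdiff g xs"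
      by (auto simp: bc_def)
    \<comment> \<open>Points of the product space are extensional, so a primitive has to be cut down
      to the tuples of the right length.\<close>
    let ?g = "restrict g (tup n)"
    have "?g \<in> coch n (S i)" by (rule coch_cong[OF g(1) assms(2)]) simp
    moreover have "f xs = cdiff ?g xs" if "xs \<in> tup (Suc n)" for xs
      using g(2)[OF that] cdiff_tup_cong[OF that, of ?g g] by simp
    moreover have "?g \<in> topspace X" using coch_V[OF g(1)] by (auto simp: topX)
    ultimately show ?thesis by (auto simp: K_def)
  qed
  moreover have "K (Suc i) \<subseteq> K i" for i
    using coch_mono[OF assms(1)] by (auto simp: K_def)
  then have "decseq K" by (rule decseq_SucI)
  moreover have "compact_space X"
    unfolding X_def using finite_V by (simp add: compact_space_product_topology compact_space_discrete_topology)
  ultimately have "(\<Inter>i. K i) \<noteq> {}"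
    using compact_space_imp_nest[of X K] by blast
  then obtain g where g: "g \<in> K i" for i by blast
  have "g \<in> coch n (\<Union>i. S i)"
    using g by (auto simp: K_def coch_def)
  then show ?thesis using g[of 0] by (auto simp: K_def bc_def)
qed

end

section \<open>Cyclic extensions and ascending unions\<close>

text \<open>The discrete antiderivative of \<open>a\<close> on the integers with value 0 at 0. On
  the negative side the sum runs from \<open>j\<close> to \<open>- 1\<close> and is negated.\<close>

definition int_sum :: "(int \<Rightarrow> 'v::ab_group_add) \<Rightarrow> int \<Rightarrow> 'v" where
  "int_sum a j = (if 0 \<le> j then \<Sum>i<nat j. a (int i) else - (\<Sum>i<nat (- j). a (- 1 - int i)))"

lemma int_sum_zero [simp]: "int_sum a 0 = 0"
  by (simp add: int_sum_def)

lemma int_sum_step: "int_sum a (j + 1) = int_sum a j + a j"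
proof (cases "0 \<le> j")
  case True
  then have "nat (j + 1) = Suc (nat j)" by simp
  then show ?thesis using True by (simp add: int_sum_def)
next
  case False
  then have "j = - 1 - int (nat (- 1 - j))" by simp
  then obtain i where j: "j = - 1 - int i" ..
  then have *: "nat (- j) = Suc i" "nat (- (j + 1)) = i" by auto
  show ?thesis
  proof (cases "i = 0")
    case True
    then show ?thesis using j by (simp add: int_sum_def)
  next
    case False
    then have "\<not> 0 \<le> j + 1" "\<not> 0 \<le> j" using j by auto
    then show ?thesis using * j by (simp add: int_sum_def)
  qed
qed

lemma int_sequence_eqI:
  fixes c d :: "int \<Rightarrow> 'v::ab_group_add"
  assumes "c 0 = d 0" "\<And>j. c (j + 1) - c j = d (j + 1) - d j"
  shows "c j = d j"
proof (induction j rule: int_induct[of _ 0])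
  case (step1 i)
  then show ?case using assms(2)[of i] by simp
next
  case (step2 i)
  then show ?case using assms(2)[of "i - 1"] by simp
qed (rule assms(1))

lemma int_sum_hom:
  assumes "\<And>u v. \<alpha> (u - v) = \<alpha> u - \<alpha> v"
  shows "\<alpha> (int_sum a j) = int_sum (\<lambda>i. \<alpha> (a i)) j"
proof (rule int_sequence_eqI)
  show "\<alpha> (int_sum a 0) = int_sum (\<lambda>i. \<alpha> (a i)) 0" using assms[of 0 0] by simp
  show "\<alpha> (int_sum a (j + 1)) - \<alpha> (int_sum a j) =
      int_sum (\<lambda>i. \<alpha> (a i)) (j + 1) - int_sum (\<lambda>i. \<alpha> (a i)) j" for j
    by (simp add: int_sum_step flip: assms)
qed

lemma int_sum_shift: "int_sum (\<lambda>i. a (i + 1)) j = int_sum a (j + 1) - a 0"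
proof (rule int_sequence_eqI[where c = "int_sum (\<lambda>i. a (i + 1))" and d = "\<lambda>j. int_sum a (j + 1) - a 0"])
  show "int_sum (\<lambda>i. a (i + 1)) 0 = int_sum a (0 + 1) - a 0" 
    using int_sum_step[of a 0] by simp
  fix j
  show "int_sum (\<lambda>i. a (i + 1)) (j + 1) - int_sum (\<lambda>i. a (i + 1)) j =
      (int_sum a (j + 1 + 1) - a 0) - (int_sum a (j + 1) - a 0)"
    using int_sum_step[of a "j + 1"] int_sum_step[of "\<lambda>i. a (i + 1)" j] by (simp add: algebra_simps)
qed

section \<open>Products of a subgroup with the powers of an element\<close>

context group
begin

text \<open>For \<open>t\<close> normalizing a subgroup \<open>M\<close> this is the group generated
  by both. It is a semidirect product with an infinite cyclic group exactly when no positive power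
  of \<open>t\<close> lies in \<open>M\<close>.\<close>

definition semidirect :: "'a set \<Rightarrow> 'a \<Rightarrow> 'a set" where
  "semidirect M t = {m \<otimes> t [^] k | m k. m \<in> M \<and> (k::int) \<in> UNIV}"

text \<open>Both inclusions are asked for: in an infinite group, conjugation can map
  \<open>M\<close> properly into itself.\<close>

definition normalizes :: "'a \<Rightarrow> 'a set \<Rightarrow> bool" where
  "normalizes t M \<longleftrightarrow> t \<in> carrier G \<and> (\<forall>x\<in>M. t \<otimes> x \<otimes> inv t \<in> M \<and> inv t \<otimes> x \<otimes> t \<in> M)"

lemma normalizes_nat_pow:
  assumes "normalizes t M" "M \<subseteq> carrier G"
  shows "normalizes (t [^] (k::nat)) M"
proof (induction k)
  case 0
  then show ?case using assms by (auto simp: normalizes_def)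
next
  case (Suc k)
  have t: "t \<in> carrier G" using assms by (simp add: normalizes_def)
  show ?case
    unfolding normalizes_def
  proof (intro conjI ballI)
    fix x assume x: "x \<in> M"
    then have xc: "x \<in> carrier G" using assms by auto
    have "t [^] Suc k \<otimes> x \<otimes> inv (t [^] Suc k) = t [^] k \<otimes> (t \<otimes> x \<otimes> inv t) \<otimes> inv (t [^] k)"
      using xc t by (simp add: inv_mult_group m_assoc)
    moreover have "t \<otimes> x \<otimes> inv t \<in> M" using x assms by (simp add: normalizes_def)
    ultimately show "t [^] Suc k \<otimes> x \<otimes> inv (t [^] Suc k) \<in> M"
      using Suc by (simp add: normalizes_def)
    have "inv (t [^] Suc k) \<otimes> x \<otimes> t [^] Suc k = inv t \<otimes> (inv (t [^] k) \<otimes> x \<otimes> t [^] k) \<otimes> t"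
      using xc t by (simp add: inv_mult_group m_assoc)
    moreover have "inv (t [^] k) \<otimes> x \<otimes> t [^] k \<in> M" using x Suc by (simp add: normalizes_def)
    ultimately show "inv (t [^] Suc k) \<otimes> x \<otimes> t [^] Suc k \<in> M"
      using assms by (simp add: normalizes_def)
  qed (use t in simp)
qed

lemma normalizes_int_pow:
  assumes "normalizes t M" "M \<subseteq> carrier G"
  shows "normalizes (t [^] (k::int)) M"
proof -
  have t: "t \<in> carrier G" using assms by (simp add: normalizes_def)
  obtain n where "k = int n \<or> k = - int n" by (metis int_cases2)
  then show ?thesis
    using normalizes_nat_pow[OF assms, of n] t
    by (auto simp: int_pow_int int_pow_neg_int normalizes_def)
qed

lemma semidirectI: "m \<in> M \<Longrightarrow> m \<otimes> t [^] (k::int) \<in> semidirect M t"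
  by (auto simp: semidirect_def)

lemma semidirectE:
  assumes "x \<in> semidirect M t"
  obtains m k where "m \<in> M" "x = m \<otimes> t [^] (k::int)"
  using assms by (auto simp: semidirect_def)

lemma semidirect_subgroup:
  assumes "subgroup M G" "normalizes t M"
  shows "subgroup (semidirect M t) G" "M \<subseteq> semidirect M t" "t \<in> semidirect M t"
proof -
  note c = subgroup.mem_carrier[OF assms(1)]
  have t: "t \<in> carrier G" using assms by (simp add: normalizes_def)
  have M: "M \<subseteq> carrier G" using c by blast
  note n = normalizes_int_pow[OF assms(2) M]
  show "M \<subseteq> semidirect M t"
  proof
    fix x assume "x \<in> M"
    then show "x \<in> semidirect M t" using semidirectI[of x M t 0] c by simp
  qed
  show "t \<in> semidirect M t"
    using semidirectI[of \<one> M t 1] t subgroup.one_closed[OF assms(1)] by (simp add: int_pow_1)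
  show "subgroup (semidirect M t) G"
  proof (rule subgroupI)
    show "semidirect M t \<subseteq> carrier G" using c t by (auto simp: semidirect_def)
    show "semidirect M t \<noteq> {}" using \<open>t \<in> semidirect M t\<close> by blast
    fix x assume "x \<in> semidirect M t"
    then obtain m k where x: "m \<in> M" "x = m \<otimes> t [^] (k::int)" by (rule semidirectE)
    have "inv x = (inv (t [^] k) \<otimes> inv m \<otimes> t [^] k) \<otimes> t [^] (- k)"
      using x c t by (simp add: inv_mult_group m_assoc int_pow_neg)
    moreover have "inv (t [^] k) \<otimes> inv m \<otimes> t [^] k \<in> M"
      using n[of k] x subgroup.m_inv_closed[OF assms(1)] by (simp add: normalizes_def)
    ultimately show "inv x \<in> semidirect M t" using semidirectI by metis
    fix y assume "y \<in> semidirect M t"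
    then obtain m' k' where y: "m' \<in> M" "y = m' \<otimes> t [^] (k'::int)" by (rule semidirectE)
    have "x \<otimes> y = (m \<otimes> (t [^] k \<otimes> m' \<otimes> inv (t [^] k))) \<otimes> t [^] (k + k')"
      using x y c t by (simp add: m_assoc int_pow_mult flip: m_assoc[of "inv (t [^] k)" "t [^] k"])
    moreover have "m \<otimes> (t [^] k \<otimes> m' \<otimes> inv (t [^] k)) \<in> M"
      using n[of k] x y subgroup.m_closed[OF assms(1)] by (simp add: normalizes_def)
    ultimately show "x \<otimes> y \<in> semidirect M t" using semidirectI by metis
  qed
qed

text \<open>Relative to a representative \<open>r\<close> of its coset of \<open>N\<close>, the
  group generated by \<open>M\<close> and \<open>t\<close>, an element reads \<open>m t^k r\<close>.
  The exponent is unique because no nonzero power of \<open>t\<close> lies in \<open>M\<close>;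
  multiplication by \<open>M\<close> keeps it and by \<open>t\<close> raises it.\<close>

lemma degree_function:
  assumes "subgroup M G" "normalizes t M" "\<And>k::nat. k > 0 \<Longrightarrow> t [^] k \<notin> M"
  obtains deg :: "'a \<Rightarrow> int"
  where "\<And>m x. m \<in> M \<Longrightarrow> x \<in> carrier G \<Longrightarrow> deg (m \<otimes> x) = deg x"
    and "\<And>x. x \<in> carrier G \<Longrightarrow> deg (t \<otimes> x) = deg x + 1"
proof -
  note c = subgroup.mem_carrier[OF assms(1)]
  have t: "t \<in> carrier G" using assms by (simp add: normalizes_def)
  define N where "N = semidirect M t"
  note N = semidirect_subgroup[OF assms(1,2), folded N_def]
  define r where "r x = (SOME y. y \<in> carrier G \<and> N #> y = N #> x)" for x
  have r: "r x \<in> carrier G \<and> N #> r x = N #> x" if "x \<in> carrier G" for x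
    unfolding r_def by (rule someI[of _ x]) (simp add: that)
  have r_eq: "r (n \<otimes> x) = r x" if "n \<in> N" "x \<in> carrier G" for n x
  proof -
    have "n \<in> carrier G" using that N subgroup.mem_carrier by metis
    then have "N #> (n \<otimes> x) = N #> x"
      using that by (intro r_coset_eqI N) (auto simp: m_assoc)
    then show ?thesis by (simp add: r_def)
  qed
  define P where "P x k \<longleftrightarrow> (\<exists>m\<in>M. x = m \<otimes> t [^] (k::int) \<otimes> r x)" for x k
  have ex: "\<exists>k. P x k" if "x \<in> carrier G" for x
  proof -
    have "x \<otimes> inv (r x) \<in> N" using r[OF that] that by (intro r_coset_eqD N) auto
    then obtain m k where mk: "m \<in> M" "x \<otimes> inv (r x) = m \<otimes> t [^] (k::int)"
      unfolding N_def by (rule semidirectE)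
    have "x = (x \<otimes> inv (r x)) \<otimes> r x" using r[OF that] that by (simp add: m_assoc)
    then show ?thesis using mk unfolding P_def by metis
  qed
  have nM: "k = 0" if "t [^] (k::int) \<in> M" for k
  proof (rule ccontr)
    assume "k \<noteq> 0"
    obtain n where n: "k = int n \<or> k = - int n" by (metis int_cases2)
    then have "t [^] n \<in> M \<or> inv (t [^] n) \<in> M" using that t by (auto simp: int_pow_int int_pow_neg_int)
    then have "t [^] n \<in> M" using subgroup.m_inv_closed[OF assms(1), of "inv (t [^] n)"] t by auto
    then show False using assms(3)[of n] n \<open>k \<noteq> 0\<close> by auto
  qed
  have uniq: "k = k'" if P: "P x k" "P x k'" and x: "x \<in> carrier G" for x k k'
  proof -
    obtain m m' where m: "m \<in> M" "x = m \<otimes> t [^] k \<otimes> r x" "m' \<in> M" "x = m' \<otimes> t [^] k' \<otimes> r x"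
      using P unfolding P_def by blast
    have rx: "r x \<in> carrier G" using r x by blast
    have "m \<otimes> t [^] k \<otimes> r x = m' \<otimes> t [^] k' \<otimes> r x" using m(2,4) by simp
    then have eq: "m \<otimes> t [^] k = m' \<otimes> t [^] k'"
      using rx m c t by (metis right_cancel int_pow_closed m_closed)
    have "t [^] (k - k') = inv m \<otimes> (m \<otimes> t [^] k) \<otimes> t [^] (- k')"
      using m c t by (simp add: m_assoc flip: int_pow_mult m_assoc[of "inv m" m])
    also have "\<dots> = inv m \<otimes> m'"
      unfolding eq using m c t by (simp add: m_assoc flip: int_pow_mult)
    also have "\<dots> \<in> M" using m subgroup.m_closed[OF assms(1)] subgroup.m_inv_closed[OF assms(1)] by simp
    finally show ?thesis using nM[of "k - k'"] by simp
  qed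
  define deg where "deg x = (SOME k. P x k)" for x
  have deg: "P x (deg x)" if "x \<in> carrier G" for x
    unfolding deg_def using ex[OF that] by (rule someI_ex)
  show ?thesis
  proof (rule that)
    fix m x assume m: "m \<in> M" and x: "x \<in> carrier G"
    from deg[OF x] obtain m' where m': "m' \<in> M" "x = m' \<otimes> t [^] deg x \<otimes> r x"
      unfolding P_def by blast
    have "m \<otimes> x = (m \<otimes> m') \<otimes> t [^] deg x \<otimes> r (m \<otimes> x)"
      using m m'(1) x c t r[OF x] r_eq[of m x] N by (subst m'(2)) (auto simp: m_assoc)
    then have "P (m \<otimes> x) (deg x)"
      unfolding P_def using m m' subgroup.m_closed[OF assms(1)] by blast
    then show "deg (m \<otimes> x) = deg x" using uniq deg m x c by (metis m_closed)
  next
    fix x assume x: "x \<in> carrier G"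
    from deg[OF x] obtain m' where m': "m' \<in> M" "x = m' \<otimes> t [^] deg x \<otimes> r x"
      unfolding P_def by blast
    have "t \<otimes> x = t \<otimes> (m' \<otimes> t [^] deg x \<otimes> r x)" using m'(2) by simp
    also have "\<dots> = (t \<otimes> m' \<otimes> inv t) \<otimes> (t \<otimes> t [^] deg x) \<otimes> r x"
      using m'(1) c t r[OF x] by (simp add: m_assoc flip: m_assoc[of "inv t" t])
    also have "t \<otimes> t [^] deg x = t [^] (deg x + 1)"
      using t by (simp add: int_pow_mult int_pow_1 add.commute[of "deg x"])
    finally have "t \<otimes> x = (t \<otimes> m' \<otimes> inv t) \<otimes> t [^] (deg x + 1) \<otimes> r (t \<otimes> x)"
      using r_eq[of t x] N x by simp
    then have "P (t \<otimes> x) (deg x + 1)"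
      unfolding P_def using m' assms(2) by (auto simp: normalizes_def)
    then show "deg (t \<otimes> x) = deg x + 1" using uniq deg x t by (metis m_closed)
  qed
qed

end

context fin_module
begin

lemma int_sum_V:
  assumes "\<And>i. a i \<in> V"
  shows "int_sum a j \<in> V"
proof (induction j rule: int_induct[of _ 0])
  case (step1 i)
  then show ?case using assms by (simp add: int_sum_step add_V)
next
  case (step2 i)
  then show ?case using int_sum_step[of a "i - 1"] assms diff_V[of "int_sum a i" "a (i - 1)"]
    by (simp add: algebra_simps)
qed (simp add: zero_V)

text \<open>Cochains invariant under \<open>M\<close> with at least one argument form a coinduced
  module over the infinite cyclic group of \<open>t\<close>, whose first cohomology vanishes.
  Concretely, the difference equation is solved along the orbits of \<open>t\<close>, with the
  degree of the first entry as the coordinate.\<close>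

lemma tr_minus_id_surj:
  assumes "subgroup M G" "normalizes t M" "\<And>k::nat. k > 0 \<Longrightarrow> t [^] k \<notin> M"
    and h: "h \<in> coch (Suc n) M"
  obtains k where "k \<in> coch (Suc n) M" "\<And>xs. xs \<in> tup (Suc n) \<Longrightarrow> tr t k xs - k xs = h xs"
proof -
  note c = subgroup.mem_carrier[OF assms(1)]
  have M: "M \<subseteq> carrier G" using c by blast
  have t: "t \<in> carrier G" using assms by (simp add: normalizes_def)
  obtain deg :: "'a \<Rightarrow> int" where
    deg: "\<And>m x. m \<in> M \<Longrightarrow> x \<in> carrier G \<Longrightarrow> deg (m \<otimes> x) = deg x"
      "\<And>x. x \<in> carrier G \<Longrightarrow> deg (t \<otimes> x) = deg x + 1"
    using degree_function[OF assms(1-3)] by blast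
  define a where "a xs j = tr (t [^] (j::int)) h xs" for xs j
  have coch_a: "tr (t [^] (j::int)) h \<in> coch (Suc n) M" for j
    by (rule tr_coch[OF h _ M]) (use t normalizes_int_pow[OF assms(2) M] in \<open>auto simp: normalizes_def\<close>)
  have act_int_sum: "act s (int_sum b j) = int_sum (\<lambda>i. act s (b i)) j" if "s \<in> carrier G" for s b j
    by (rule int_sum_hom) (rule act_diff[OF that])
  \<comment> \<open>The solution starting with 0 in degree 0: minus the sum of \<open>t^i h\<close>
    for \<open>i\<close> below the degree. Translation by \<open>t\<close> lowers the degree in the
    argument by one and shifts the summands by one, which leaves the term \<open>h\<close>.\<close>
  define k where "k xs = - int_sum (a xs) (deg (hd xs))" for xs
  have "k \<in> coch (Suc n) M"
  proof (rule cochI)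
    fix xs assume xs: "xs \<in> tup (Suc n)"
    show "k xs \<in> V"
      unfolding k_def a_def using xs by (intro uminus_V int_sum_V coch_V[OF coch_a])
    fix m assume m: "m \<in> M"
    have "a (shift m xs) j = act m (a xs j)" for j
      unfolding a_def by (rule coch_shift[OF coch_a xs m])
    moreover have "deg (hd (shift m xs)) = deg (hd xs)"
      using xs m deg(1) by (auto elim!: tup_SucE)
    ultimately show "k (shift m xs) = act m (k xs)"
      using c[OF m] by (simp add: k_def act_uminus act_int_sum) (metis ext)
  qed
  moreover have "tr t k xs - k xs = h xs" if xs: "xs \<in> tup (Suc n)" for xs
  proof -
    let ?ys = "shift (inv t) xs"
    have d: "deg (hd ?ys) = deg (hd xs) - 1"
    proof -
      obtain y ys where y: "xs = y # ys" "y \<in> carrier G" using xs by (rule tup_SucE)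
      have "deg (t \<otimes> (inv t \<otimes> y)) = deg (inv t \<otimes> y) + 1" using deg(2) y t by simp
      moreover have "t \<otimes> (inv t \<otimes> y) = y" using y t by (simp flip: m_assoc)
      ultimately show ?thesis using y by simp
    qed
    have *: "act t (a ?ys j) = a xs (j + 1)" for j
    proof -
      have "act t (a ?ys j) = tr t (tr (t [^] j) h) xs" by (simp add: a_def tr_def)
      also have "\<dots> = tr (t \<otimes> t [^] j) h xs" using t xs by (simp add: tr_mult)
      also have "t \<otimes> t [^] j = t [^] (j + 1)"
        using t by (simp add: int_pow_mult int_pow_1 add.commute[of j])
      finally show ?thesis by (simp add: a_def)
    qed
    have "act t (int_sum (a ?ys) j) = int_sum (a xs) (j + 1) - a xs 0" for j
      using t by (simp add: act_int_sum * int_sum_shift)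
    moreover have "a xs 0 = h xs" using xs by (simp add: a_def tr_one)
    ultimately show ?thesis
      using t by (simp add: tr_def k_def d act_uminus)
  qed
  ultimately show ?thesis by (rule that)
qed

end

text \<open>A pairwise unrelated set of greatest size exists by the bound and cannot be enlarged, so
  it meets everything. It serves to deduce finite index in an ascending union from a bound on its
  finite subsets.\<close>

lemma finite_maximal_independent:
  assumes "\<And>Y. finite Y \<Longrightarrow> Y \<subseteq> Z \<Longrightarrow> (\<And>x y. x \<in> Y \<Longrightarrow> y \<in> Y \<Longrightarrow> x \<noteq> y \<Longrightarrow> \<not> E x y) \<Longrightarrow> card Y \<le> k"
    and "\<And>x y. E x y \<Longrightarrow> E y x" and "\<And>x. x \<in> Z \<Longrightarrow> E x x"
  obtains Y where "finite Y" "Y \<subseteq> Z" "\<And>x. x \<in> Z \<Longrightarrow> \<exists>y\<in>Y. E x y"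
proof -
  define I where "I Y \<longleftrightarrow> finite Y \<and> Y \<subseteq> Z \<and> (\<forall>x\<in>Y. \<forall>y\<in>Y. x \<noteq> y \<longrightarrow> \<not> E x y)" for Y
  have "I {}" by (simp add: I_def)
  moreover have "\<forall>Y. I Y \<longrightarrow> card Y < Suc k" using assms(1) by (auto simp: I_def less_Suc_eq_le)
  ultimately have "\<exists>Y. I Y \<and> (\<forall>Y'. I Y' \<longrightarrow> card Y' \<le> card Y)" by (rule ex_has_greatest_nat)
  then obtain Y where Y: "I Y" "\<And>Y'. I Y' \<Longrightarrow> card Y' \<le> card Y" by blast
  have "\<exists>y\<in>Y. E x y" if x: "x \<in> Z" for x
  proof (rule ccontr)
    assume n: "\<not> (\<exists>y\<in>Y. E x y)"
    then have "x \<notin> Y" using assms(3) x by blast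
    moreover have "I (insert x Y)" using Y(1) x n assms(2) unfolding I_def by blast
    ultimately show False using Y(2)[of "insert x Y"] Y(1) by (simp add: I_def)
  qed
  then show ?thesis using that Y(1) by (auto simp: I_def)
qed

section \<open>Ascending unions of conjugates\<close>

context group
begin

definition conj_pow :: "'a \<Rightarrow> nat \<Rightarrow> 'a \<Rightarrow> 'a" where
  "conj_pow t i x = inv (t [^] i) \<otimes> x \<otimes> t [^] i"

definition shrinks :: "'a \<Rightarrow> 'a set \<Rightarrow> bool" where
  "shrinks t L \<longleftrightarrow> t \<in> carrier G \<and> (\<forall>x\<in>L. inv t \<otimes> x \<otimes> t \<in> L)"

text \<open>The conjugate \<open>t^i L t^-i\<close>, described by conjugating back into
  \<open>L\<close>. It grows with \<open>i\<close> when \<open>t\<close> shrinks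
  \<open>L\<close>.\<close>

definition unshrink :: "'a \<Rightarrow> 'a set \<Rightarrow> nat \<Rightarrow> 'a set" where
  "unshrink t L i = {x \<in> carrier G. conj_pow t i x \<in> L}"

definition limit_group :: "'a \<Rightarrow> 'a set \<Rightarrow> 'a set" where
  "limit_group t L = (\<Union>i. unshrink t L i)"

lemma conj_pow_mult:
  "t \<in> carrier G \<Longrightarrow> x \<in> carrier G \<Longrightarrow> y \<in> carrier G \<Longrightarrow>
    conj_pow t i (x \<otimes> y) = conj_pow t i x \<otimes> conj_pow t i y"
  by (simp add: conj_pow_def m_assoc flip: m_assoc[of "t [^] i" "inv (t [^] i)"])

lemma conj_pow_inv:
  "t \<in> carrier G \<Longrightarrow> x \<in> carrier G \<Longrightarrow> conj_pow t i (inv x) = inv (conj_pow t i x)"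
  by (simp add: conj_pow_def m_assoc inv_mult_group)

lemma conj_pow_add:
  "t \<in> carrier G \<Longrightarrow> x \<in> carrier G \<Longrightarrow> conj_pow t (i + j) x = conj_pow t j (conj_pow t i x)"
  by (simp add: conj_pow_def m_assoc inv_mult_group flip: nat_pow_mult)

lemma conj_pow_pow:
  "t \<in> carrier G \<Longrightarrow> x \<in> carrier G \<Longrightarrow> conj_pow (t [^] m) i x = conj_pow t (m * i) x"
  by (simp add: conj_pow_def nat_pow_pow)

lemma conj_pow_zero [simp]: "x \<in> carrier G \<Longrightarrow> conj_pow t 0 x = x"
  by (simp add: conj_pow_def)

lemma conj_pow_one: "t \<in> carrier G \<Longrightarrow> conj_pow t (Suc 0) x = inv t \<otimes> x \<otimes> t"
  by (simp add: conj_pow_def)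

lemma mult_inv_mult_cancel:
  assumes "x \<in> carrier G" "y \<in> carrier G" "z \<in> carrier G"
  shows "(x \<otimes> inv z) \<otimes> inv (y \<otimes> inv z) = x \<otimes> inv y"
  using assms by (simp add: group_simps)

lemma conj_pow_cancel:
  "t \<in> carrier G \<Longrightarrow> x \<in> carrier G \<Longrightarrow> conj_pow t i (t [^] i \<otimes> x \<otimes> inv (t [^] i)) = x"
  by (simp add: conj_pow_def m_assoc flip: m_assoc[of "inv (t [^] i)" "t [^] i"])

lemma conj_pow_shrinks:
  assumes "shrinks t L" "subgroup L G" "x \<in> L"
  shows "conj_pow t i x \<in> L"
proof -
  have t: "t \<in> carrier G" using assms by (simp add: shrinks_def)
  note c = subgroup.mem_carrier[OF assms(2)]
  show ?thesis
  proof (induction i)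
    case (Suc i)
    have "conj_pow t (Suc i) x = inv t \<otimes> conj_pow t i x \<otimes> t"
      using conj_pow_add[OF t c[OF assms(3)], of i 1] t by (simp add: conj_pow_one)
    then show ?case using Suc assms(1) by (simp add: shrinks_def)
  qed (use assms c in simp)
qed

lemma shrinks_pow:
  assumes "shrinks t L" "subgroup L G"
  shows "shrinks (t [^] (m::nat)) L"
  using conj_pow_shrinks[OF assms, of _ m] assms unfolding shrinks_def conj_pow_def by auto

lemma unshrink_subgroup:
  assumes "subgroup L G" "t \<in> carrier G"
  shows "subgroup (unshrink t L i) G"
proof (rule subgroupI)
  have "\<one> \<in> unshrink t L i"
    using assms subgroup.one_closed by (auto simp: unshrink_def conj_pow_def)
  then show "unshrink t L i \<noteq> {}" by blast
qed (use assms in \<open>auto simp: unshrink_def conj_pow_mult conj_pow_inv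
      intro: subgroup.m_closed subgroup.m_inv_closed\<close>)

lemma unshrink_mono:
  assumes "shrinks t L" "subgroup L G" "i \<le> j"
  shows "unshrink t L i \<subseteq> unshrink t L j"
proof
  have t: "t \<in> carrier G" using assms by (simp add: shrinks_def)
  fix x assume x: "x \<in> unshrink t L i"
  then have "conj_pow t j x = conj_pow t (j - i) (conj_pow t i x)"
    using conj_pow_add[OF t, of x i "j - i"] assms by (simp add: unshrink_def)
  then show "x \<in> unshrink t L j"
    using x conj_pow_shrinks[OF assms(1,2)] by (simp add: unshrink_def)
qed

lemma limit_groupE:
  assumes "x \<in> limit_group t L"
  obtains i where "x \<in> carrier G" "conj_pow t i x \<in> L"
  using assms by (auto simp: limit_group_def unshrink_def)

lemma limit_groupI: "x \<in> carrier G \<Longrightarrow> conj_pow t i x \<in> L \<Longrightarrow> x \<in> limit_group t L"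
  by (auto simp: limit_group_def unshrink_def)

lemma limit_group_mono: "L \<subseteq> L' \<Longrightarrow> limit_group t L \<subseteq> limit_group t L'"
  by (auto simp: limit_group_def unshrink_def)

lemma subset_limit_group: "subgroup L G \<Longrightarrow> L \<subseteq> limit_group t L"
  using subgroup.mem_carrier by (fastforce intro!: limit_groupI[of _ _ 0])

lemma finite_subset_limit_group:
  assumes "shrinks t L" "subgroup L G" "finite Y" "Y \<subseteq> limit_group t L"
  obtains i where "Y \<subseteq> unshrink t L i"
proof -
  have "\<exists>i. Y \<subseteq> unshrink t L i" using assms(3,4)
  proof (induction rule: finite_induct)
    case (insert y Y)
    then obtain i j where "Y \<subseteq> unshrink t L i" "y \<in> unshrink t L j" by (auto simp: limit_group_def)
    then have "insert y Y \<subseteq> unshrink t L (max i j)"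
      using unshrink_mono[OF assms(1,2), of i "max i j"] unshrink_mono[OF assms(1,2), of j "max i j"] by auto
    then show ?case by blast
  qed simp
  then show ?thesis using that by blast
qed

lemma limit_group_subgroup:
  assumes "shrinks t L" "subgroup L G"
  shows "subgroup (limit_group t L) G"
proof (rule subgroupI)
  have t: "t \<in> carrier G" using assms by (simp add: shrinks_def)
  note u = unshrink_subgroup[OF assms(2) t]
  show "limit_group t L \<subseteq> carrier G" by (auto simp: limit_group_def unshrink_def)
  show "limit_group t L \<noteq> {}"
    using subset_limit_group[OF assms(2)] subgroup.one_closed[OF assms(2)] by blast
  show "inv x \<in> limit_group t L" if "x \<in> limit_group t L" for x
    using that u by (auto simp: limit_group_def intro: subgroup.m_inv_closed)
  fix x y assume "x \<in> limit_group t L" "y \<in> limit_group t L"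
  then obtain i where "{x, y} \<subseteq> unshrink t L i"
    using finite_subset_limit_group[OF assms, of "{x, y}"] by blast
  then have "x \<otimes> y \<in> unshrink t L i" using subgroup.m_closed[OF u] by simp
  then show "x \<otimes> y \<in> limit_group t L" by (auto simp: limit_group_def)
qed

lemma normalizes_limit_group:
  assumes "shrinks t L" "subgroup L G"
  shows "normalizes t (limit_group t L)"
  unfolding normalizes_def
proof (intro conjI ballI)
  show t: "t \<in> carrier G" using assms by (simp add: shrinks_def)
  fix x assume "x \<in> limit_group t L"
  then obtain i where x: "x \<in> carrier G" "conj_pow t i x \<in> L" by (rule limit_groupE)
  have "conj_pow t (1 + i) (t \<otimes> x \<otimes> inv t) = conj_pow t i x"
    using conj_pow_cancel[of t x 1] x t by (subst conj_pow_add) auto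
  then show "t \<otimes> x \<otimes> inv t \<in> limit_group t L"
    using x t by (intro limit_groupI[of _ _ "1 + i"]) auto
  have "conj_pow t i (inv t \<otimes> x \<otimes> t) = conj_pow t 1 (conj_pow t i x)"
    using conj_pow_add[of t x i 1] conj_pow_add[of t x 1 i] x t by (simp add: conj_pow_one add.commute)
  then have "conj_pow t i (inv t \<otimes> x \<otimes> t) \<in> L"
    using conj_pow_shrinks[OF assms x(2)] by metis
  then show "inv t \<otimes> x \<otimes> t \<in> limit_group t L"
    using x t by (intro limit_groupI[of _ _ i]) auto
qed

text \<open>Conjugation by \<open>t\<close> fixes the powers of \<open>t\<close>, so the union
  contains no powers beyond those already in \<open>L\<close>.\<close>

lemma pow_notin_limit_group:
  assumes "t [^] (k::nat) \<notin> L" "t \<in> carrier G"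
  shows "t [^] k \<notin> limit_group t L"
proof
  assume "t [^] k \<in> limit_group t L"
  then obtain i where "conj_pow t i (t [^] k) \<in> L" by (rule limit_groupE)
  moreover have "conj_pow t i (t [^] k) = t [^] k"
  proof -
    have "inv (t [^] i) \<otimes> t [^] k \<otimes> t [^] i = inv (t [^] i) \<otimes> (t [^] i \<otimes> t [^] k)"
      using assms(2) by (simp add: m_assoc nat_pow_mult add.commute)
    also have "\<dots> = t [^] k" using assms(2) by (simp flip: m_assoc)
    finally show ?thesis by (simp add: conj_pow_def)
  qed
  ultimately show False using assms(1) by simp
qed

text \<open>Finitely many elements of the larger union lie in a single \<open>t^i L t^-i\<close>. If
  they are distinct modulo the smaller union, conjugation by \<open>t^i\<close> sends them to
  distinct cosets of \<open>Q\<close> in \<open>L\<close>. So the index of \<open>Q\<close> in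
  \<open>L\<close> bounds the new index.\<close>

lemma fin_ind_limit_group:
  assumes "fin_ind Q L" "shrinks t Q" "shrinks t L"
  shows "fin_ind (limit_group t Q) (limit_group t L)"
proof -
  note Q = fin_indD[OF assms(1)]
  have t: "t \<in> carrier G" using assms by (simp add: shrinks_def)
  let ?M = "limit_group t L" and ?M' = "limit_group t Q"
  note M = limit_group_subgroup[OF assms(3) Q(2)] and M' = limit_group_subgroup[OF assms(2) Q(1)]
  have Mc: "x \<in> carrier G" if "x \<in> ?M" for x using that by (rule limit_groupE)
  have sub: "?M' \<subseteq> ?M" by (rule limit_group_mono[OF Q(3)])
  obtain Y where Y: "finite Y" "Y \<subseteq> ?M" "\<And>x. x \<in> ?M \<Longrightarrow> \<exists>y\<in>Y. x \<in> carrier G \<and> y \<in> carrier G \<and> x \<otimes> inv y \<in> ?M'"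
  proof (rule finite_maximal_independent[where Z = ?M and k = "card ((\<lambda>x. Q #> x) ` L)"
        and E = "\<lambda>x y. x \<in> carrier G \<and> y \<in> carrier G \<and> x \<otimes> inv y \<in> ?M'"])
    fix Y assume Y: "finite Y" "Y \<subseteq> ?M"
      "\<And>x y. x \<in> Y \<Longrightarrow> y \<in> Y \<Longrightarrow> x \<noteq> y \<Longrightarrow> \<not> (x \<in> carrier G \<and> y \<in> carrier G \<and> x \<otimes> inv y \<in> ?M')"
    obtain i where i: "Y \<subseteq> unshrink t L i"
      using finite_subset_limit_group[OF assms(3) Q(2) Y(1,2)] .
    have "inj_on (\<lambda>y. Q #> conj_pow t i y) Y"
    proof (rule inj_onI, rule ccontr)
      fix x y assume xy: "x \<in> Y" "y \<in> Y" "Q #> conj_pow t i x = Q #> conj_pow t i y" "x \<noteq> y"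
      then have c: "x \<in> carrier G" "y \<in> carrier G" "conj_pow t i x \<in> L" "conj_pow t i y \<in> L"
        using i by (auto simp: unshrink_def)
      have "conj_pow t i x \<otimes> inv (conj_pow t i y) \<in> Q"
        using fin_ind_coset[OF assms(1) c(3,4) xy(3)] .
      then have "conj_pow t i (x \<otimes> inv y) \<in> Q" using c t by (simp add: conj_pow_mult conj_pow_inv)
      then have "x \<otimes> inv y \<in> ?M'" using c by (intro limit_groupI) auto
      then show False using Y(3) xy c by blast
    qed
    moreover have "(\<lambda>y. Q #> conj_pow t i y) ` Y \<subseteq> (\<lambda>x. Q #> x) ` L"
      using i by (auto simp: unshrink_def)
    ultimately show "card Y \<le> card ((\<lambda>x. Q #> x) ` L)"
      using card_inj_on_le Q(4) by blast
  next
    fix x y assume "x \<in> carrier G \<and> y \<in> carrier G \<and> x \<otimes> inv y \<in> ?M'"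
    then show "y \<in> carrier G \<and> x \<in> carrier G \<and> y \<otimes> inv x \<in> ?M'"
      using subgroup.m_inv_closed[OF M', of "x \<otimes> inv y"] by (simp add: inv_mult_group)
  next
    fix x assume "x \<in> ?M"
    then show "x \<in> carrier G \<and> x \<in> carrier G \<and> x \<otimes> inv x \<in> ?M'"
      using Mc subgroup.one_closed[OF M'] by simp
  qed (rule that)
  define \<kappa> where "\<kappa> x = (SOME y. y \<in> Y \<and> x \<otimes> inv y \<in> ?M')" for x
  have \<kappa>: "\<kappa> x \<in> Y \<and> x \<otimes> inv (\<kappa> x) \<in> ?M'" if "x \<in> ?M" for x
  proof -
    have "\<exists>y. y \<in> Y \<and> x \<otimes> inv y \<in> ?M'" using Y(3)[OF that] by blast
    then show ?thesis unfolding \<kappa>_def by (rule someI_ex)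
  qed
  show ?thesis
  proof (rule fin_indI[where \<kappa> = \<kappa>])
    show "finite (\<kappa> ` ?M)" by (rule finite_subset[OF _ Y(1)]) (use \<kappa> in auto)
    fix x y assume xy: "x \<in> ?M" "y \<in> ?M" "\<kappa> x = \<kappa> y"
    have kc: "\<kappa> y \<in> carrier G" using \<kappa>[OF xy(2)] Y(2) Mc by auto
    have "(x \<otimes> inv (\<kappa> y)) \<otimes> inv (y \<otimes> inv (\<kappa> y)) \<in> ?M'"
      by (rule subgroup.m_closed[OF M' _ subgroup.m_inv_closed[OF M']])
        (use \<kappa>[OF xy(1)] \<kappa>[OF xy(2)] xy(3) in simp_all)
    then show "x \<otimes> inv y \<in> ?M'"
      using mult_inv_mult_cancel[OF Mc[OF xy(1)] Mc[OF xy(2)] kc] by simp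
  qed (use M M' sub in auto)
qed

lemma fin_ind_semidirect:
  assumes "fin_ind A B" "normalizes t A" "normalizes t B"
  shows "fin_ind (semidirect A t) (semidirect B t)"
proof -
  note A = fin_indD[OF assms(1)]
  have t: "t \<in> carrier G" using assms by (simp add: normalizes_def)
  note cA = subgroup.mem_carrier[OF A(1)] and cB = subgroup.mem_carrier[OF A(2)]
  have Bs: "B \<subseteq> carrier G" and As: "A \<subseteq> carrier G" using cA cB by auto
  note nA = normalizes_int_pow[OF assms(2) As] and nB = normalizes_int_pow[OF assms(3) Bs]
  \<comment> \<open>The power of \<open>t\<close> is written on the left here. In
    \<open>x \<otimes> inv y\<close> the two parts in \<open>B\<close> then stand side by side, so
    that equal right cosets of \<open>A\<close> can be used.\<close>
  define \<beta> where "\<beta> x = (SOME b. b \<in> B \<and> (\<exists>k::int. x = t [^] k \<otimes> b))" for x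
  have \<beta>: "\<beta> x \<in> B \<and> (\<exists>k::int. x = t [^] k \<otimes> \<beta> x)" if x: "x \<in> semidirect B t" for x
  proof -
    obtain b k where b: "b \<in> B" "x = b \<otimes> t [^] (k::int)" using x by (rule semidirectE)
    have "x = t [^] k \<otimes> (inv (t [^] k) \<otimes> b \<otimes> t [^] k)"
      using b cB t by (simp add: group_simps)
    moreover have "inv (t [^] k) \<otimes> b \<otimes> t [^] k \<in> B" using nB b by (simp add: normalizes_def)
    ultimately have "\<exists>b. b \<in> B \<and> (\<exists>k::int. x = t [^] k \<otimes> b)" by blast
    then show ?thesis unfolding \<beta>_def by (rule someI_ex)
  qed
  show ?thesis
  proof (rule fin_indI[where \<kappa> = "\<lambda>x. A #> \<beta> x"])
    have "(\<lambda>x. A #> \<beta> x) ` semidirect B t \<subseteq> (\<lambda>x. A #> x) ` B" using \<beta> by auto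
    then show "finite ((\<lambda>x. A #> \<beta> x) ` semidirect B t)" using A(4) finite_subset by blast
    fix x y assume xy: "x \<in> semidirect B t" "y \<in> semidirect B t" "A #> \<beta> x = A #> \<beta> y"
    obtain k l :: int where k: "x = t [^] k \<otimes> \<beta> x" "y = t [^] l \<otimes> \<beta> y" "\<beta> x \<in> B" "\<beta> y \<in> B"
      using \<beta> xy(1,2) by blast
    let ?a = "\<beta> x \<otimes> inv (\<beta> y)"
    have a: "?a \<in> A" using fin_ind_coset[OF assms(1) k(3,4) xy(3)] .
    have "x \<otimes> inv y = (t [^] k \<otimes> \<beta> x) \<otimes> inv (t [^] l \<otimes> \<beta> y)" using k(1,2) by simp
    also have "\<dots> = t [^] k \<otimes> ?a \<otimes> inv (t [^] l)"
      using k(3,4) cB t by (simp add: inv_mult_group m_assoc)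
    also have "\<dots> = (t [^] k \<otimes> ?a \<otimes> inv (t [^] k)) \<otimes> t [^] (k - l)"
      using cA[OF a] t k(3,4) cB by (simp add: group_simps int_pow_diff)
    finally show "x \<otimes> inv y \<in> semidirect A t"
      using nA[of k] a semidirectI unfolding normalizes_def by metis
  qed (use A semidirect_subgroup[OF A(1) assms(2)] semidirect_subgroup[OF A(2) assms(3)] in
      \<open>auto simp: semidirect_def\<close>)
qed

lemma fin_ind_semidirect_pow:
  assumes "subgroup M G" "subgroup H G" "normalizes t M" "M \<subseteq> H" "t \<in> H" "H \<subseteq> semidirect M t"
    and "(m::nat) > 0"
  shows "fin_ind (semidirect M (t [^] m)) H"
proof -
  have t: "t \<in> carrier G" using assms by (simp add: normalizes_def)
  note c = subgroup.mem_carrier[OF assms(1)]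
  have Ms: "M \<subseteq> carrier G" using c by auto
  note n = normalizes_nat_pow[OF assms(3) Ms, of m]
  note sd = semidirect_subgroup[OF assms(1) n]
  \<comment> \<open>Any exponent may be chosen. Two elements whose chosen exponents agree modulo
    \<open>m\<close> differ by elements of \<open>M\<close> and a power of
    \<open>t^m\<close>.\<close>
  define \<delta> where "\<delta> x = (SOME k. \<exists>m\<in>M. x = m \<otimes> t [^] (k::int))" for x
  have \<delta>: "\<exists>m\<in>M. x = m \<otimes> t [^] \<delta> x" if "x \<in> H" for x
  proof -
    have "\<exists>k. \<exists>m\<in>M. x = m \<otimes> t [^] (k::int)"
      using that assms(6) by (blast elim: semidirectE)
    then show ?thesis unfolding \<delta>_def by (rule someI_ex)
  qed
  show ?thesis
  proof (rule fin_indI[where \<kappa> = "\<lambda>x. \<delta> x mod int m"])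
    have "(\<lambda>x. \<delta> x mod int m) ` H \<subseteq> {0..<int m}" using assms(7) by auto
    then show "finite ((\<lambda>x. \<delta> x mod int m) ` H)" using finite_subset by blast
    show "semidirect M (t [^] m) \<subseteq> H"
    proof
      fix x assume "x \<in> semidirect M (t [^] m)"
      then obtain a k where x: "a \<in> M" "x = a \<otimes> (t [^] m) [^] (k::int)" by (rule semidirectE)
      have "(t [^] m) [^] k \<in> H"
        using subgroup_int_pow_closed[OF assms(2), of t "int m"] assms(2,5)
        by (intro subgroup_int_pow_closed) (auto simp: int_pow_int)
      then show "x \<in> H" using x assms(2,4) by (auto intro: subgroup.m_closed)
    qed
    fix x y assume xy: "x \<in> H" "y \<in> H" "\<delta> x mod int m = \<delta> y mod int m"
    obtain a b where ab: "a \<in> M" "x = a \<otimes> t [^] \<delta> x" "b \<in> M" "y = b \<otimes> t [^] \<delta> y"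
      using \<delta> xy by blast
    obtain e where e: "\<delta> x - \<delta> y = int m * e" using xy(3) by (metis mod_eq_dvd_iff dvdE)
    have "x \<otimes> inv y = (a \<otimes> t [^] \<delta> x) \<otimes> inv (b \<otimes> t [^] \<delta> y)" using ab(2,4) by simp
    also have "\<dots> = a \<otimes> t [^] (\<delta> x - \<delta> y) \<otimes> inv b"
      using ab(1,3) c t by (simp add: inv_mult_group m_assoc int_pow_diff)
    also have "t [^] (\<delta> x - \<delta> y) = (t [^] m) [^] e"
      using t by (simp add: e int_pow_pow flip: int_pow_int)
    finally have eq: "x \<otimes> inv y = a \<otimes> (t [^] m) [^] e \<otimes> inv b" .
    have "a \<in> semidirect M (t [^] m)" "inv b \<in> semidirect M (t [^] m)"
      "(t [^] m) [^] e \<in> semidirect M (t [^] m)"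
      using sd ab subgroup.m_inv_closed[OF assms(1)] subgroup_int_pow_closed[OF sd(1,3)] by auto
    then show "x \<otimes> inv y \<in> semidirect M (t [^] m)"
      unfolding eq by (intro subgroup.m_closed[OF sd(1)])
  qed (use sd assms in auto)
qed

end

section \<open>Effaceable cohomology\<close>

context fin_module
begin

text \<open>The order of the quantifiers matters: \<open>Q\<close> serves all cocycles of
  \<open>R\<close> in the given degree. \<open>R\<close> ranges over all subgroups of finite index
  so that the property can be applied repeatedly. The bound \<open>n \<ge> 1\<close> admits degree
  0, which is trivial by augmentation.\<close>

definition effaceable :: "'a set \<Rightarrow> bool" where
  "effaceable S \<longleftrightarrow> (\<forall>n\<ge>1. \<forall>R. fin_ind R S \<longrightarrow> (\<exists>Q. fin_ind Q R \<and> zc n R \<subseteq> bc n Q))"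

lemma effaceableD:
  assumes "effaceable S" "fin_ind R S" "n \<ge> 1"
  obtains Q where "fin_ind Q R" "zc n R \<subseteq> bc n Q"
  using assms unfolding effaceable_def by blast

lemma effaceable_trivial: "effaceable {\<one>}"
  unfolding effaceable_def
proof (intro allI impI)
  fix n :: nat and R assume n: "n \<ge> 1" and R: "fin_ind R {\<one>}"
  then have "R = {\<one>}" using fin_indD[OF R] subgroup.one_closed by blast
  moreover obtain m where "n = Suc m" using n by (cases n) auto
  ultimately show "\<exists>Q. fin_ind Q R \<and> zc n R \<subseteq> bc n Q"
    using zc_trivial_bc[of _ m] fin_ind_refl[of R] fin_indD[OF R] by auto
qed

text \<open>Cocycles of \<open>R\<close> are restricted to \<open>R \<inter> S\<close>, which has
  finite index both in \<open>R\<close> and in \<open>S\<close>.\<close>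

lemma effaceable_overgroup:
  assumes "effaceable S" "fin_ind S H"
  shows "effaceable H"
  unfolding effaceable_def
proof (intro allI impI)
  fix n :: nat and R assume n: "n \<ge> 1" and R: "fin_ind R H"
  note S = fin_indD[OF assms(2)] and R' = fin_indD[OF R]
  have "fin_ind (R \<inter> S) S" by (rule fin_ind_Int_subgroup[OF R S(1,3)])
  then obtain Q where Q: "fin_ind Q (R \<inter> S)" "zc n (R \<inter> S) \<subseteq> bc n Q"
    using effaceableD[OF assms(1) _ n] by blast
  have "fin_ind (S \<inter> R) R" by (rule fin_ind_Int_subgroup[OF assms(2) R'(1,3)])
  then have "fin_ind Q R" using fin_ind_trans[OF Q(1)] by (simp add: Int_commute)
  moreover have "zc n R \<subseteq> bc n Q" using Q(2) zc_mono[of "R \<inter> S" R n] by blast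
  ultimately show "\<exists>Q. fin_ind Q R \<and> zc n R \<subseteq> bc n Q" by blast
qed

lemma tr_zc:
  assumes "f \<in> zc n S" "s \<in> carrier G" "R \<subseteq> carrier G" "\<And>x. x \<in> R \<Longrightarrow> inv s \<otimes> x \<otimes> s \<in> S"
  shows "tr s f \<in> zc n R"
proof -
  have "tr s f \<in> coch n R" using assms by (intro tr_coch) (auto simp: zc_def)
  moreover have "cdiff (tr s f) xs = 0" if "xs \<in> tup (Suc n)" for xs
    using assms(1,2) that shift_tup[of "inv s" xs "Suc n"]
    by (simp add: cdiff_tr) (simp add: tr_def zc_def act_zero)
  ultimately show ?thesis by (simp add: zc_def)
qed

text \<open>Translating \<open>f\<close> by \<open>t^-i\<close> gives a cocycle on \<open>L\<close>
  again, because the union absorbs conjugation. A primitive of the translate on \<open>Q\<close>,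
  translated back, is a primitive of \<open>f\<close> itself on \<open>t^i Q t^-i\<close>.
  Compactness supplies one primitive for all \<open>i\<close> at once.\<close>

lemma zc_limit_group:
  assumes "shrinks t L" "subgroup L G" "shrinks t Q" "subgroup Q G"
    and "zc (Suc n) L \<subseteq> bc (Suc n) Q"
  shows "zc (Suc n) (limit_group t L) \<subseteq> bc (Suc n) (limit_group t Q)"
proof
  have t: "t \<in> carrier G" using assms by (simp add: shrinks_def)
  fix f assume f: "f \<in> zc (Suc n) (limit_group t L)"
  have "f \<in> bc (Suc n) (unshrink t Q i)" for i
  proof -
    have "tr (inv (t [^] i)) f \<in> zc (Suc n) L"
    proof (rule tr_zc[OF f])
      fix x assume x: "x \<in> L"
      then have xc: "x \<in> carrier G" using subgroup.mem_carrier[OF assms(2)] by blast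
      then have "t [^] i \<otimes> x \<otimes> inv (t [^] i) \<in> limit_group t L"
        using t x by (intro limit_groupI[of _ _ i]) (simp_all add: conj_pow_cancel)
      then show "inv (inv (t [^] i)) \<otimes> x \<otimes> inv (t [^] i) \<in> limit_group t L" using t by simp
    qed (use t subgroup.subset[OF assms(2)] in auto)
    then have "tr (inv (t [^] i)) f \<in> bc (Suc n) Q" using assms(5) by blast
    then obtain g where g: "g \<in> coch n Q"
      "\<And>xs. xs \<in> tup (Suc n) \<Longrightarrow> tr (inv (t [^] i)) f xs = cdiff g xs"
      by (auto simp: bc_def)
    have "tr (t [^] i) g \<in> coch n (unshrink t Q i)"
      by (rule tr_coch[OF g(1)]) (use t in \<open>auto simp: unshrink_def conj_pow_def\<close>)
    moreover have "f xs = cdiff (tr (t [^] i) g) xs" if xs: "xs \<in> tup (Suc n)" for xs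
    proof -
      have "f xs = tr (t [^] i \<otimes> inv (t [^] i)) f xs" using t xs by (simp add: tr_one)
      also have "\<dots> = tr (t [^] i) (tr (inv (t [^] i)) f) xs"
        using t xs by (intro tr_mult) auto
      also have "\<dots> = tr (t [^] i) (cdiff g) xs"
        using t xs g(2) by (intro tr_cong) auto
      finally show ?thesis using t by (simp add: cdiff_tr)
    qed
    ultimately show ?thesis by (auto simp: bc_def)
  qed
  then show "f \<in> bc (Suc n) (limit_group t Q)"
    unfolding limit_group_def
    using unshrink_mono[OF assms(3,4)] by (intro bc_ascending_union) (auto simp: unshrink_def)
qed

section \<open>The Wang sequence\<close>

lemma coch_semidirect:
  assumes "subgroup M G" "normalizes t M" "f \<in> coch n M" "\<And>xs. xs \<in> tup n \<Longrightarrow> tr t f xs = f xs"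
  shows "f \<in> coch n (semidirect M t)"
proof -
  note sd = semidirect_subgroup[OF assms(1,2)]
  have t: "t \<in> carrier G" using assms by (simp add: normalizes_def)
  let ?S = "{s \<in> carrier G. \<forall>xs\<in>tup n. tr s f xs = f xs}"
  have M: "M \<subseteq> ?S" using assms(3) coch_iff_tr[OF assms(1)] subgroup.mem_carrier[OF assms(1)] by auto
  have "t \<in> ?S" using assms t by auto
  then have tk: "t [^] (k::int) \<in> ?S" for k by (rule subgroup_int_pow_closed[OF stabilizer_subgroup])
  have "semidirect M t \<subseteq> ?S"
  proof
    fix x assume "x \<in> semidirect M t"
    then obtain m k where "m \<in> M" "x = m \<otimes> t [^] (k::int)" by (rule semidirectE)
    then show "x \<in> ?S" using subgroup.m_closed[OF stabilizer_subgroup _ tk] M by blast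
  qed
  then show ?thesis using assms(3) coch_V by (subst coch_iff_tr[OF sd(1)]) blast
qed

text \<open>The Wang sequence of \<open>M \<rtimes> \<langle>t\<rangle>\<close>: if \<open>f = d g\<close> with \<open>g\<close> invariant under \<open>M\<close>, then
  \<open>e = t g - g\<close> is a cocycle; killing \<open>e\<close> on a smaller group makes \<open>g\<close> correctible to
  a cochain invariant under \<open>t\<close>.\<close>

lemma wang_step:
  assumes M: "subgroup M G" "normalizes t M" "subgroup M' G" "normalizes t M'" "M' \<subseteq> M"
    and nt: "\<And>k::nat. k > 0 \<Longrightarrow> t [^] k \<notin> M'"
    and kill: "zc (Suc (Suc n)) M \<subseteq> bc (Suc (Suc n)) M'"
    and f: "f \<in> bc (Suc (Suc (Suc n))) M" "\<And>xs. xs \<in> tup (Suc (Suc (Suc n))) \<Longrightarrow> tr t f xs = f xs"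
  shows "f \<in> bc (Suc (Suc (Suc n))) (semidirect M' t)"
proof -
  have t: "t \<in> carrier G" using assms by (simp add: normalizes_def)
  have Ms: "M \<subseteq> carrier G" "M' \<subseteq> carrier G" using M subgroup.subset by auto
  let ?n = "Suc (Suc n)"
  obtain g where g: "g \<in> coch ?n M" "\<And>xs. xs \<in> tup (Suc ?n) \<Longrightarrow> f xs = cdiff g xs"
    using f(1) by (auto simp: bc_def)
  define e where "e xs = tr t g xs - g xs" for xs
  have trg: "tr t g \<in> coch ?n M"
    by (rule tr_coch[OF g(1) t Ms(1)]) (use M(2) in \<open>auto simp: normalizes_def\<close>)
  have "e \<in> coch ?n M" unfolding e_def by (rule coch_diff[OF trg g(1) Ms(1)])
  moreover have "cdiff e xs = 0" if xs: "xs \<in> tup (Suc ?n)" for xs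
  proof -
    have "cdiff e xs = tr t (cdiff g) xs - cdiff g xs"
      unfolding e_def cdiff_diff using t by (simp add: cdiff_tr)
    also have "tr t (cdiff g) xs = tr t f xs" using t xs g(2) by (intro tr_cong) auto
    finally show ?thesis using f(2) g(2) xs by simp
  qed
  ultimately have "e \<in> bc ?n M'" using kill by (auto simp: zc_def)
  then obtain h where h: "h \<in> coch (Suc n) M'" "\<And>xs. xs \<in> tup ?n \<Longrightarrow> e xs = cdiff h xs"
    by (auto simp: bc_def)
  \<comment> \<open>\<open>h\<close> has at least one argument, as \<open>tr_minus_id_surj\<close>
    demands. This is where degree one drops out. The differential of \<open>k\<close> then has the
    same defect under \<open>t\<close> as \<open>g\<close>.\<close>
  obtain k where k: "k \<in> coch (Suc n) M'" "\<And>xs. xs \<in> tup (Suc n) \<Longrightarrow> tr t k xs - k xs = h xs"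
    using tr_minus_id_surj[OF M(3,4) nt h(1)] by blast
  define g' where "g' xs = g xs - cdiff k xs" for xs
  have "g' \<in> coch ?n M'"
    unfolding g'_def using coch_mono[OF M(5)] g(1) cdiff_coch[OF k(1) Ms(2)]
    by (intro coch_diff Ms(2)) auto
  moreover have "tr t g' xs = g' xs" if xs: "xs \<in> tup ?n" for xs
  proof -
    have "cdiff h xs = cdiff (\<lambda>ys. tr t k ys - k ys) xs"
      by (rule cdiff_tup_cong[OF xs]) (use k(2) in simp)
    also have "\<dots> = tr t (cdiff k) xs - cdiff k xs"
      unfolding cdiff_diff using t by (simp add: cdiff_tr)
    finally have "tr t (cdiff k) xs = cdiff k xs + (tr t g xs - g xs)"
      using h(2)[OF xs] by (simp add: e_def)
    then show ?thesis unfolding g'_def using t by (simp add: tr_diff)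
  qed
  ultimately have "g' \<in> coch ?n (semidirect M' t)" by (intro coch_semidirect M)
  moreover have "f xs = cdiff g' xs" if "xs \<in> tup (Suc ?n)" for xs
    using g(2)[OF that] by (simp add: g'_def[abs_def] cdiff_diff cdiff_cdiff)
  ultimately show ?thesis by (auto simp: bc_def)
qed

text \<open>In degree one \<open>t g - g\<close> is a constant and a power of \<open>t\<close> fixes \<open>g\<close>; the
  exponent \<open>fact (card V)\<close> does not depend on \<open>g\<close>.\<close>

lemma wang_step_degree_one:
  assumes M: "subgroup M G" "normalizes t M"
    and f: "f \<in> bc 2 M" "\<And>xs. xs \<in> tup 2 \<Longrightarrow> tr t f xs = f xs"
  shows "f \<in> bc 2 (semidirect M (t [^] (fact (card V) :: nat)))"
proof -
  have t: "t \<in> carrier G" using assms by (simp add: normalizes_def)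
  have Ms: "M \<subseteq> carrier G" using M subgroup.subset by auto
  obtain g where g: "g \<in> coch 1 M" "\<And>xs. xs \<in> tup 2 \<Longrightarrow> f xs = cdiff g xs"
    using f(1) by (auto simp: bc_def numeral_2_eq_2)
  have inv: "tr (t [^] (i::nat)) f xs = f xs" if "xs \<in> tup 2" for i xs
    using that
  proof (induction i arbitrary: xs)
    case (Suc i)
    have "tr (t [^] Suc i) f xs = tr (t [^] i) (tr t f) xs"
      using Suc t by (simp add: tr_mult)
    also have "\<dots> = tr (t [^] i) f xs" using Suc t f(2) by (intro tr_cong) auto
    finally show ?case using Suc by simp
  qed (simp add: tr_one)
  \<comment> \<open>The differential of \<open>t^i g - g\<close> vanishes, so this cochain is a
    constant; \<open>s i\<close> is its value.\<close>
  define s where "s i = tr (t [^] (i::nat)) g [\<one>] - g [\<one>]" for i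
  have sx: "tr (t [^] (i::nat)) g [x] = g [x] + s i" if x: "x \<in> carrier G" for i x
  proof -
    let ?e = "\<lambda>xs. tr (t [^] i) g xs - g xs"
    have xs: "[\<one>, x] \<in> tup 2" using x by (simp add: tup_def)
    have "cdiff ?e [\<one>, x] = tr (t [^] i) (cdiff g) [\<one>, x] - cdiff g [\<one>, x]"
      using t by (simp only: cdiff_diff cdiff_tr nat_pow_closed)
    also have "tr (t [^] i) (cdiff g) [\<one>, x] = tr (t [^] i) f [\<one>, x]"
      using t xs g(2) by (intro tr_cong) auto
    finally have "cdiff ?e [\<one>, x] = 0" using inv[OF xs] g(2)[OF xs] by simp
    then show ?thesis by (simp add: s_def algebra_simps)
  qed
  have trg: "tr (t [^] (i::nat)) g \<in> coch 1 M" for i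
    by (rule tr_coch[OF g(1) _ Ms])
      (use t normalizes_nat_pow[OF M(2) Ms] in \<open>auto simp: normalizes_def\<close>)
  have sV: "s i \<in> V" for i
    unfolding s_def by (intro diff_V coch_V[OF trg] coch_V[OF g(1)]) (auto simp: tup_def)
  \<comment> \<open>Pigeonhole with \<open>card V + 1\<close> exponents. The difference of two
    exponents with the same value is positive and at most \<open>card V\<close>, hence divides the
    factorial.\<close>
  have "\<not> inj_on s {..card V}"
  proof
    assume "inj_on s {..card V}"
    then have "card {..card V} \<le> card V" using sV by (intro card_inj_on_le finite_V) auto
    then show False by simp
  qed
  then obtain i j where ij: "i < j" "j \<le> card V" "s i = s j"
    unfolding inj_on_def by (metis atMost_iff nat_neq_iff)
  define p where "p = j - i"
  have p: "p > 0" "p \<le> card V" using ij by (auto simp: p_def)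
  \<comment> \<open>Two translates of \<open>g\<close> agree, and translating back by
    \<open>t^i\<close> shows that \<open>t^p\<close> fixes \<open>g\<close>.\<close>
  have fix_p: "tr (t [^] p) g xs = g xs" if xs: "xs \<in> tup 1" for xs
  proof -
    have eq: "tr (t [^] j) g ys = tr (t [^] i) g ys" if "ys \<in> tup 1" for ys
      using that sx ij by (auto simp: tup_def length_Suc_conv)
    have "t [^] i \<otimes> t [^] p = t [^] j" using t ij by (simp add: nat_pow_mult p_def)
    then have "t [^] p = inv (t [^] i) \<otimes> t [^] j" using t by (metis inv_mult_cancel(1) nat_pow_closed)
    then have "tr (t [^] p) g xs = tr (inv (t [^] i)) (tr (t [^] j) g) xs"
      using t xs by (simp add: tr_mult)
    also have "\<dots> = tr (inv (t [^] i)) (tr (t [^] i) g) xs"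
      using t xs eq by (intro tr_cong) auto
    also have "\<dots> = g xs" using t xs by (simp add: tr_one flip: tr_mult)
    finally show ?thesis .
  qed
  have "p dvd fact (card V)" using p by (intro dvd_fact) auto
  then obtain q where q: "fact (card V) = p * q" by (metis dvdE)
  let ?S = "{s \<in> carrier G. \<forall>xs\<in>tup 1. tr s g xs = g xs}"
  have "t [^] p \<in> ?S" using fix_p t by simp
  then have "(t [^] p) [^] int q \<in> ?S" by (rule subgroup_int_pow_closed[OF stabilizer_subgroup])
  then have "t [^] (fact (card V) :: nat) \<in> ?S" using t by (simp add: q int_pow_int nat_pow_pow)
  then have "g \<in> coch 1 (semidirect M (t [^] (fact (card V) :: nat)))"
    using normalizes_nat_pow[OF M(2) Ms] by (intro coch_semidirect M g) auto
  then show ?thesis using g(2) by (auto simp: bc_def numeral_2_eq_2)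
qed


section \<open>The ascending step\<close>

lemma invariant_fin_ind_subgroup:
  assumes "shrinks t L" "fin_ind R L" "fin_gen L"
  obtains Q where "fin_ind Q L" "Q \<subseteq> R" "shrinks t Q"
proof -
  have t: "t \<in> carrier G" using assms by (simp add: shrinks_def)
  note c = subgroup.mem_carrier[OF fin_indD(2)[OF assms(2)]]
  have "endo_on L (\<lambda>x. inv t \<otimes> x \<otimes> t)"
    using assms(1) t c by (auto simp: endo_on_def shrinks_def group_simps)
  then obtain Q where "fin_ind Q L" "Q \<subseteq> R" "\<And>x. x \<in> Q \<Longrightarrow> inv t \<otimes> x \<otimes> t \<in> Q"
    using invariant_fin_ind[OF _ assms(2,3)] by blast
  then show ?thesis using that t by (simp add: shrinks_def)
qed

text \<open>If \<open>t^k\<close> lies in \<open>L\<close>, it conjugates \<open>L\<close> into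
  \<open>L\<close>; conjugating back \<open>k - 1\<close> times with the shrinking direction shows
  that \<open>t\<close> itself does so too. Hence \<open>t\<close> normalizes \<open>L\<close>, all
  of \<open>H\<close> consists of products of \<open>L\<close> with powers of \<open>t\<close>, and
  \<open>L\<close> already contains \<open>t^k\<close>.\<close>

lemma ascending_fin_ind:
  assumes L: "subgroup L G" "shrinks t L" and H: "subgroup H G" "L \<subseteq> H" "t \<in> H"
    and gen: "\<And>x. x \<in> H \<Longrightarrow> \<exists>i j. \<exists>l\<in>L. x = t [^] (i::nat) \<otimes> l \<otimes> inv (t [^] (j::nat))"
    and k: "k > 0" "t [^] (k::nat) \<in> L"
  shows "fin_ind L H"
proof -
  have t: "t \<in> carrier G" using L by (simp add: shrinks_def)
  note c = subgroup.mem_carrier[OF L(1)] and m = subgroup.m_closed[OF L(1)] and i = subgroup.m_inv_closed[OF L(1)]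
  have "t \<otimes> x \<otimes> inv t \<in> L" if x: "x \<in> L" for x
  proof -
    have "conj_pow t (k - 1) (t [^] k \<otimes> x \<otimes> inv (t [^] k)) \<in> L"
      using x k m i by (intro conj_pow_shrinks[OF L(2,1)]) auto
    moreover have "t [^] k \<otimes> x \<otimes> inv (t [^] k) = t [^] (k - 1) \<otimes> (t \<otimes> x \<otimes> inv t) \<otimes> inv (t [^] (k - 1))"
    proof -
      have "t [^] k = t [^] (k - 1) \<otimes> t" using k(1) by (metis Suc_diff_1 nat_pow_Suc)
      then show ?thesis using t x c by (simp add: group_simps)
    qed
    ultimately show ?thesis using t x c by (simp add: conj_pow_cancel)
  qed
  then have n: "normalizes t L" using L(2) by (simp add: normalizes_def shrinks_def)
  have "H \<subseteq> semidirect L t"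
  proof
    fix x assume "x \<in> H"
    then obtain i j l where x: "l \<in> L" "x = t [^] (i::nat) \<otimes> l \<otimes> inv (t [^] (j::nat))" using gen by blast
    note s = semidirect_subgroup[OF L(1) n]
    have "t [^] i \<in> semidirect L t" "t [^] j \<in> semidirect L t"
      using subgroup_int_pow_closed[OF s(1,3), of "int i"] subgroup_int_pow_closed[OF s(1,3), of "int j"]
      by (simp_all add: int_pow_int)
    then show "x \<in> semidirect L t"
      using x s(2) by (auto intro!: subgroup.m_closed[OF s(1)] subgroup.m_inv_closed[OF s(1)])
  qed
  then have "fin_ind (semidirect L (t [^] k)) H" by (intro fin_ind_semidirect_pow L(1) H n k(1))
  moreover have "semidirect L (t [^] k) = L"
  proof
    show "semidirect L (t [^] k) \<subseteq> L"
      using subgroup_int_pow_closed[OF L(1) k(2)] m by (auto simp: semidirect_def)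
    show "L \<subseteq> semidirect L (t [^] k)"
      using normalizes_nat_pow[OF n subgroup.subset[OF L(1)]] by (intro semidirect_subgroup L(1))
  qed
  ultimately show ?thesis by simp
qed

text \<open>\<open>H\<close> is a quotient of the ascending HNN extension of \<open>L\<close> given by conjugation with
  \<open>t\<close>; the case where a power of \<open>t\<close> lies in \<open>L\<close> makes \<open>L\<close> of finite index.\<close>

lemma effaceable_ascending:
  assumes L: "subgroup L G" "shrinks t L" "fin_gen L" "effaceable L"
    and H: "subgroup H G" "L \<subseteq> H" "t \<in> H"
    and gen: "\<And>x. x \<in> H \<Longrightarrow> \<exists>i j. \<exists>l\<in>L. x = t [^] (i::nat) \<otimes> l \<otimes> inv (t [^] (j::nat))"
  shows "effaceable H"
proof (cases "\<exists>k::nat. k > 0 \<and> t [^] k \<in> L")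
  case True
  then obtain k :: nat where "k > 0" "t [^] k \<in> L" by blast
  then have "fin_ind L H" by (intro ascending_fin_ind[OF L(1,2) H gen])
  then show ?thesis by (rule effaceable_overgroup[OF L(4)])
next
  case False
  have t: "t \<in> carrier G" using L by (simp add: shrinks_def)
  have Lc: "L \<subseteq> carrier G" using L subgroup.subset by blast
  have nt: "\<And>k::nat. k > 0 \<Longrightarrow> t [^] k \<notin> L" using False by blast
  show ?thesis
    unfolding effaceable_def
  proof (intro allI impI)
    fix n :: nat and R assume n: "n \<ge> 1" and R: "fin_ind R H"
    note R' = fin_indD[OF R]
    show "\<exists>Q. fin_ind Q R \<and> zc n R \<subseteq> bc n Q"
    proof (cases "n = 1")
      case True
      then show ?thesis
        using fin_ind_refl[OF R'(1)] zc_one_bc subgroup.subset[OF R'(1)] by auto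
    next
      case False
      \<comment> \<open>\<open>t\<close> itself need not lie in \<open>R\<close>. Its power
        \<open>s\<close> does, and so fixes the cochains equivariant under \<open>R\<close>.\<close>
      obtain m :: nat where m: "m > 0" "t [^] m \<in> R" using fin_ind_pow[OF R H(3)] by blast
      define s where "s = t [^] m"
      have s: "s \<in> carrier G" "s \<in> R" "s \<in> H" using t m R'(3) by (auto simp: s_def)
      have sL: "shrinks s L" unfolding s_def by (rule shrinks_pow[OF L(2,1)])
      have ns: "s [^] k \<notin> L" if "k > 0" for k :: nat
        using nt[of "m * k"] that m t by (simp add: s_def nat_pow_pow)
      define L0 where "L0 = R \<inter> L"
      have L0: "fin_ind L0 L" unfolding L0_def by (rule fin_ind_Int_subgroup[OF R L(1) H(2)])
      have sL0: "shrinks s L0"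
        using sL s R'(1) by (auto simp: shrinks_def L0_def intro: subgroup.m_closed subgroup.m_inv_closed)
      let ?M = "limit_group s"
      \<comment> \<open>The union is formed inside \<open>R\<close>, so that cocycles of
        \<open>R\<close> restrict to it: both \<open>L0\<close> and the conjugating element
        \<open>s\<close> lie in \<open>R\<close>.\<close>
      have MR: "?M L0 \<subseteq> R"
      proof
        fix x assume "x \<in> ?M L0"
        then obtain i where x: "x \<in> carrier G" "conj_pow s i x \<in> L0" by (rule limit_groupE)
        have si: "s [^] i \<in> R"
          using subgroup_int_pow_closed[OF R'(1) s(2), of "int i"] by (simp add: int_pow_int)
        have "x = s [^] i \<otimes> conj_pow s i x \<otimes> inv (s [^] i)"
          using x s by (simp add: conj_pow_def group_simps)
        also have "\<dots> \<in> R"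
          using x(2) si by (auto simp: L0_def intro: subgroup.m_closed[OF R'(1)] subgroup.m_inv_closed[OF R'(1)])
        finally show "x \<in> R" .
      qed
      \<comment> \<open>Effaceability of \<open>L\<close> kills the cocycles of \<open>P\<close> on
        some subgroup; this is shrunk to one stable under \<open>s\<close>, and the statement then
        passes to the unions.\<close>
      have kill: "\<exists>Q. fin_ind Q L \<and> Q \<subseteq> P \<and> shrinks s Q \<and> zc (Suc p) (?M P) \<subseteq> bc (Suc p) (?M Q)"
        if P: "fin_ind P L" "shrinks s P" for P p
      proof -
        obtain Q where Q: "fin_ind Q P" "zc (Suc p) P \<subseteq> bc (Suc p) Q"
          using effaceableD[OF L(4) P(1), of "Suc p"] by auto
        obtain Q' where Q': "fin_ind Q' L" "Q' \<subseteq> Q" "shrinks s Q'"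
          using invariant_fin_ind_subgroup[OF sL fin_ind_trans[OF Q(1) P(1)] L(3)] .
        have "zc (Suc p) P \<subseteq> bc (Suc p) Q'" using Q(2) bc_mono[OF Q'(2)] by blast
        then have "zc (Suc p) (?M P) \<subseteq> bc (Suc p) (?M Q')"
          using P Q' fin_indD by (intro zc_limit_group) auto
        then show ?thesis using Q' fin_indD(3)[OF Q(1)] by blast
      qed
      have sub: "subgroup (?M Q) G" "normalizes s (?M Q)" if "fin_ind Q L" "shrinks s Q" for Q
        using that limit_group_subgroup normalizes_limit_group fin_indD(1) by blast+
      \<comment> \<open>The index is estimated in \<open>H\<close> through the union built from all
        of \<open>L\<close>, and is then restricted to \<open>R\<close>.\<close>
      have fin: "fin_ind (semidirect (?M Q) (s [^] q)) R"
        if Q: "fin_ind Q L" "shrinks s Q" "Q \<subseteq> L0" and q: "q > 0" for Q and q :: nat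
      proof -
        have LL: "subgroup (?M L) G" "normalizes s (?M L)"
          using sub[OF fin_ind_refl[OF L(1)] sL] by auto
        have "fin_ind (semidirect (?M Q) (s [^] q)) (semidirect (?M L) (s [^] q))"
          using sub[OF Q(1,2)] LL subgroup.subset
          by (intro fin_ind_semidirect fin_ind_limit_group Q sL normalizes_nat_pow) auto
        moreover have "fin_ind (semidirect (?M L) (s [^] q)) H"
        proof -
          \<comment> \<open>The conjugates by powers of \<open>s\<close> are cofinal among those by
            powers of \<open>t\<close>, so \<open>s\<close> and \<open>t\<close> give the same union
            for \<open>L\<close>.\<close>
          have "?M L \<subseteq> limit_group t L"
            using t by (auto simp: s_def conj_pow_pow elim!: limit_groupE intro: limit_groupI)
          moreover have "limit_group t L \<subseteq> ?M L"
          proof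
            fix x assume "x \<in> limit_group t L"
            then obtain i where x: "x \<in> carrier G" "conj_pow t i x \<in> L" by (rule limit_groupE)
            have "i \<le> m * i" using m by simp
            then have "conj_pow t (m * i) x \<in> L"
              using conj_pow_add[OF t x(1), of i "m * i - i"] conj_pow_shrinks[OF L(2,1) x(2)] by simp
            then have "conj_pow s i x \<in> L" using t x by (simp add: s_def conj_pow_pow)
            then show "x \<in> ?M L" using x limit_groupI by blast
          qed
          ultimately have eq: "?M L = limit_group t L" by blast
          have LM: "subgroup (limit_group t L) G" "normalizes t (limit_group t L)"
            using limit_group_subgroup[OF L(2,1)] normalizes_limit_group[OF L(2,1)] .
          note sd = semidirect_subgroup[OF LM]
          have tH: "t [^] i \<in> H" for i :: nat
            using subgroup_int_pow_closed[OF H(1,3), of "int i"] by (simp add: int_pow_int)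
          have "limit_group t L \<subseteq> H"
          proof
            fix x assume "x \<in> limit_group t L"
            then obtain i where x: "x \<in> carrier G" "conj_pow t i x \<in> L" by (rule limit_groupE)
            have "x = t [^] i \<otimes> conj_pow t i x \<otimes> inv (t [^] i)"
              using x t by (simp add: conj_pow_def group_simps)
            also have "\<dots> \<in> H"
              using x(2) H(2) tH by (auto intro: subgroup.m_closed[OF H(1)] subgroup.m_inv_closed[OF H(1)])
            finally show "x \<in> H" .
          qed
          moreover have "H \<subseteq> semidirect (limit_group t L) t"
          proof
            fix x assume "x \<in> H"
            then obtain i j l where x: "l \<in> L" "x = t [^] (i::nat) \<otimes> l \<otimes> inv (t [^] (j::nat))"
              using gen by blast
            have "t [^] i \<in> semidirect (limit_group t L) t" "t [^] j \<in> semidirect (limit_group t L) t"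
              using subgroup_int_pow_closed[OF sd(1,3), of "int i"]
                subgroup_int_pow_closed[OF sd(1,3), of "int j"]
              by (simp_all add: int_pow_int)
            moreover have "l \<in> semidirect (limit_group t L) t"
              using x(1) subset_limit_group[OF L(1)] sd(2) by blast
            ultimately show "x \<in> semidirect (limit_group t L) t"
              unfolding x(2) by (intro subgroup.m_closed[OF sd(1)] subgroup.m_inv_closed[OF sd(1)])
          qed
          ultimately have "fin_ind (semidirect (limit_group t L) (t [^] (m * q))) H"
            using m(1) q by (intro fin_ind_semidirect_pow LM H) auto
          moreover have "s [^] q = t [^] (m * q)" using t by (simp add: s_def nat_pow_pow)
          ultimately show ?thesis by (simp add: eq)
        qed
        ultimately have F: "fin_ind (semidirect (?M Q) (s [^] q)) H" by (rule fin_ind_trans)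
        have "semidirect (?M Q) (s [^] q) \<subseteq> R"
        proof
          fix x assume "x \<in> semidirect (?M Q) (s [^] q)"
          then obtain a k where x: "a \<in> ?M Q" "x = a \<otimes> (s [^] q) [^] (k::int)" by (rule semidirectE)
          have "s [^] q \<in> R"
            using subgroup_int_pow_closed[OF R'(1) s(2), of "int q"] by (simp add: int_pow_int)
          moreover have "a \<in> R" using x(1) limit_group_mono[OF Q(3)] MR by blast
          ultimately show "x \<in> R"
            unfolding x(2) by (intro subgroup.m_closed[OF R'(1)] subgroup_int_pow_closed[OF R'(1)])
        qed
        then show ?thesis by (rule fin_ind_mono(2)[OF F R'(1) _ R'(3)])
      qed
      have nsM: "s [^] k \<notin> ?M Q" if "k > 0" "Q \<subseteq> L" for k :: nat and Q
        using pow_notin_limit_group[of s k Q] ns[OF that(1)] that(2) s by blast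
      have inv: "tr s f xs = f xs" if "f \<in> zc n R" "xs \<in> tup n" for f xs
        using that tr_invariant[of f n R s xs] s(2) subgroup.subset[OF R'(1)] unfolding zc_def by blast
      \<comment> \<open>Here \<open>n\<close> counts arguments and is at least 2, so
        \<open>p = 0\<close> is cohomological degree one.\<close>
      obtain p where p: "n = Suc (Suc p)" using n False by (cases n; cases "n - 1") auto
      obtain Q where Q: "fin_ind Q L" "Q \<subseteq> L0" "shrinks s Q" "zc n (?M L0) \<subseteq> bc n (?M Q)"
        using kill[OF L0 sL0, of "Suc p"] p by blast
      have ZR: "zc n R \<subseteq> bc n (?M Q)" using Q(4) zc_mono[OF MR] by blast
      show ?thesis
      proof (cases p)
        case 0
        \<comment> \<open>The exponent depends only on the size of \<open>V\<close>, so the same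
          subgroup serves every cocycle of \<open>R\<close>.\<close>
        let ?q = "fact (card V) :: nat"
        have "zc n R \<subseteq> bc n (semidirect (?M Q) (s [^] ?q))"
        proof
          fix f assume f: "f \<in> zc n R"
          have "n = 2" using p 0 by simp
          then show "f \<in> bc n (semidirect (?M Q) (s [^] ?q))"
            using wang_step_degree_one[OF sub[OF Q(1,3)], of f] ZR f inv[OF f] by blast
        qed
        then show ?thesis using fin[OF Q(1,3,2), of ?q] by auto
      next
        case (Suc r)
        \<comment> \<open>A second shrinking, with one argument less: it kills the cocycle
          \<open>t g - g\<close> of the Wang sequence.\<close>
        obtain Q' where Q': "fin_ind Q' L" "Q' \<subseteq> Q" "shrinks s Q'" "zc (Suc p) (?M Q) \<subseteq> bc (Suc p) (?M Q')"
          using kill[OF Q(1,3), of p] by blast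
        have "zc n R \<subseteq> bc n (semidirect (?M Q') s)"
        proof
          fix f assume f: "f \<in> zc n R"
          show "f \<in> bc n (semidirect (?M Q') s)"
            unfolding p Suc
          proof (rule wang_step[OF sub[OF Q(1,3)] sub[OF Q'(1,3)] limit_group_mono[OF Q'(2)]])
            show "s [^] k \<notin> ?M Q'" if "k > 0" for k :: nat
              using nsM that fin_indD(3)[OF Q'(1)] by blast
            show "zc (Suc (Suc r)) (?M Q) \<subseteq> bc (Suc (Suc r)) (?M Q')" using Q'(4) Suc by simp
            show "f \<in> bc (Suc (Suc (Suc r))) (?M Q)" using ZR f p Suc by auto
            show "tr s f xs = f xs" if "xs \<in> tup (Suc (Suc (Suc r)))" for xs
              using inv[OF f] that p Suc by simp
          qed
        qed
        then show ?thesis using fin[OF Q'(1,3), of 1] Q'(2) Q(2) s(1) by auto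
      qed
    qed
  qed
qed

end

section \<open>Cochains that factor through a finite quotient\<close>

context fin_module
begin

definition cosets :: "'a set \<Rightarrow> 'a list \<Rightarrow> 'a set list" where
  "cosets N xs = map (\<lambda>x. N #> x) xs"

lemma cosets_simps [simp]:
  "cosets N [] = []" "cosets N (x # xs) = (N #> x) # cosets N xs"
  "cosets N (xs @ ys) = cosets N xs @ cosets N ys" "length (cosets N xs) = length xs"
  by (auto simp: cosets_def)

lemma cosets_length: "cosets N xs = cosets N ys \<Longrightarrow> length xs = length ys"
  by (metis cosets_simps(4))

lemma cosets_mono:
  assumes "cosets N xs = cosets N ys" "N \<subseteq> M" "subgroup N G" "subgroup M G"
    "set xs \<subseteq> carrier G" "set ys \<subseteq> carrier G"
  shows "cosets M xs = cosets M ys"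
  using cosets_length[OF assms(1)] assms
proof (induction xs ys rule: list_induct2)
  case (Cons x xs y ys)
  then have "x \<otimes> inv y \<in> N" by (intro r_coset_eqD) auto
  then have "M #> x = M #> y" using Cons.prems by (intro r_coset_eqI) auto
  then show ?case using Cons by simp
qed simp

lemma cosets_shift:
  assumes "cosets N xs = cosets N ys" "N \<lhd> G" "s \<in> carrier G"
    "set xs \<subseteq> carrier G" "set ys \<subseteq> carrier G"
  shows "cosets N (shift s xs) = cosets N (shift s ys)"
  using cosets_length[OF assms(1)] assms
proof (induction xs ys rule: list_induct2)
  case (Cons x xs y ys)
  have N: "subgroup N G" using Cons.prems by (simp add: normal_imp_subgroup)
  have xy: "x \<in> carrier G" "y \<in> carrier G" using Cons.prems by auto
  have "x \<otimes> inv y \<in> N" by (rule r_coset_eqD[OF N xy]) (use Cons.prems in simp)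
  then have "s \<otimes> (x \<otimes> inv y) \<otimes> inv s \<in> N"
    by (rule normal.inv_op_closed2[OF Cons.prems(2,3)])
  then have "N #> (s \<otimes> x) = N #> (s \<otimes> y)"
    using xy Cons.prems(3) by (intro r_coset_eqI N) (simp_all add: group_simps)
  then show ?case using Cons by simp
qed simp

lemma cosets_shift_self:
  assumes "N \<lhd> G" "s \<in> N" "set xs \<subseteq> carrier G"
  shows "cosets N (shift s xs) = cosets N xs"
  using assms(3)
proof (induction xs)
  case (Cons x xs)
  have N: "subgroup N G" using assms by (simp add: normal_imp_subgroup)
  have "s \<in> carrier G" using assms N subgroup.mem_carrier by metis
  then have "N #> (s \<otimes> x) = N #> x"
    using Cons.prems assms by (intro r_coset_eqI N) (simp_all add: group_simps)
  then show ?case using Cons by simp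
qed simp

text \<open>Of the \<open>n\<close> arguments, the first \<open>p\<close> have been reduced modulo
  \<open>N\<close>; the others may be arbitrary. \<open>p = 0\<close> imposes nothing, and
  \<open>p = n\<close> says that \<open>f\<close> comes from the quotient.\<close>

definition factors :: "'a set \<Rightarrow> nat \<Rightarrow> nat \<Rightarrow> ('a list \<Rightarrow> 'v) \<Rightarrow> bool" where
  "factors N p n f \<longleftrightarrow> (\<forall>ys ys' zs. length ys = p \<and> ys @ zs \<in> tup n \<and> ys' @ zs \<in> tup n \<and>
     cosets N ys = cosets N ys' \<longrightarrow> f (ys @ zs) = f (ys' @ zs))"

lemma factorsD:
  assumes "factors N p n f" "cosets N ys = cosets N ys'" "length ys = p" "ys @ zs \<in> tup n" "ys' @ zs \<in> tup n"
  shows "f (ys @ zs) = f (ys' @ zs)"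
  using assms by (auto simp: factors_def)

lemma factors_zero: "factors N 0 n f"
  by (auto simp: factors_def cosets_def)

lemma factors_mono:
  assumes "factors N p n f" "M \<subseteq> N" "subgroup M G" "subgroup N G" "q \<le> p" "p \<le> n"
  shows "factors M q n f"
  unfolding factors_def
proof (intro allI impI, elim conjE)
  fix ys ys' zs assume ys: "length ys = q" "ys @ zs \<in> tup n" "ys' @ zs \<in> tup n" "cosets M ys = cosets M ys'"
  have "cosets N ys = cosets N ys'"
    by (rule cosets_mono[OF ys(4) assms(2-4)]) (use ys in \<open>auto simp: tup_def\<close>)
  then have c: "cosets N (ys @ take (p - q) zs) = cosets N (ys' @ take (p - q) zs)" by simp
  have l: "length (ys @ take (p - q) zs) = p" using ys assms by (auto simp: tup_def)
  have "f ((ys @ take (p - q) zs) @ drop (p - q) zs) = f ((ys' @ take (p - q) zs) @ drop (p - q) zs)"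
    by (rule factorsD[OF assms(1) c l]) (use ys in simp_all)
  then show "f (ys @ zs) = f (ys' @ zs)" by simp
qed

lemma cdiff_cosets_cong:
  assumes "cosets N ys = cosets N ys'" "ys \<in> tup (Suc m)" "ys' \<in> tup (Suc m)"
    and "\<And>us us'. us \<in> tup m \<Longrightarrow> us' \<in> tup m \<Longrightarrow> cosets N us = cosets N us' \<Longrightarrow> f us = g us'"
  shows "cdiff f ys = cdiff g ys'"
  using assms
proof (induction m arbitrary: ys ys' f g)
  case 0
  then show ?case by (auto simp: tup_def length_Suc_conv)
next
  case (Suc m)
  obtain y zs where y: "ys = y # zs" "y \<in> carrier G" "zs \<in> tup (Suc m)" using Suc.prems(2) by (rule tup_SucE)
  obtain y' zs' where y': "ys' = y' # zs'" "y' \<in> carrier G" "zs' \<in> tup (Suc m)" using Suc.prems(3) by (rule tup_SucE)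
  have c: "N #> y = N #> y'" "cosets N zs = cosets N zs'" using Suc.prems(1) y y' by auto
  have "cdiff (\<lambda>us. f (y # us)) zs = cdiff (\<lambda>us. g (y' # us)) zs'"
    by (rule Suc.IH[OF c(2) y(3) y'(3)], rule Suc.prems(4)) (use y y' c in \<open>auto simp: tup_Cons\<close>)
  moreover have "f zs = g zs'" by (rule Suc.prems(4)) (use y y' c in auto)
  ultimately show ?case using y y' by simp
qed

lemma cdiff_shift_eq:
  assumes "s \<in> carrier G" "xs \<in> tup (Suc n)" "\<And>ys. ys \<in> tup n \<Longrightarrow> f (shift s ys) = act s (g ys)"
  shows "cdiff f (shift s xs) = act s (cdiff g xs)"
proof -
  have "cdiff f (shift s xs) = cdiff (\<lambda>ys. f (shift s ys)) xs"
    by (simp add: shift_def cdiff_map)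
  also have "\<dots> = cdiff (\<lambda>ys. act s (g ys)) xs"
    by (rule cdiff_tup_cong) (use assms in auto)
  finally show ?thesis using cdiff_hom[of "act s" g] act_diff[OF assms(1)] by simp
qed

text \<open>\<open>G / N\<close> acts freely on nonempty tuples of cosets through the first entry.
  So one solution may be chosen freely after moving the first entry to the trivial coset, and is
  then translated back. The representative used for moving is ambiguous up to \<open>N\<close>,
  which is harmless because solutions are equivariant under \<open>N\<close>.\<close>

lemma equivariant_choice:
  assumes N: "N \<lhd> G"
    and ex: "\<And>Y. Y \<in> tup (Suc p) \<Longrightarrow> \<exists>g. Q Y g"
    and Q_coch: "\<And>Y g. Q Y g \<Longrightarrow> g \<in> coch q N"
    and Q_tr: "\<And>s Y g. Y \<in> tup (Suc p) \<Longrightarrow> Q Y g \<Longrightarrow> s \<in> carrier G \<Longrightarrow> Q (shift s Y) (tr s g)"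
    and Q_cong: "\<And>Y Y' g. Y \<in> tup (Suc p) \<Longrightarrow> Y' \<in> tup (Suc p) \<Longrightarrow> cosets N Y = cosets N Y' \<Longrightarrow> Q Y g \<Longrightarrow> Q Y' g"
  obtains F where "\<And>Y. Y \<in> tup (Suc p) \<Longrightarrow> Q Y (F Y)"
    and "\<And>Y Y'. Y \<in> tup (Suc p) \<Longrightarrow> Y' \<in> tup (Suc p) \<Longrightarrow> cosets N Y = cosets N Y' \<Longrightarrow> F Y = F Y'"
    and "\<And>s Y zs. Y \<in> tup (Suc p) \<Longrightarrow> s \<in> carrier G \<Longrightarrow> zs \<in> tup q \<Longrightarrow>
      F (shift s Y) (shift s zs) = act s (F Y zs)"
proof -
  have Ns: "subgroup N G" using N by (simp add: normal_imp_subgroup)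
  define r where "r c = (SOME x. x \<in> carrier G \<and> N #> x = c)" for c
  have r: "r (N #> x) \<in> carrier G \<and> N #> r (N #> x) = N #> x" if "x \<in> carrier G" for x
    unfolding r_def by (rule someI[of _ x]) (simp add: that)
  define g0 where "g0 C = (SOME g. \<exists>Y\<in>tup (Suc p). cosets N Y = C \<and> Q Y g)" for C
  have g0: "\<exists>Y'\<in>tup (Suc p). cosets N Y' = cosets N Y \<and> Q Y' (g0 (cosets N Y))" if "Y \<in> tup (Suc p)" for Y
  proof -
    have "\<exists>g. \<exists>Y'\<in>tup (Suc p). cosets N Y' = cosets N Y \<and> Q Y' g" using ex[OF that] that by blast
    then show ?thesis unfolding g0_def by (rule someI_ex)
  qed
  have g0Q: "Q Y (g0 (cosets N Y))" if "Y \<in> tup (Suc p)" for Y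
    using g0[OF that] Q_cong that by blast
  define \<rho> where "\<rho> Y = r (N #> hd Y)" for Y
  have hd_c: "hd Y \<in> carrier G" if "Y \<in> tup (Suc p)" for Y using that by (auto elim: tup_SucE)
  have \<rho>: "\<rho> Y \<in> carrier G" "N #> \<rho> Y = N #> hd Y" if "Y \<in> tup (Suc p)" for Y
    using r hd_c that by (auto simp: \<rho>_def)
  \<comment> \<open>\<open>\<rho> Y\<close> is the representative of the first coset. The chosen
    solution is taken for the tuple translated by its inverse, and is carried back.\<close>
  define F where "F Y = tr (\<rho> Y) (g0 (cosets N (shift (inv (\<rho> Y)) Y)))" for Y
  show ?thesis
  proof (rule that)
    fix Y assume Y: "Y \<in> tup (Suc p)"
    note \<rho> = \<rho>[OF Y]
    have Y': "shift (inv (\<rho> Y)) Y \<in> tup (Suc p)" using Y \<rho> by (intro shift_tup) auto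
    have "Q (shift (\<rho> Y) (shift (inv (\<rho> Y)) Y)) (F Y)"
      unfolding F_def by (rule Q_tr[OF Y' g0Q[OF Y'] \<rho>(1)])
    then show "Q Y (F Y)" using \<rho> Y by (simp add: shift_inv)
  next
    fix Y Y' assume Y: "Y \<in> tup (Suc p)" "Y' \<in> tup (Suc p)" "cosets N Y = cosets N Y'"
    then have "\<rho> Y = \<rho> Y'" unfolding \<rho>_def by (auto elim!: tup_SucE)
    moreover have "cosets N (shift (inv (\<rho> Y)) Y) = cosets N (shift (inv (\<rho> Y)) Y')"
      by (rule cosets_shift[OF Y(3) N]) (use Y \<rho> in \<open>auto simp: tup_def\<close>)
    ultimately show "F Y = F Y'" by (simp add: F_def)
  next
    fix s Y zs assume Y: "Y \<in> tup (Suc p)" and s: "s \<in> carrier G" and zs: "zs \<in> tup q"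
    note \<rho>Y = \<rho>[OF Y]
    have sY: "shift s Y \<in> tup (Suc p)" using Y s by (rule shift_tup[rotated])
    note \<rho>sY = \<rho>[OF sY]
    \<comment> \<open>The failure of \<open>\<rho>\<close> to commute with translation by
      \<open>s\<close>. It lies in \<open>N\<close>, since both elements represent the same
      coset.\<close>
    define \<nu> where "\<nu> = inv (s \<otimes> \<rho> Y) \<otimes> \<rho> (shift s Y)"
    have \<nu>c: "\<nu> \<in> carrier G" using s \<rho>Y \<rho>sY by (simp add: \<nu>_def)
    have "cosets N (shift s [\<rho> Y]) = cosets N (shift s [hd Y])"
      by (rule cosets_shift[OF _ N s]) (use \<rho>Y hd_c[OF Y] in auto)
    moreover have "hd (shift s Y) = s \<otimes> hd Y" using Y by (auto elim: tup_SucE)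
    ultimately have "N #> \<rho> (shift s Y) = N #> (s \<otimes> \<rho> Y)" using \<rho>sY by simp
    then have "\<rho> (shift s Y) \<otimes> inv (s \<otimes> \<rho> Y) \<in> N"
      using s \<rho>Y \<rho>sY by (intro r_coset_eqD Ns) auto
    then have "inv (s \<otimes> \<rho> Y) \<otimes> (\<rho> (shift s Y) \<otimes> inv (s \<otimes> \<rho> Y)) \<otimes> (s \<otimes> \<rho> Y) \<in> N"
      using N s \<rho>Y by (intro normal.inv_op_closed1) auto
    then have \<nu>: "\<nu> \<in> N" using s \<rho>Y \<rho>sY by (simp add: \<nu>_def group_simps)
    have \<rho>eq: "\<rho> (shift s Y) = s \<otimes> \<rho> Y \<otimes> \<nu>"
      using s \<rho>Y \<rho>sY by (simp add: \<nu>_def group_simps)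
    let ?Z = "shift (inv (\<rho> Y)) Y"
    have Z: "?Z \<in> tup (Suc p)" using Y \<rho>Y by (intro shift_tup) auto
    have sh: "shift (inv (\<rho> (shift s Y))) (shift s xs) = shift (inv \<nu>) (shift (inv (\<rho> Y)) xs)"
      if xs: "xs \<in> tup m" for xs m
    proof -
      have "shift (inv (\<rho> (shift s Y))) (shift s xs) = shift (inv (\<rho> (shift s Y)) \<otimes> s) xs"
        using s \<rho>sY xs by (simp add: shift_mult)
      also have "inv (\<rho> (shift s Y)) \<otimes> s = inv \<nu> \<otimes> inv (\<rho> Y)"
        unfolding \<rho>eq using s \<rho>Y \<nu>c by (simp add: group_simps)
      finally show ?thesis using \<nu>c \<rho>Y xs by (simp add: shift_mult)
    qed
    have "inv \<nu> \<in> N" using \<nu> subgroup.m_inv_closed[OF Ns] by blast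
    then have C: "cosets N (shift (inv (\<rho> (shift s Y))) (shift s Y)) = cosets N ?Z"
      unfolding sh[OF Y] using Z by (intro cosets_shift_self[OF N]) (auto simp: tup_def)
    let ?g = "g0 (cosets N ?Z)"
    have g: "?g \<in> coch q N" using Q_coch[OF g0Q[OF Z]] .
    let ?w = "shift (inv (\<rho> Y)) zs"
    have w: "?w \<in> tup q" using zs \<rho>Y by (intro shift_tup) auto
    have "F (shift s Y) (shift s zs) = act (\<rho> (shift s Y)) (?g (shift (inv \<nu>) ?w))"
      unfolding F_def C tr_def sh[OF zs] ..
    also have "?g (shift (inv \<nu>) ?w) = act (inv \<nu>) (?g ?w)"
      by (rule coch_shift[OF g w \<open>inv \<nu> \<in> N\<close>])
    also have "act (\<rho> (shift s Y)) \<dots> = act s (act (\<rho> Y) (?g ?w))"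
      unfolding \<rho>eq using s \<rho>Y \<nu>c by (simp add: act_mult act_act_inv)
    finally show "F (shift s Y) (shift s zs) = act s (F Y zs)"
      by (simp add: F_def tr_def)
  qed
qed

lemma factors_step_top:
  assumes "f \<in> coch (Suc p) (carrier G)" "subgroup N G"
    and "factors N p (Suc p) f" "factors N (Suc p) (Suc (Suc p)) (cdiff f)"
  shows "factors N (Suc p) (Suc p) f"
  unfolding factors_def
proof (intro allI impI, elim conjE)
  fix ys ys' zs assume ys: "length ys = Suc p" "ys @ zs \<in> tup (Suc p)" "ys' @ zs \<in> tup (Suc p)"
    "cosets N ys = cosets N ys'"
  obtain u w where u: "ys = u @ [w]" using ys(1) by (cases ys rule: rev_cases) auto
  obtain u' w' where u': "ys' = u' @ [w']" using ys cosets_length[OF ys(4)] by (cases ys' rule: rev_cases) auto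
  have c: "cosets N u = cosets N u'" "N #> w = N #> w'" using ys(4) u u' by auto
  have l: "u \<in> tup p" "u' \<in> tup p" "w \<in> carrier G" "w' \<in> carrier G" "zs = []"
    using ys u u' cosets_length[OF ys(4)] by (auto simp: tup_def)
  have "cdiff f ((u @ [w]) @ [w]) = cdiff f ((u @ [w']) @ [w])"
    by (rule factorsD[OF assms(4)]) (use l c in \<open>auto simp: tup_def\<close>)
  moreover have "cdiff (\<lambda>v. f (v @ [w, w])) u = cdiff (\<lambda>v. f (v @ [w', w])) u"
  proof (cases p)
    case 0
    then show ?thesis using l by (auto simp: tup_def)
  next
    case (Suc m)
    have "f (v @ [w, w]) = f (v @ [w', w])" if "v \<in> tup m" for v
      using factorsD[OF assms(3), of "v @ [w]" "v @ [w']" "[w]"] that l c Suc by (auto simp: tup_def)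
    then show ?thesis using l Suc by (intro cdiff_tup_cong[of _ m]) auto
  qed
  ultimately have "f (u @ [w]) = f (u @ [w'])"
    using cdiff_append[of f u "[w, w]"] cdiff_append[of f u "[w', w]"] by (auto split: if_splits)
  moreover have "f (u @ [w']) = f (u' @ [w'])"
    by (rule factorsD[OF assms(3) c(1)]) (use l in \<open>auto simp: tup_def\<close>)
  ultimately show "f (ys @ zs) = f (ys' @ zs)" using u u' l by simp
qed

text \<open>\<open>F Y\<close> with \<open>Y = y @ [z\<^sub>0]\<close> trivializes the cocycle \<open>d f(Y, \<hyphen>)\<close> of the remaining variables.
  Substituting the last entry of \<open>Y\<close> once more as the first free variable gives the
  correction term; the term with \<open>f\<close> compensates for cochains not being normalized.\<close>

lemma factors_step:
  assumes f: "f \<in> coch (Suc (p + Suc r)) (carrier G)"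
    and N: "N \<lhd> G" and N': "N' \<lhd> G" "N' \<subseteq> N"
    and kill: "zc (Suc (Suc r)) N \<subseteq> bc (Suc (Suc r)) N'"
    and fac: "factors N p (Suc (p + Suc r)) f" "factors N (Suc p) (Suc (Suc (p + Suc r))) (cdiff f)"
  obtains g where "g \<in> coch (p + Suc r) (carrier G)"
    "factors N' (Suc p) (Suc (p + Suc r)) (\<lambda>xs. f xs - cdiff g xs)"
proof -
  let ?q = "Suc r" and ?n = "Suc (p + Suc r)"
  have Ns: "subgroup N G" "subgroup N' G" using N N' by (auto simp: normal_imp_subgroup)
  have Nc: "N \<subseteq> carrier G" "N' \<subseteq> carrier G" using Ns subgroup.subset by auto
  \<comment> \<open>The part of the differential that omits an entry after \<open>y\<close>. It
    depends on \<open>y\<close> and \<open>w\<close> only modulo \<open>N\<close>: the full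
    differential does by assumption, and omitting an entry of \<open>y\<close> moves
    \<open>w\<close> among the first \<open>p\<close> arguments.\<close>
  define C where "C y w z = cdiff (\<lambda>v. f (y @ v)) (w # z)" for y w z
  have C_cong: "C y w z = C y' w' z'"
    if c: "cosets N y = cosets N y'" "N #> w = N #> w'" and l: "y \<in> tup p" "y' \<in> tup p"
      "w \<in> carrier G" "w' \<in> carrier G" "z \<in> tup (Suc ?q)" "z' = z" for y y' w w' z z'
  proof -
    have "cdiff f ((y @ [w]) @ z) = cdiff f ((y' @ [w']) @ z)"
      by (rule factorsD[OF fac(2)]) (use l c in \<open>auto simp: tup_def\<close>)
    moreover have "cdiff (\<lambda>v. f (v @ w # z)) y = cdiff (\<lambda>v. f (v @ w' # z)) y'"
    proof (cases p)
      case 0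
      then show ?thesis using l by (auto simp: tup_def)
    next
      case (Suc m)
      show ?thesis
      proof (rule cdiff_cosets_cong[OF c(1)])
        fix us us' assume "us \<in> tup m" "us' \<in> tup m" "cosets N us = cosets N us'"
        then show "f (us @ w # z) = f (us' @ w' # z)"
          using factorsD[OF fac(1), of "us @ [w]" "us' @ [w']" z] l c Suc by (auto simp: tup_def)
      qed (use l Suc in auto)
    qed
    moreover have "length y = length y'" using l by (simp add: tup_def)
    ultimately show ?thesis
      using cdiff_append[of f y "w # z"] cdiff_append[of f y' "w' # z"] l
      unfolding C_def by (cases "even (length y)") (simp_all del: cdiff.simps)
  qed
  define E where "E Y z = cdiff (\<lambda>v. f (Y @ v)) z" for Y z
  have E_eq: "E (y @ [w]) z = f (y @ z) - C y w z" for y w z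
    by (simp add: E_def C_def)
  have Y_cases: "\<exists>y w. Y = y @ [w] \<and> y \<in> tup p \<and> w \<in> carrier G" if "Y \<in> tup (Suc p)" for Y
    using that by (cases Y rule: rev_cases) (auto simp: tup_def)
  have E_cong: "E Y z = E Y' z"
    if YY: "Y \<in> tup (Suc p)" "Y' \<in> tup (Suc p)" "cosets N Y = cosets N Y'" and z: "z \<in> tup (Suc ?q)" for Y Y' z
  proof -
    obtain y w where y: "Y = y @ [w]" "y \<in> tup p" "w \<in> carrier G" using Y_cases[OF YY(1)] by blast
    obtain y' w' where y': "Y' = y' @ [w']" "y' \<in> tup p" "w' \<in> carrier G" using Y_cases[OF YY(2)] by blast
    have c: "cosets N y = cosets N y'" "N #> w = N #> w'" using YY(3) y y' by auto
    have "f (y @ z) = f (y' @ z)"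
      by (rule factorsD[OF fac(1) c(1)]) (use y y' z in \<open>auto simp: tup_def\<close>)
    then show ?thesis using C_cong[OF c y(2) y'(2) y(3) y'(3) z HOL.refl] y y' by (simp add: E_eq)
  qed
  have E_V: "E Y z \<in> V" if "Y \<in> tup (Suc p)" "z \<in> tup (Suc ?q)" for Y z
    unfolding E_def using that
    by (intro cdiff_V[OF that(2)] coch_V[OF f]) (auto simp: tup_def)
  have E_shift: "E (shift s Y) (shift s z) = act s (E Y z)"
    if "Y \<in> tup (Suc p)" "z \<in> tup (Suc ?q)" "s \<in> carrier G" for s Y z
    unfolding E_def
  proof (rule cdiff_shift_eq[OF that(3,2)])
    fix v assume "v \<in> tup ?q"
    then have "Y @ v \<in> tup ?n" using that by (auto simp: tup_def)
    then show "f (shift s Y @ shift s v) = act s (f (Y @ v))"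
      using coch_shift[OF f, of "Y @ v" s] that by simp
  qed
  \<comment> \<open>Translation by an element of \<open>N\<close> does not change the cosets of the
    parameter \<open>Y\<close>. So the equivariance of \<open>f\<close> in all variables yields
    equivariance of \<open>E Y\<close> under \<open>N\<close> in the free variables.\<close>
  have E_zc: "E Y \<in> zc (Suc ?q) N" if Y: "Y \<in> tup (Suc p)" for Y
  proof -
    have "E Y \<in> coch (Suc ?q) N"
    proof (rule cochI)
      fix z s assume z: "z \<in> tup (Suc ?q)" and s: "s \<in> N"
      have sc: "s \<in> carrier G" using s Nc by auto
      have "E Y (shift s z) = E (shift s Y) (shift s z)"
        using Y s sc z cosets_shift_self[OF N s, of Y]
        by (intro E_cong shift_tup) (auto simp: tup_def)
      then show "E Y (shift s z) = act s (E Y z)" using E_shift[OF Y z sc] by simp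
    qed (rule E_V[OF Y])
    moreover have "cdiff (E Y) z = 0" for z
      unfolding E_def[abs_def] by (rule cdiff_cdiff)
    ultimately show ?thesis by (simp add: zc_def)
  qed
  define Q where "Q Y g \<longleftrightarrow> g \<in> coch ?q N' \<and> (\<forall>z\<in>tup (Suc ?q). E Y z = cdiff g z)" for Y g
  obtain F where F: "\<And>Y. Y \<in> tup (Suc p) \<Longrightarrow> Q Y (F Y)"
    "\<And>Y Y'. Y \<in> tup (Suc p) \<Longrightarrow> Y' \<in> tup (Suc p) \<Longrightarrow> cosets N' Y = cosets N' Y' \<Longrightarrow> F Y = F Y'"
    "\<And>s Y zs. Y \<in> tup (Suc p) \<Longrightarrow> s \<in> carrier G \<Longrightarrow> zs \<in> tup ?q \<Longrightarrow>
      F (shift s Y) (shift s zs) = act s (F Y zs)"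
  proof (rule equivariant_choice[OF N'(1), of p Q ?q])
    fix Y assume "Y \<in> tup (Suc p)"
    then have "E Y \<in> bc (Suc ?q) N'" using E_zc kill by blast
    then show "\<exists>g. Q Y g" by (auto simp: bc_def Q_def)
  next
    show "g \<in> coch ?q N'" if "Q Y g" for Y g using that by (simp add: Q_def)
  next
    fix s Y g assume Y: "Y \<in> tup (Suc p)" and g: "Q Y g" and s: "s \<in> carrier G"
    have "tr s g \<in> coch ?q N'"
      by (rule tr_coch[OF _ s Nc(2)]) (use g N' s normal.inv_op_closed1 in \<open>auto simp: Q_def\<close>)
    moreover have "E (shift s Y) z = cdiff (tr s g) z" if z: "z \<in> tup (Suc ?q)" for z
    proof -
      let ?z = "shift (inv s) z"
      have z': "?z \<in> tup (Suc ?q)" using z s by (intro shift_tup) auto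
      have "E (shift s Y) z = E (shift s Y) (shift s ?z)" using z s by (simp add: shift_inv)
      also have "\<dots> = act s (cdiff g ?z)" using E_shift[OF Y z' s] g z' by (simp add: Q_def)
      also have "\<dots> = cdiff (tr s g) z" using s by (simp add: cdiff_tr) (simp add: tr_def)
      finally show ?thesis .
    qed
    ultimately show "Q (shift s Y) (tr s g)" by (simp add: Q_def)
  next
    fix Y Y' g assume Y: "Y \<in> tup (Suc p)" "Y' \<in> tup (Suc p)" "cosets N' Y = cosets N' Y'" and g: "Q Y g"
    have "cosets N Y = cosets N Y'"
      by (rule cosets_mono[OF Y(3) N'(2) Ns(2,1)]) (use Y in \<open>auto simp: tup_def\<close>)
    then show "Q Y' g" using g E_cong[OF Y(1,2)] by (simp add: Q_def)
  qed (rule that)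
  \<comment> \<open>The sign that \<open>cdiff_append\<close> puts on the trailing faces after
    \<open>p\<close> parameters. Including it in \<open>g\<close> makes the trailing part of its
    differential appear with a plus sign.\<close>
  define \<sigma> where "\<sigma> = (if even p then id else uminus :: 'v \<Rightarrow> 'v)"
  have \<sigma>: "\<sigma> (\<sigma> v) = v" "\<sigma> (u - v) = \<sigma> u - \<sigma> v" "\<sigma> u \<in> V \<longleftrightarrow> u \<in> V"
    "s \<in> carrier G \<Longrightarrow> act s (\<sigma> u) = \<sigma> (act s u)" for u v s
    using uminus_V[of "- u"] by (auto simp: \<sigma>_def uminus_V act_uminus)
  define h where "h y v = F (y @ [hd v]) v - f (y @ hd v # v)" for y v
  define g where "g l = \<sigma> (h (take p l) (drop p l))" for l
  have F_coch: "F Y \<in> coch ?q N'" if "Y \<in> tup (Suc p)" for Y using F(1)[OF that] by (simp add: Q_def)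
  have g_eq: "g (y @ v) = \<sigma> (h y v)" if "y \<in> tup p" for y v using that by (simp add: g_def tup_def)
  have split: "\<exists>y x v. l = y @ x # v \<and> y \<in> tup p \<and> x \<in> carrier G \<and> v \<in> tup k" if "l \<in> tup (p + Suc k)" for l k
  proof -
    have "drop p l \<in> tup (Suc k)" using that by (auto simp: tup_def dest: in_set_dropD)
    then obtain x v where v: "drop p l = x # v" "x \<in> carrier G" "v \<in> tup k" by (rule tup_SucE)
    moreover have "take p l \<in> tup p" using that by (auto simp: tup_def dest: in_set_takeD)
    ultimately show ?thesis by (metis append_take_drop_id)
  qed
  have h_cong: "h y v = h y' v"
    if "y \<in> tup p" "y' \<in> tup p" "N' #> hd v = N' #> hd v'" "cosets N' y = cosets N' y'"
      "v \<in> tup ?q" "v = v'" for y y' v v'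
  proof -
    have v: "hd v \<in> carrier G" using that by (auto elim: tup_SucE)
    have "cosets N y = cosets N y'"
      by (rule cosets_mono[OF that(4) N'(2) Ns(2,1)]) (use that in \<open>auto simp: tup_def\<close>)
    then have "f (y @ hd v # v) = f (y' @ hd v # v)"
      by (rule factorsD[OF fac(1)]) (use that v in \<open>auto simp: tup_def\<close>)
    moreover have "F (y @ [hd v]) = F (y' @ [hd v])"
      by (rule F(2)) (use that v in \<open>auto simp: tup_def\<close>)
    ultimately show ?thesis by (simp add: h_def)
  qed
  have g_coch: "g \<in> coch (p + ?q) (carrier G)"
  proof (rule cochI)
    fix l assume "l \<in> tup (p + ?q)"
    then obtain y x v where l: "l = y @ x # v" "y \<in> tup p" "x \<in> carrier G" "v \<in> tup r" using split by blast
    have m: "y @ [x] \<in> tup (Suc p)" "x # v \<in> tup ?q" "y @ x # x # v \<in> tup ?n"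
      using l by (auto simp: tup_def)
    show "g l \<in> V"
      unfolding l(1) g_eq[OF l(2)] h_def
      using coch_V[OF F_coch[OF m(1)] m(2)] coch_V[OF f m(3)] by (simp add: \<sigma>(3) diff_V)
    fix s assume s: "s \<in> carrier G"
    have "F (shift s (y @ [x])) (shift s (x # v)) = act s (F (y @ [x]) (x # v))"
      by (rule F(3)[OF m(1) s m(2)])
    moreover have "f (shift s (y @ x # x # v)) = act s (f (y @ x # x # v))"
      by (rule coch_shift[OF f m(3) s])
    moreover have "g (shift s l) = \<sigma> (h (shift s y) (shift s (x # v)))"
      using g_eq[OF shift_tup[OF s l(2)]] l(1) by simp
    ultimately show "g (shift s l) = act s (g l)"
      unfolding l(1) g_eq[OF l(2)] using s by (simp add: h_def \<sigma>(4) act_diff)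
  qed
  \<comment> \<open>The equation \<open>E Y = cdiff (F Y)\<close> makes the unreduced value of
    \<open>f\<close> cancel. Every term that remains sees the first \<open>p + 1\<close> entries
    only through their cosets modulo \<open>N'\<close>.\<close>
  have main: "f (y @ x # z) - cdiff g (y @ x # z) =
      F (y @ [x]) z - h y z - cdiff (\<lambda>u. g (u @ x # z)) y"
    if y: "y \<in> tup p" and x: "x \<in> carrier G" and z: "z \<in> tup ?q" for y x z
  proof -
    have Y: "y @ [x] \<in> tup (Suc p)" and xz: "x # z \<in> tup (Suc ?q)" using y x z by (auto simp: tup_def)
    have "cdiff g (y @ x # z) = cdiff (\<lambda>u. g (u @ x # z)) y + \<sigma> (cdiff (\<lambda>v. g (y @ v)) (x # z))"
      using cdiff_append[of g y "x # z"] y by (simp add: \<sigma>_def tup_def)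
    also have "cdiff (\<lambda>v. g (y @ v)) (x # z) = cdiff (\<lambda>v. \<sigma> (h y v)) (x # z)"
      by (rule cdiff_cong) (rule g_eq[OF y])
    also have "\<dots> = \<sigma> (cdiff (h y) (x # z))" by (rule cdiff_hom) (rule \<sigma>(2))
    also have "cdiff (h y) (x # z) = h y z - (cdiff (\<lambda>v. F (y @ [x]) (x # v)) z - cdiff (\<lambda>v. f (y @ x # x # v)) z)"
      by (simp add: h_def cdiff_diff)
    also have "\<dots> = h y z + f (y @ x # z) - F (y @ [x]) z"
    proof -
      have "E (y @ [x]) (x # z) = cdiff (F (y @ [x])) (x # z)" using F(1)[OF Y] xz by (simp add: Q_def)
      then show ?thesis by (simp add: E_def algebra_simps)
    qed
    finally show ?thesis by (simp add: \<sigma>(1))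
  qed
  have "factors N' (Suc p) ?n (\<lambda>xs. f xs - cdiff g xs)"
    unfolding factors_def
  proof (intro allI impI, elim conjE)
    fix Y Y' z assume Y: "length Y = Suc p" "Y @ z \<in> tup ?n" "Y' @ z \<in> tup ?n" "cosets N' Y = cosets N' Y'"
    have YY: "Y \<in> tup (Suc p)" "Y' \<in> tup (Suc p)" "z \<in> tup ?q"
      using Y cosets_length[OF Y(4)] by (auto simp: tup_def)
    obtain y w where y: "Y = y @ [w]" "y \<in> tup p" "w \<in> carrier G" using Y_cases[OF YY(1)] by blast
    obtain y' w' where y': "Y' = y' @ [w']" "y' \<in> tup p" "w' \<in> carrier G" using Y_cases[OF YY(2)] by blast
    have c: "cosets N' y = cosets N' y'" "N' #> w = N' #> w'" using Y(4) y y' by auto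
    have "F Y z = F Y' z" using F(2)[OF YY(1,2) Y(4)] by simp
    moreover have "h y z = h y' z" by (rule h_cong[OF y(2) y'(2) HOL.refl c(1) YY(3) HOL.refl])
    moreover have "cdiff (\<lambda>u. g (u @ w # z)) y = cdiff (\<lambda>u. g (u @ w' # z)) y'"
    proof (cases p)
      case 0
      then show ?thesis using y y' by (auto simp: tup_def)
    next
      case (Suc m)
      show ?thesis
      proof (rule cdiff_cosets_cong[OF c(1)])
        fix u u' assume u: "u \<in> tup m" "u' \<in> tup m" "cosets N' u = cosets N' u'"
        have "u @ [w] \<in> tup p" "u' @ [w'] \<in> tup p" using u y y' Suc by (auto simp: tup_def)
        then show "g (u @ w # z) = g (u' @ w' # z)"
          using g_eq[of "u @ [w]" z] g_eq[of "u' @ [w']" z] h_cong[of "u @ [w]" "u' @ [w']" z z] u(3) c(2) YY(3)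
          by simp
      qed (use y y' Suc in auto)
    qed
    ultimately show "f (Y @ z) - cdiff g (Y @ z) = f (Y' @ z) - cdiff g (Y' @ z)"
      using main[OF y(2,3) YY(3)] main[OF y'(2,3) YY(3)] y(1) y'(1) by simp
  qed
  then show ?thesis using that g_coch by blast
qed

text \<open>Induction on the number \<open>p\<close> of reduced variables. All subgroups are chosen
  before \<open>f\<close>, since effaceability is uniform in the cocycle, so the final
  \<open>M\<close> serves every cochain. Subtracting a coboundary leaves the differential of
  \<open>f\<close> unchanged, and the hypothesis remains available in each step.\<close>

theorem effaceable_factors:
  assumes eff: "effaceable (carrier G)" and N: "N \<lhd> G" "fin_ind N (carrier G)"
  obtains M where "M \<lhd> G" "fin_ind M (carrier G)" "M \<subseteq> N"
    "\<And>f. f \<in> coch (Suc n) (carrier G) \<Longrightarrow> factors N (Suc (Suc n)) (Suc (Suc n)) (cdiff f) \<Longrightarrow>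
      \<exists>g \<in> coch n (carrier G). factors M (Suc n) (Suc n) (\<lambda>xs. f xs - cdiff g xs)"
proof -
  have "p \<le> Suc n \<Longrightarrow> \<exists>M. M \<lhd> G \<and> fin_ind M (carrier G) \<and> M \<subseteq> N \<and>
    (\<forall>f \<in> coch (Suc n) (carrier G). factors N (Suc (Suc n)) (Suc (Suc n)) (cdiff f) \<longrightarrow>
      (\<exists>g \<in> coch n (carrier G). factors M p (Suc n) (\<lambda>xs. f xs - cdiff g xs)))" for p
  proof (induction p)
    case 0
    have "(\<lambda>xs. 0) \<in> coch n (carrier G)" by (rule coch_zero) simp
    then show ?case using N by (intro exI[of _ N]) (auto simp: factors_zero)
  next
    case (Suc p)
    then obtain M where M: "M \<lhd> G" "fin_ind M (carrier G)" "M \<subseteq> N" and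
      red: "\<And>f. f \<in> coch (Suc n) (carrier G) \<Longrightarrow> factors N (Suc (Suc n)) (Suc (Suc n)) (cdiff f) \<Longrightarrow>
        \<exists>g \<in> coch n (carrier G). factors M p (Suc n) (\<lambda>xs. f xs - cdiff g xs)" by auto
    have Ms: "subgroup M G" "subgroup N G" using M(1) N(1) by (auto simp: normal_imp_subgroup)
    obtain g0 where g0: "\<And>f. f \<in> coch (Suc n) (carrier G) \<Longrightarrow> factors N (Suc (Suc n)) (Suc (Suc n)) (cdiff f) \<Longrightarrow>
        g0 f \<in> coch n (carrier G) \<and> factors M p (Suc n) (\<lambda>xs. f xs - cdiff (g0 f) xs)"
      using red by metis
    define f1 where "f1 f xs = f xs - cdiff (g0 f) xs" for f xs
    have f1: "f1 f \<in> coch (Suc n) (carrier G)" "factors M p (Suc n) (f1 f)"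
      "factors M (Suc p) (Suc (Suc n)) (cdiff (f1 f))"
      if f: "f \<in> coch (Suc n) (carrier G)" "factors N (Suc (Suc n)) (Suc (Suc n)) (cdiff f)" for f
    proof -
      show "f1 f \<in> coch (Suc n) (carrier G)"
        unfolding f1_def[abs_def] using g0[OF f] by (intro coch_diff cdiff_coch f) auto
      show "factors M p (Suc n) (f1 f)" using g0[OF f] by (simp add: f1_def[abs_def])
      have "cdiff (f1 f) = cdiff f" by (simp add: f1_def[abs_def] cdiff_diff cdiff_cdiff fun_eq_iff)
      then show "factors M (Suc p) (Suc (Suc n)) (cdiff (f1 f))"
        using factors_mono[OF f(2) M(3) Ms] Suc.prems by simp
    qed
    show ?case
    proof (cases "p = n")
      case True
      have "\<exists>g \<in> coch n (carrier G). factors M (Suc p) (Suc n) (\<lambda>xs. f xs - cdiff g xs)"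
        if f: "f \<in> coch (Suc n) (carrier G)" "factors N (Suc (Suc n)) (Suc (Suc n)) (cdiff f)" for f
        using factors_step_top[of "f1 f" p M] f1[OF f] Ms g0[OF f] True
        by (auto simp: f1_def[abs_def])
      then show ?thesis using M by blast
    next
      case False
      then obtain r where r: "n = p + Suc r" using Suc.prems less_imp_Suc_add[of p n] by auto
      obtain Q where Q: "fin_ind Q M" "zc (Suc (Suc r)) M \<subseteq> bc (Suc (Suc r)) Q"
        using effaceableD[OF eff M(2), of "Suc (Suc r)"] by auto
      \<comment> \<open>Effaceability gives some subgroup of finite index; cosets of tuples can be
        translated only for a normal one, so its core is taken.\<close>
      obtain M' where M': "M' \<lhd> G" "M' \<subseteq> Q" "fin_ind M' (carrier G)"
        using normal_core_fin_ind[OF fin_ind_trans[OF Q(1) M(2)]] .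
      have M'M: "M' \<subseteq> M" using M' fin_indD(3)[OF Q(1)] by blast
      have kill: "zc (Suc (Suc r)) M \<subseteq> bc (Suc (Suc r)) M'" using Q(2) bc_mono[OF M'(2)] by blast
      have "\<exists>g \<in> coch n (carrier G). factors M' (Suc p) (Suc n) (\<lambda>xs. f xs - cdiff g xs)"
        if f: "f \<in> coch (Suc n) (carrier G)" "factors N (Suc (Suc n)) (Suc (Suc n)) (cdiff f)" for f
      proof -
        obtain g where g: "g \<in> coch n (carrier G)"
          "factors M' (Suc p) (Suc n) (\<lambda>xs. f1 f xs - cdiff g xs)"
          using factors_step[of "f1 f" p r M M'] f1[OF f] M M' M'M kill r by auto
        let ?g = "\<lambda>xs. g0 f xs + g xs"
        have "?g \<in> coch n (carrier G)" using g0[OF f] g by (intro coch_add) auto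
        moreover have "(\<lambda>xs. f1 f xs - cdiff g xs) = (\<lambda>xs. f xs - cdiff ?g xs)"
          by (simp add: f1_def cdiff_add fun_eq_iff)
        ultimately show ?thesis using g(2) by auto
      qed
      then show ?thesis using M' M'M M(3) by blast
    qed
  qed
  from this[of "Suc n"] obtain M where "M \<lhd> G" "fin_ind M (carrier G)" "M \<subseteq> N"
    "\<forall>f \<in> coch (Suc n) (carrier G). factors N (Suc (Suc n)) (Suc (Suc n)) (cdiff f) \<longrightarrow>
      (\<exists>g \<in> coch n (carrier G). factors M (Suc n) (Suc n) (\<lambda>xs. f xs - cdiff g xs))" by auto
  then show ?thesis by (intro that[of M]) auto
qed

end

section \<open>Polycyclic groups and ascending HNN extensions\<close>

lemma cyclic_factor_generator:
  assumes "group P" "subgroup K P" "K' \<lhd> P\<lparr>carrier := K\<rparr>" "cyclic_group (P\<lparr>carrier := K\<rparr> Mod K')"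
  obtains u where "u \<in> K" "\<And>x. x \<in> K \<Longrightarrow> \<exists>y\<in>K'. \<exists>k::int. x = y \<otimes>\<^bsub>P\<^esub> u [^]\<^bsub>P\<^esub> k"
proof -
  interpret P: group P by fact
  let ?Q = "P\<lparr>carrier := K\<rparr>"
  interpret Q: group ?Q by (rule P.subgroup_imp_group[OF assms(2)])
  interpret N: normal K' ?Q by fact
  interpret M: group "?Q Mod K'" by (rule N.factorgroup_is_group)
  obtain c where c: "c \<in> carrier (?Q Mod K')" "carrier (?Q Mod K') = range (\<lambda>n::int. c [^]\<^bsub>?Q Mod K'\<^esub> n)"
    using assms(4) M.cyclic_group by blast
  obtain u where u: "u \<in> K" "c = K' #>\<^bsub>?Q\<^esub> u" using c(1) by (auto simp: carrier_FactGroup)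
  have "\<exists>y\<in>K'. \<exists>k::int. x = y \<otimes>\<^bsub>P\<^esub> u [^]\<^bsub>P\<^esub> k" if x: "x \<in> K" for x
  proof -
    have "K' #>\<^bsub>?Q\<^esub> x \<in> carrier (?Q Mod K')" using x by (simp add: carrier_FactGroup)
    then obtain k :: int where k: "K' #>\<^bsub>?Q\<^esub> x = c [^]\<^bsub>?Q Mod K'\<^esub> k" using c(2) by blast
    also have "\<dots> = K' #>\<^bsub>?Q\<^esub> (u [^]\<^bsub>?Q\<^esub> k)"
      unfolding u(2) by (rule N.FactGroup_int_pow) (use u in simp)
    also have "u [^]\<^bsub>?Q\<^esub> k = u [^]\<^bsub>P\<^esub> k" using P.int_pow_consistent[OF assms(2) u(1)] by simp
    finally have "K' #>\<^bsub>?Q\<^esub> x = K' #>\<^bsub>?Q\<^esub> (u [^]\<^bsub>P\<^esub> k)" .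
    moreover have "x \<in> K' #>\<^bsub>?Q\<^esub> x" using Q.rcos_self[OF _ N.subgroup_axioms, of x] x by simp
    ultimately show ?thesis by (auto simp: r_coset_def)
  qed
  then show ?thesis using that u(1) by blast
qed

context fin_module
begin

text \<open>An extension with cyclic quotient, finite or infinite, is a case of
  \<open>effaceable_ascending\<close>: a product \<open>y t^n\<close> is rewritten as
  \<open>t^n (t^-n y t^n)\<close>, and \<open>y t^-n\<close> already has the required form.\<close>

lemma effaceable_polycyclic_step:
  assumes L: "subgroup L G" "fin_gen L" "effaceable L" and H: "subgroup H G" "L \<subseteq> H" "t \<in> H"
    and nm: "\<And>x. x \<in> L \<Longrightarrow> inv t \<otimes> x \<otimes> t \<in> L"
    and gen: "\<And>x. x \<in> H \<Longrightarrow> \<exists>y\<in>L. \<exists>k::int. x = y \<otimes> t [^] k"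
  shows "fin_gen H" "effaceable H"
proof -
  have t: "t \<in> carrier G" using H subgroup.mem_carrier by metis
  note c = subgroup.mem_carrier[OF L(1)]
  obtain X where X: "finite X" "X \<subseteq> carrier G" "L = generate G X" using L(2) by (auto simp: fin_gen_def)
  have "H = generate G (insert t X)"
  proof
    have XH: "insert t X \<subseteq> H" using X H generate.incl[of _ X G] by blast
    show "generate G (insert t X) \<subseteq> H" by (rule generate_subgroup_incl[OF XH H(1)])
    have s: "subgroup (generate G (insert t X)) G" using X t by (intro generate_is_subgroup) auto
    have "L \<subseteq> generate G (insert t X)" unfolding X(3) by (rule mono_generate) auto
    moreover have "t [^] (k::int) \<in> generate G (insert t X)" for k
      by (rule subgroup_int_pow_closed[OF s]) (simp add: generate.incl)
    ultimately show "H \<subseteq> generate G (insert t X)"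
      using gen subgroup.m_closed[OF s] by blast
  qed
  then show "fin_gen H" using X t unfolding fin_gen_def by (intro exI[of _ "insert t X"]) auto
  have sh: "shrinks t L" using nm t by (simp add: shrinks_def)
  show "effaceable H"
  proof (rule effaceable_ascending[OF L(1) sh L(2,3) H])
    fix x assume "x \<in> H"
    then obtain y k where x: "y \<in> L" "x = y \<otimes> t [^] (k::int)" using gen by blast
    obtain n where "k = int n \<or> k = - int n" by (metis int_cases2)
    then show "\<exists>i j. \<exists>l\<in>L. x = t [^] (i::nat) \<otimes> l \<otimes> inv (t [^] (j::nat))"
    proof
      assume k: "k = int n"
      have "x = t [^] n \<otimes> conj_pow t n y \<otimes> inv (t [^] (0::nat))"
        using x t c k by (simp add: conj_pow_def group_simps int_pow_int)
      then show ?thesis using conj_pow_shrinks[OF sh L(1) x(1)] by blast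
    next
      assume k: "k = - int n"
      have "x = t [^] (0::nat) \<otimes> y \<otimes> inv (t [^] n)"
        using x t c k by (simp add: int_pow_neg_int)
      then show ?thesis using x(1) by blast
    qed
  qed
qed

text \<open>The induction follows the images of the series under \<open>\<beta>\<close>. These
  images inherit generators and normality, so the homomorphism may have a kernel, as the map into
  the HNN extension does when \<open>\<phi>\<close> is not injective.\<close>

lemma effaceable_polycyclic:
  fixes P :: "('c, 'n) monoid_scheme"
  assumes "polycyclic_group P" and \<beta>: "\<beta> \<in> hom P G"
  shows "subgroup (\<beta> ` carrier P) G" "fin_gen (\<beta> ` carrier P)" "effaceable (\<beta> ` carrier P)"
proof -
  have P: "group P" using assms(1) by (simp add: polycyclic_group_def)
  interpret P: group P by (rule P)
  interpret \<beta>: group_hom P G \<beta> by unfold_locales (rule \<beta>)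
  obtain n :: nat and K where K: "K 0 = {\<one>\<^bsub>P\<^esub>}" "K n = carrier P" "\<And>i. i \<le> n \<Longrightarrow> subgroup (K i) P"
    "\<And>i. i < n \<Longrightarrow> K i \<lhd> P\<lparr>carrier := K (Suc i)\<rparr>"
    "\<And>i. i < n \<Longrightarrow> cyclic_group (P\<lparr>carrier := K (Suc i)\<rparr> Mod K i)"
    using assms(1) unfolding polycyclic_group_def by blast
  have "i \<le> n \<Longrightarrow> subgroup (\<beta> ` K i) G \<and> fin_gen (\<beta> ` K i) \<and> effaceable (\<beta> ` K i)" for i
  proof (induction i)
    case 0
    have "fin_gen {\<one>}" unfolding fin_gen_def by (intro exI[of _ "{}"]) (simp add: generate_empty)
    then show ?case using effaceable_trivial triv_subgroup by (simp add: K(1))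
  next
    case (Suc i)
    then have IH: "subgroup (\<beta> ` K i) G" "fin_gen (\<beta> ` K i)" "effaceable (\<beta> ` K i)" by auto
    have i: "i < n" using Suc.prems by simp
    have sK: "subgroup (K (Suc i)) P" using K(3) Suc.prems by blast
    note Kc = subgroup.mem_carrier[OF sK]
    interpret N: normal "K i" "P\<lparr>carrier := K (Suc i)\<rparr>" by (rule K(4)[OF i])
    obtain u where u: "u \<in> K (Suc i)"
      "\<And>x. x \<in> K (Suc i) \<Longrightarrow> \<exists>y\<in>K i. \<exists>k::int. x = y \<otimes>\<^bsub>P\<^esub> u [^]\<^bsub>P\<^esub> k"
      using cyclic_factor_generator[OF P sK K(4)[OF i] K(5)[OF i]] by blast
    have sub: "K i \<subseteq> K (Suc i)" using N.subset by simp
    have H: "subgroup (\<beta> ` K (Suc i)) G" by (rule \<beta>.subgroup_img_is_subgroup[OF sK])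
    have nm: "inv (\<beta> u) \<otimes> x \<otimes> \<beta> u \<in> \<beta> ` K i" if x: "x \<in> \<beta> ` K i" for x
    proof -
      obtain y where y: "y \<in> K i" "x = \<beta> y" using x by blast
      have "inv\<^bsub>P\<lparr>carrier := K (Suc i)\<rparr>\<^esub> u \<otimes>\<^bsub>P\<^esub> y \<otimes>\<^bsub>P\<^esub> u \<in> K i"
        using N.inv_op_closed1[of u y] u(1) y(1) by simp
      then have "inv\<^bsub>P\<^esub> u \<otimes>\<^bsub>P\<^esub> y \<otimes>\<^bsub>P\<^esub> u \<in> K i"
        using P.m_inv_consistent[OF sK u(1)] by simp
      then have "\<beta> (inv\<^bsub>P\<^esub> u \<otimes>\<^bsub>P\<^esub> y \<otimes>\<^bsub>P\<^esub> u) \<in> \<beta> ` K i" by blast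
      moreover have "u \<in> carrier P" "y \<in> carrier P" using u(1) y(1) sub Kc by blast+
      ultimately show ?thesis by (simp add: y(2))
    qed
    have gen: "\<exists>y\<in>\<beta> ` K i. \<exists>k::int. x = y \<otimes> \<beta> u [^] k" if x: "x \<in> \<beta> ` K (Suc i)" for x
    proof -
      obtain z where z: "z \<in> K (Suc i)" "x = \<beta> z" using x by blast
      then obtain y k where y: "y \<in> K i" "z = y \<otimes>\<^bsub>P\<^esub> u [^]\<^bsub>P\<^esub> (k::int)" using u(2) by blast
      have "u \<in> carrier P" "y \<in> carrier P" using u(1) y(1) sub Kc by blast+
      then have "x = \<beta> y \<otimes> \<beta> u [^] k" by (simp add: z(2) y(2) \<beta>.hom_int_pow)
      then show ?thesis using y(1) by blast
    qed
    show ?case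
      using effaceable_polycyclic_step[OF IH H image_mono[OF sub] imageI[OF u(1)] nm gen] H by blast
  qed
  from this[of n] show "subgroup (\<beta> ` carrier P) G" "fin_gen (\<beta> ` carrier P)" "effaceable (\<beta> ` carrier P)"
    by (auto simp: K(2))
qed

end

context group
begin

text \<open>Products \<open>t^i l t^-j\<close> absorb every generator on the left: \<open>y\<close>
  passes \<open>t^i\<close> after conjugation into \<open>L\<close>, \<open>t\<close> raises
  \<open>i\<close>, and \<open>t^-1\<close> lowers \<open>i\<close>. When \<open>i = 0\<close>, the
  last case uses \<open>t^-1 l t^-j = (t^-1 l t) t^-(j+1)\<close>.\<close>

lemma ascending_form_mult:
  assumes "shrinks t L" "subgroup L G"
    and x: "\<exists>i j. \<exists>l\<in>L. x = t [^] (i::nat) \<otimes> l \<otimes> inv (t [^] (j::nat))"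
  shows "y \<in> L \<Longrightarrow> \<exists>i j. \<exists>l\<in>L. y \<otimes> x = t [^] (i::nat) \<otimes> l \<otimes> inv (t [^] (j::nat))"
    and "\<exists>i j. \<exists>l\<in>L. t \<otimes> x = t [^] (i::nat) \<otimes> l \<otimes> inv (t [^] (j::nat))"
    and "\<exists>i j. \<exists>l\<in>L. inv t \<otimes> x = t [^] (i::nat) \<otimes> l \<otimes> inv (t [^] (j::nat))"
proof -
  have t: "t \<in> carrier G" using assms by (simp add: shrinks_def)
  note c = subgroup.mem_carrier[OF assms(2)]
  obtain i j l where l: "l \<in> L" "x = t [^] (i::nat) \<otimes> l \<otimes> inv (t [^] (j::nat))" using x by blast
  show "\<exists>i j. \<exists>l\<in>L. y \<otimes> x = t [^] (i::nat) \<otimes> l \<otimes> inv (t [^] (j::nat))" if y: "y \<in> L"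
  proof -
    have "y \<otimes> x = t [^] i \<otimes> (conj_pow t i y \<otimes> l) \<otimes> inv (t [^] j)"
      using l y t c by (simp add: conj_pow_def group_simps)
    then show ?thesis
      using subgroup.m_closed[OF assms(2) conj_pow_shrinks[OF assms(1,2) y] l(1)] by blast
  qed
  have "t \<otimes> x = t [^] Suc i \<otimes> l \<otimes> inv (t [^] j)"
    using l t c nat_pow_Suc2[OF t, of i] by (simp add: m_assoc del: nat_pow_Suc)
  then show "\<exists>i j. \<exists>l\<in>L. t \<otimes> x = t [^] (i::nat) \<otimes> l \<otimes> inv (t [^] (j::nat))"
    using l(1) by blast
  show "\<exists>i j. \<exists>l\<in>L. inv t \<otimes> x = t [^] (i::nat) \<otimes> l \<otimes> inv (t [^] (j::nat))"
  proof (cases i)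
    case 0
    have "inv (t [^] Suc j) = inv t \<otimes> inv (t [^] j)"
      using t by (metis inv_mult_group nat_pow_Suc nat_pow_closed)
    then have "inv t \<otimes> x = t [^] (0::nat) \<otimes> (inv t \<otimes> l \<otimes> t) \<otimes> inv (t [^] Suc j)"
      using l t c 0 by (simp add: group_simps del: nat_pow_Suc)
    then show ?thesis using l(1) assms(1) unfolding shrinks_def by blast
  next
    case (Suc k)
    have "t [^] i = t \<otimes> t [^] k" using t Suc by (metis nat_pow_Suc2)
    then have "inv t \<otimes> x = t [^] k \<otimes> l \<otimes> inv (t [^] j)"
      using l t c by (simp add: group_simps)
    then show ?thesis using l(1) by blast
  qed
qed

end

section \<open>Words and presented groups\<close>

lemma words_simps [simp]:
  "[] \<in> words S" "x # w \<in> words S \<longleftrightarrow> fst x \<in> S \<and> w \<in> words S"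
  "v @ w \<in> words S \<longleftrightarrow> v \<in> words S \<and> w \<in> words S"
  by (auto simp: words_def in_lists_conv_set mem_Times_iff)

lemma word_cong_words: "word_cong S R v w \<Longrightarrow> v \<in> words S \<and> w \<in> words S"
  by (induction rule: word_cong.induct) auto

lemma word_cong_append_left: "word_cong S R v w \<Longrightarrow> u \<in> words S \<Longrightarrow> word_cong S R (u @ v) (u @ w)"
proof (induction rule: word_cong.induct)
  case (cancel a b s c)
  then show ?case using word_cong.cancel[of "u @ a" S b s R c] by simp
next
  case (relation a b r r')
  then show ?case using word_cong.relation[of "u @ a" S b r r' R] by simp
qed (auto intro: word_cong.intros)

lemma word_cong_append_right: "word_cong S R v w \<Longrightarrow> u \<in> words S \<Longrightarrow> word_cong S R (v @ u) (w @ u)"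
proof (induction rule: word_cong.induct)
  case (cancel a b s c)
  then show ?case using word_cong.cancel[of a S "b @ u" s R c] by simp
next
  case (relation a b r r')
  then show ?case using word_cong.relation[of a S "b @ u" r r' R] by simp
qed (auto intro: word_cong.intros)

lemma word_cong_append:
  assumes "word_cong S R v v'" "word_cong S R w w'"
  shows "word_cong S R (v @ w) (v' @ w')"
  using word_cong_append_right[OF assms(1), of w] word_cong_append_left[OF assms(2), of v']
    word_cong_words[OF assms(1)] word_cong_words[OF assms(2)] by (meson word_cong.trans)

definition word_class :: "'s set \<Rightarrow> ('s word \<times> 's word) set \<Rightarrow> 's word \<Rightarrow> 's word set" where
  "word_class S R w = {v. word_cong S R w v}"

lemma word_class_eq_iff:
  "v \<in> words S \<Longrightarrow> w \<in> words S \<Longrightarrow> word_class S R v = word_class S R w \<longleftrightarrow> word_cong S R v w"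
  unfolding word_class_def by (metis (mono_tags, lifting) Collect_cong mem_Collect_eq word_cong.refl word_cong.sym word_cong.trans)

lemma carrier_presented_group: "carrier (presented_group S R) = word_class S R ` words S"
  by (auto simp: presented_group_def quotient_def word_class_def)

lemma one_presented_group: "\<one>\<^bsub>presented_group S R\<^esub> = word_class S R []"
  by (simp add: presented_group_def word_class_def)

lemma mult_presented_group:
  assumes "v \<in> words S" "w \<in> words S"
  shows "word_class S R v \<otimes>\<^bsub>presented_group S R\<^esub> word_class S R w = word_class S R (v @ w)"
proof -
  have "(\<exists>a\<in>word_class S R v. \<exists>b\<in>word_class S R w. word_cong S R (a @ b) x) \<longleftrightarrow> word_cong S R (v @ w) x" for x
    unfolding word_class_def using assms
    by (auto intro: word_cong.refl) (meson word_cong.trans word_cong_append)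
  then show ?thesis by (simp add: presented_group_def) (simp add: word_class_def)
qed

lemma word_inverse_exists:
  "w \<in> words S \<Longrightarrow> \<exists>v\<in>words S. word_cong S R (v @ w) []"
proof (induction w)
  case Nil
  have "word_cong S R ([] @ []) []" by (simp add: word_cong.refl)
  then show ?case by (intro bexI[of _ "[]"]) auto
next
  case (Cons x w)
  obtain s b where x: "x = (s, b)" by (cases x)
  obtain v where v: "v \<in> words S" "word_cong S R (v @ w) []" using Cons by auto
  have "word_cong S R (v @ [(s, \<not> b), (s, \<not> \<not> b)] @ w) (v @ w)"
    using Cons.prems v x by (intro word_cong.cancel) auto
  then have "word_cong S R ((v @ [(s, \<not> b)]) @ x # w) []"
    using v(2) x by (auto intro: word_cong.trans)
  then show ?case using v(1) Cons.prems x by (intro bexI[of _ "v @ [(s, \<not> b)]"]) auto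
qed

lemma group_presented_group: "group (presented_group S R)"
proof (rule groupI)
  fix X assume "X \<in> carrier (presented_group S R)"
  then obtain w where w: "w \<in> words S" "X = word_class S R w" by (auto simp: carrier_presented_group)
  obtain v where v: "v \<in> words S" "word_cong S R (v @ w) []" using word_inverse_exists[OF w(1)] by blast
  then have "word_class S R v \<otimes>\<^bsub>presented_group S R\<^esub> X = \<one>\<^bsub>presented_group S R\<^esub>"
    using w by (simp add: mult_presented_group one_presented_group word_class_eq_iff)
  then show "\<exists>Y\<in>carrier (presented_group S R). Y \<otimes>\<^bsub>presented_group S R\<^esub> X = \<one>\<^bsub>presented_group S R\<^esub>"
    using v(1) by (auto simp: carrier_presented_group)
qed (auto simp: carrier_presented_group one_presented_group mult_presented_group)

lemma presented_group_induct:
  assumes "x \<in> carrier (presented_group S R)" "P \<one>\<^bsub>presented_group S R\<^esub>"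
    and "\<And>s b y. s \<in> S \<Longrightarrow> y \<in> carrier (presented_group S R) \<Longrightarrow> P y \<Longrightarrow>
      P (word_class S R [(s, b)] \<otimes>\<^bsub>presented_group S R\<^esub> y)"
  shows "P x"
proof -
  obtain w where w: "w \<in> words S" "x = word_class S R w" using assms(1) by (auto simp: carrier_presented_group)
  have "w \<in> words S \<Longrightarrow> P (word_class S R w)" for w
  proof (induction w)
    case Nil
    then show ?case using assms(2) by (simp add: one_presented_group)
  next
    case (Cons l w)
    obtain s b where l: "l = (s, b)" by (cases l)
    have "P (word_class S R [(s, b)] \<otimes>\<^bsub>presented_group S R\<^esub> word_class S R w)"
      using Cons l by (intro assms(3)) (auto simp: carrier_presented_group)
    then show ?case using Cons.prems l by (simp add: mult_presented_group)
  qed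
  then show ?thesis using w by simp
qed

lemma word_class_inverse:
  assumes "s \<in> S"
  shows "word_class S R [(s, False)] = inv\<^bsub>presented_group S R\<^esub> word_class S R [(s, True)]"
proof -
  interpret group "presented_group S R" by (rule group_presented_group)
  have "word_cong S R ([] @ [(s, False), (s, \<not> False)] @ []) ([] @ [])"
    using assms by (intro word_cong.cancel) auto
  then have "word_class S R [(s, False)] \<otimes>\<^bsub>presented_group S R\<^esub> word_class S R [(s, True)] = \<one>\<^bsub>presented_group S R\<^esub>"
    using assms by (simp add: mult_presented_group one_presented_group word_class_eq_iff)
  then show ?thesis
    using assms by (intro inv_equality[symmetric]) (auto simp: carrier_presented_group)
qed

lemma group_ascending_hnn: "group (ascending_hnn G \<phi>)"
  unfolding ascending_hnn_def by (rule group_presented_group)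

text \<open>The presentation is used through its relations and through induction over generators,
  both independent of a normal form. \<open>\<beta>\<close> is not claimed to be injective: the
  relation \<open>t^-1 g t = \<phi> g\<close> kills the kernel of \<open>\<phi>\<close>.\<close>

lemma ascending_hnn_structure:
  fixes G (structure)
  assumes "group G" "\<phi> \<in> hom G G"
  obtains \<beta> t where "\<beta> \<in> hom G (ascending_hnn G \<phi>)" "t \<in> carrier (ascending_hnn G \<phi>)"
    "\<And>g. g \<in> carrier G \<Longrightarrow>
      inv\<^bsub>ascending_hnn G \<phi>\<^esub> t \<otimes>\<^bsub>ascending_hnn G \<phi>\<^esub> \<beta> g \<otimes>\<^bsub>ascending_hnn G \<phi>\<^esub> t = \<beta> (\<phi> g)"
    "\<And>P x. x \<in> carrier (ascending_hnn G \<phi>) \<Longrightarrow> P \<one>\<^bsub>ascending_hnn G \<phi>\<^esub> \<Longrightarrow>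
      (\<And>g y. g \<in> carrier G \<Longrightarrow> y \<in> carrier (ascending_hnn G \<phi>) \<Longrightarrow> P y \<Longrightarrow> P (\<beta> g \<otimes>\<^bsub>ascending_hnn G \<phi>\<^esub> y)) \<Longrightarrow>
      (\<And>y. y \<in> carrier (ascending_hnn G \<phi>) \<Longrightarrow> P y \<Longrightarrow> P (t \<otimes>\<^bsub>ascending_hnn G \<phi>\<^esub> y)) \<Longrightarrow>
      (\<And>y. y \<in> carrier (ascending_hnn G \<phi>) \<Longrightarrow> P y \<Longrightarrow> P (inv\<^bsub>ascending_hnn G \<phi>\<^esub> t \<otimes>\<^bsub>ascending_hnn G \<phi>\<^esub> y)) \<Longrightarrow> P x"
proof -
  interpret G: group G by fact
  let ?H = "ascending_hnn G \<phi>"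
  interpret H: group ?H by (rule group_ascending_hnn)
  define S where "S = insert Stable (Base ` carrier G)"
  define R where "R = {([(Base g, True), (Base h, True)], [(Base (g \<otimes> h), True)]) | g h.
         g \<in> carrier G \<and> h \<in> carrier G} \<union>
      {([(Stable, False), (Base g, True), (Stable, True)], [(Base (\<phi> g), True)]) | g.
         g \<in> carrier G}"
  have H: "?H = presented_group S R" by (simp add: ascending_hnn_def S_def R_def)
  define \<beta> where "\<beta> g = word_class S R [(Base g, True)]" for g
  define t where "t = word_class S R [(Stable, True)]"
  have inS: "Stable \<in> S" "\<And>g. g \<in> carrier G \<Longrightarrow> Base g \<in> S" by (auto simp: S_def)
  have \<phi>: "\<phi> g \<in> carrier G" if "g \<in> carrier G" for g using assms(2) that by (auto simp: hom_def)
  have rel: "word_class S R r = word_class S R r'" if "(r, r') \<in> R" "r \<in> words S" "r' \<in> words S" for r r'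
    using word_cong.relation[of "[]" S "[]" r r' R] that by (simp add: word_class_eq_iff)
  have \<beta>: "\<beta> \<in> hom G ?H"
  proof (rule homI)
    fix g h assume gh: "g \<in> carrier G" "h \<in> carrier G"
    show "\<beta> g \<in> carrier ?H" using gh inS by (simp add: H carrier_presented_group \<beta>_def)
    have "word_class S R [(Base g, True), (Base h, True)] = word_class S R [(Base (g \<otimes> h), True)]"
      by (rule rel) (use gh inS in \<open>auto simp: R_def\<close>)
    then show "\<beta> (g \<otimes> h) = \<beta> g \<otimes>\<^bsub>?H\<^esub> \<beta> h"
      using gh inS by (simp add: H \<beta>_def mult_presented_group)
  qed
  moreover have t: "t \<in> carrier ?H" using inS by (simp add: H carrier_presented_group t_def)
  moreover have inv_t: "inv\<^bsub>?H\<^esub> t = word_class S R [(Stable, False)]"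
    using word_class_inverse[OF inS(1), of R] by (simp add: H t_def)
  have "inv\<^bsub>?H\<^esub> t \<otimes>\<^bsub>?H\<^esub> \<beta> g \<otimes>\<^bsub>?H\<^esub> t = \<beta> (\<phi> g)" if g: "g \<in> carrier G" for g
  proof -
    have "word_class S R [(Stable, False), (Base g, True), (Stable, True)] = \<beta> (\<phi> g)"
      unfolding \<beta>_def by (rule rel) (use g \<phi> inS in \<open>auto simp: R_def\<close>)
    then show ?thesis unfolding inv_t using g inS by (simp add: H \<beta>_def t_def mult_presented_group)
  qed
  moreover have "P x"
    if x: "x \<in> carrier ?H" and one: "P \<one>\<^bsub>?H\<^esub>"
      and base: "\<And>g y. g \<in> carrier G \<Longrightarrow> y \<in> carrier ?H \<Longrightarrow> P y \<Longrightarrow> P (\<beta> g \<otimes>\<^bsub>?H\<^esub> y)"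
      and st: "\<And>y. y \<in> carrier ?H \<Longrightarrow> P y \<Longrightarrow> P (t \<otimes>\<^bsub>?H\<^esub> y)"
      and st': "\<And>y. y \<in> carrier ?H \<Longrightarrow> P y \<Longrightarrow> P (inv\<^bsub>?H\<^esub> t \<otimes>\<^bsub>?H\<^esub> y)" for P x
    using x one unfolding H
  proof (rule presented_group_induct)
    fix s b y assume s: "s \<in> S" and y: "y \<in> carrier (presented_group S R)" "P y"
    have y': "y \<in> carrier ?H" using y by (simp add: H)
    consider "s = Stable" | g where "g \<in> carrier G" "s = Base g" using s by (auto simp: S_def)
    then show "P (word_class S R [(s, b)] \<otimes>\<^bsub>presented_group S R\<^esub> y)"
    proof cases
      case 1
      then show ?thesis using st[OF y' y(2)] st'[OF y' y(2)] inv_t by (cases b) (auto simp: H t_def)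
    next
      case (2 g)
      \<comment> \<open>A formal inverse of a base letter is again a base element, so induction
        needs inverse letters only for \<open>t\<close>.\<close>
      have "word_class S R [(Base g, False)] = \<beta> (inv g)"
        using word_class_inverse[of "Base g" S R] 2(1) inS group_hom.hom_inv[of G ?H \<beta> g] \<beta>
        by (simp add: H \<beta>_def group_hom_def group_hom_axioms_def G.group_axioms group_presented_group)
      then show ?thesis
        using base[OF 2(1) y' y(2)] base[OF G.inv_closed[OF 2(1)] y' y(2)] 2(2)
        by (cases b) (auto simp: H \<beta>_def)
    qed
  qed
  ultimately show ?thesis by (rule that)
qed

lemma effaceable_ascending_hnn:
  fixes G :: "('a, 'm) monoid_scheme"
  assumes "polycyclic_group G" "\<phi> \<in> hom G G" "fin_module (ascending_hnn G \<phi>) V act"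
  shows "fin_module.effaceable (ascending_hnn G \<phi>) V act (carrier (ascending_hnn G \<phi>))"
proof -
  let ?H = "ascending_hnn G \<phi>"
  interpret G: group G using assms(1) by (simp add: polycyclic_group_def)
  interpret H: fin_module ?H V act by fact
  obtain \<beta> t where \<beta>: "\<beta> \<in> hom G ?H" and t: "t \<in> carrier ?H"
    and conj: "\<And>g. g \<in> carrier G \<Longrightarrow> inv\<^bsub>?H\<^esub> t \<otimes>\<^bsub>?H\<^esub> \<beta> g \<otimes>\<^bsub>?H\<^esub> t = \<beta> (\<phi> g)"
    and ind: "\<And>P x. x \<in> carrier ?H \<Longrightarrow> P \<one>\<^bsub>?H\<^esub> \<Longrightarrow>
      (\<And>g y. g \<in> carrier G \<Longrightarrow> y \<in> carrier ?H \<Longrightarrow> P y \<Longrightarrow> P (\<beta> g \<otimes>\<^bsub>?H\<^esub> y)) \<Longrightarrow>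
      (\<And>y. y \<in> carrier ?H \<Longrightarrow> P y \<Longrightarrow> P (t \<otimes>\<^bsub>?H\<^esub> y)) \<Longrightarrow>
      (\<And>y. y \<in> carrier ?H \<Longrightarrow> P y \<Longrightarrow> P (inv\<^bsub>?H\<^esub> t \<otimes>\<^bsub>?H\<^esub> y)) \<Longrightarrow> P x"
    by (rule ascending_hnn_structure[OF G.group_axioms assms(2)]) blast
  let ?L = "\<beta> ` carrier G"
  note L = H.effaceable_polycyclic[OF assms(1) \<beta>]
  have \<phi>: "\<phi> g \<in> carrier G" if "g \<in> carrier G" for g using assms(2) that by (auto simp: hom_def)
  have sh: "H.shrinks t ?L" using t conj \<phi> by (auto simp: H.shrinks_def)
  show ?thesis
  proof (rule H.effaceable_ascending[OF L(1) sh L(2,3) H.subgroup_self subgroup.subset[OF L(1)] t])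
    fix x assume "x \<in> carrier ?H"
    then show "\<exists>i j. \<exists>l\<in>?L. x = t [^]\<^bsub>?H\<^esub> (i::nat) \<otimes>\<^bsub>?H\<^esub> l \<otimes>\<^bsub>?H\<^esub> inv\<^bsub>?H\<^esub> (t [^]\<^bsub>?H\<^esub> (j::nat))"
    proof (rule ind)
      have "\<one>\<^bsub>?H\<^esub> = t [^]\<^bsub>?H\<^esub> (0::nat) \<otimes>\<^bsub>?H\<^esub> \<one>\<^bsub>?H\<^esub> \<otimes>\<^bsub>?H\<^esub> inv\<^bsub>?H\<^esub> (t [^]\<^bsub>?H\<^esub> (0::nat))" by simp
      then show "\<exists>i j. \<exists>l\<in>?L. \<one>\<^bsub>?H\<^esub> = t [^]\<^bsub>?H\<^esub> (i::nat) \<otimes>\<^bsub>?H\<^esub> l \<otimes>\<^bsub>?H\<^esub> inv\<^bsub>?H\<^esub> (t [^]\<^bsub>?H\<^esub> (j::nat))"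
        using subgroup.one_closed[OF L(1)] by blast
    qed (use H.ascending_form_mult[OF sh L(1)] in auto)
  qed
qed

section \<open>Inhomogeneous cochains\<close>

text \<open>The recursion solved as an alternating sum over the omitted position, the form in which
  it meets the inhomogeneous coboundary.\<close>

lemma cdiff_sum:
  "cdiff f xs = (\<Sum>j<length xs. (if even j then id else uminus) (f (take j xs @ drop (Suc j) xs)))"
proof (induction xs arbitrary: f)
  case (Cons x xs)
  have "(\<Sum>j<length (x # xs). (if even j then id else uminus) (f (take j (x # xs) @ drop (Suc j) (x # xs)))) =
      f xs + (\<Sum>j<length xs. - (if even j then id else uminus) (f (x # take j xs @ drop (Suc j) xs)))"
    by (simp add: sum.lessThan_Suc_shift del: sum.lessThan_Suc) (rule sum.cong, auto)
  then show ?case by (simp add: Cons.IH sum_negf)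
qed simp

locale module_action =
  fixes P :: "('g, 'm) monoid_scheme" and A :: "'b monoid" and a :: "'g \<Rightarrow> 'b \<Rightarrow> 'b"
  assumes group_P: "group P" and comm_group_A: "comm_group A" and finite_A: "finite (carrier A)"
    and action: "a \<in> hom P (AutoGroup A)"

sublocale module_action \<subseteq> P: group P by (rule group_P)
sublocale module_action \<subseteq> A: comm_group A by (rule comm_group_A)

context module_action
begin

lemma action_hom: "h \<in> carrier P \<Longrightarrow> a h \<in> hom A A"
  using action by (auto simp: hom_def AutoGroup_def auto_def)

lemma action_closed: "h \<in> carrier P \<Longrightarrow> x \<in> carrier A \<Longrightarrow> a h x \<in> carrier A"
  using action_hom by (auto simp: hom_def)

lemma action_mult:
  assumes "h \<in> carrier P" "k \<in> carrier P" "x \<in> carrier A"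
  shows "a (h \<otimes>\<^bsub>P\<^esub> k) x = a h (a k x)"
proof -
  have "a h \<in> Bij (carrier A)" "a k \<in> Bij (carrier A)"
    using action assms by (auto simp: hom_def AutoGroup_def auto_def)
  moreover have "a (h \<otimes>\<^bsub>P\<^esub> k) = a h \<otimes>\<^bsub>AutoGroup A\<^esub> a k"
    using action assms by (simp add: hom_def)
  ultimately show ?thesis using assms(3) by (simp add: AutoGroup_def BijGroup_def compose_def)
qed

lemma action_one: "x \<in> carrier A \<Longrightarrow> a \<one>\<^bsub>P\<^esub> x = x"
proof -
  assume x: "x \<in> carrier A"
  have "a \<one>\<^bsub>P\<^esub> = \<one>\<^bsub>AutoGroup A\<^esub>" by (rule hom_one[OF action group_P A.AutoGroup])
  then show ?thesis using x by (simp add: AutoGroup_def BijGroup_def)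
qed

lemma fin_module: "fin_module P (ab_in A ` carrier A) (\<lambda>h. ab_map A (a h))"
proof
  show "finite (ab_in A ` carrier A)" using finite_A by simp
  show "0 \<in> ab_in A ` carrier A"
    using ab_in_one[OF comm_group_A] by (metis A.one_closed image_eqI)
  fix u v assume "u \<in> ab_in A ` carrier A" "v \<in> ab_in A ` carrier A"
  then obtain x y where xy: "x \<in> carrier A" "y \<in> carrier A" "u = ab_in A x" "v = ab_in A y" by blast
  have "ab_in A (x \<otimes>\<^bsub>A\<^esub> inv\<^bsub>A\<^esub> y) = u - v"
    using xy by (simp add: ab_in_mult[OF comm_group_A] ab_in_inv[OF comm_group_A])
  then show "u - v \<in> ab_in A ` carrier A" using xy by (metis A.inv_closed A.m_closed image_eqI)
next
  fix s v assume s: "s \<in> carrier P" "v \<in> ab_in A ` carrier A"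
  then show "ab_map A (a s) v \<in> ab_in A ` carrier A"
    by (auto simp: ab_map_in[OF comm_group_A action_hom] intro: action_closed)
next
  fix s and u v :: "'b ab_prod" assume s: "s \<in> carrier P"
  have "ab_map A (a s) ((u - v) + v) = ab_map A (a s) (u - v) + ab_map A (a s) v"
    by (rule ab_map_add[OF comm_group_A action_hom[OF s]])
  then show "ab_map A (a s) (u - v) = ab_map A (a s) u - ab_map A (a s) v" by (simp add: algebra_simps)
next
  fix s t v assume "s \<in> carrier P" "t \<in> carrier P"
  then show "ab_map A (a (s \<otimes>\<^bsub>P\<^esub> t)) v = ab_map A (a s) (ab_map A (a t) v)"
    by (intro ab_map_comp[OF comm_group_A] action_hom action_mult)
next
  fix v show "ab_map A (a \<one>\<^bsub>P\<^esub>) v = v"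
    by (rule ab_map_ident[OF comm_group_A]) (rule action_one)
qed

end

sublocale module_action \<subseteq> M: fin_module P "ab_in A ` carrier A" "\<lambda>h. ab_map A (a h)"
  by (rule fin_module)

context module_action
begin

definition quotients :: "nat \<Rightarrow> 'g list \<Rightarrow> nat \<Rightarrow> 'g" where
  "quotients n l = (\<lambda>i\<in>{..<n}. inv\<^bsub>P\<^esub> (l ! i) \<otimes>\<^bsub>P\<^esub> l ! Suc i)"

text \<open>The entries of \<open>(1, x_0, x_0 x_1, ...)\<close>, the tuple that starts with the
  unit and has successive quotients \<open>x\<close>. Every tuple is a translate of one of these, so
  they determine an equivariant cochain.\<close>

primrec partial_product :: "(nat \<Rightarrow> 'g) \<Rightarrow> nat \<Rightarrow> 'g" where
  "partial_product x 0 = \<one>\<^bsub>P\<^esub>"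
| "partial_product x (Suc i) = partial_product x i \<otimes>\<^bsub>P\<^esub> x i"

definition partial_products :: "nat \<Rightarrow> (nat \<Rightarrow> 'g) \<Rightarrow> 'g list" where
  "partial_products n x = map (partial_product x) [0..<Suc n]"

text \<open>\<open>f(l\<^sub>0, \<dots>, l\<^sub>n) = l\<^sub>0 \<phi>(l\<^sub>0\<inverse> l\<^sub>1, \<dots>, l\<^bsub>n-1\<^esub>\<inverse> l\<^sub>n)\<close> is the homogeneous cochain
  of \<open>\<phi>\<close>.\<close>

definition homog :: "nat \<Rightarrow> ((nat \<Rightarrow> 'g) \<Rightarrow> 'b) \<Rightarrow> 'g list \<Rightarrow> 'b ab_prod" where
  "homog n \<phi> l = ab_in A (a (l ! 0) (\<phi> (quotients n l)))"

definition inhomog :: "nat \<Rightarrow> ('g list \<Rightarrow> 'b ab_prod) \<Rightarrow> (nat \<Rightarrow> 'g) \<Rightarrow> 'b" where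
  "inhomog n F = (\<lambda>x\<in>tuples P n. ab_coord (F (partial_products n x)) A)"

abbreviation cochains :: "nat \<Rightarrow> ((nat \<Rightarrow> 'g) \<Rightarrow> 'b) set" where
  "cochains n \<equiv> carrier (cochain_group P A n)"

abbreviation \<delta> :: "nat \<Rightarrow> ((nat \<Rightarrow> 'g) \<Rightarrow> 'b) \<Rightarrow> (nat \<Rightarrow> 'g) \<Rightarrow> 'b" where
  "\<delta> \<equiv> coboundary P A a"

lemma cochain_closed: "\<phi> \<in> cochains n \<Longrightarrow> x \<in> tuples P n \<Longrightarrow> \<phi> x \<in> carrier A"
  by (auto simp: cochain_group_def)

lemma tup_nth: "l \<in> M.tup n \<Longrightarrow> i < n \<Longrightarrow> l ! i \<in> carrier P"
  by (auto simp: M.tup_def)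

lemma tuples_nth: "x \<in> tuples P n \<Longrightarrow> i < n \<Longrightarrow> x i \<in> carrier P"
  by (auto simp: tuples_def)

lemma quotients_tuples: "l \<in> M.tup (Suc n) \<Longrightarrow> quotients n l \<in> tuples P n"
  by (auto simp: quotients_def tuples_def tup_nth)

lemma partial_product_closed: "x \<in> tuples P n \<Longrightarrow> i \<le> n \<Longrightarrow> partial_product x i \<in> carrier P"
  by (induction i) (auto simp: tuples_nth)

lemma partial_products_tup: "x \<in> tuples P n \<Longrightarrow> partial_products n x \<in> M.tup (Suc n)"
  by (auto simp: M.tup_def partial_products_def partial_product_closed simp del: upt_Suc)

lemma partial_products_nth: "i \<le> n \<Longrightarrow> partial_products n x ! i = partial_product x i"
  by (simp add: partial_products_def nth_map_upt del: upt_Suc)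

lemma length_partial_products [simp]: "length (partial_products n x) = Suc n"
  by (simp add: partial_products_def del: upt_Suc)

lemma quotients_partial_products:
  assumes x: "x \<in> tuples P n"
  shows "quotients n (partial_products n x) = x"
proof (rule ext)
  fix i
  show "quotients n (partial_products n x) i = x i"
  proof (cases "i < n")
    case True
    then show ?thesis
      using partial_product_closed[OF x, of i] tuples_nth[OF x True]
      by (simp add: quotients_def partial_products_nth P.inv_mult_cancel)
  next
    case False
    then show ?thesis using x by (simp add: quotients_def tuples_def PiE_def extensional_def)
  qed
qed

lemma shift_partial_products:
  assumes l: "l \<in> M.tup (Suc n)"
  shows "M.shift (l ! 0) (partial_products n (quotients n l)) = l"
proof (rule nth_equalityI)
  show len: "length (M.shift (l ! 0) (partial_products n (quotients n l))) = length l"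
    using l by (simp add: partial_products_def M.tup_def del: upt_Suc)
  have "i \<le> n \<Longrightarrow> l ! 0 \<otimes>\<^bsub>P\<^esub> partial_product (quotients n l) i = l ! i" for i
  proof (induction i)
    case (Suc i)
    have c: "l ! 0 \<in> carrier P" "l ! i \<in> carrier P" "l ! Suc i \<in> carrier P"
      using tup_nth[OF l] Suc.prems by auto
    have p: "partial_product (quotients n l) i \<in> carrier P"
      using partial_product_closed[OF quotients_tuples[OF l]] Suc.prems by simp
    have "l ! 0 \<otimes>\<^bsub>P\<^esub> partial_product (quotients n l) (Suc i) =
        (l ! 0 \<otimes>\<^bsub>P\<^esub> partial_product (quotients n l) i) \<otimes>\<^bsub>P\<^esub> (inv\<^bsub>P\<^esub> (l ! i) \<otimes>\<^bsub>P\<^esub> l ! Suc i)"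
      using Suc.prems c p by (simp add: quotients_def P.m_assoc)
    also have "\<dots> = l ! Suc i" using Suc c by (simp add: P.inv_mult_cancel)
    finally show ?case .
  qed (use tup_nth[OF l] in simp)
  then show "M.shift (l ! 0) (partial_products n (quotients n l)) ! i = l ! i"
    if "i < length (M.shift (l ! 0) (partial_products n (quotients n l)))" for i
    using that by (simp add: M.shift_def partial_products_nth)
qed

lemma quotients_shift:
  assumes "l \<in> M.tup (Suc n)" "s \<in> carrier P"
  shows "quotients n (M.shift s l) = quotients n l"
  using assms by (auto simp: quotients_def M.shift_def tup_nth P.group_simps fun_eq_iff M.tup_def)

lemma homog_coch: "\<phi> \<in> cochains n \<Longrightarrow> homog n \<phi> \<in> M.coch (Suc n) (carrier P)"
proof (rule M.cochI)
  fix l assume \<phi>: "\<phi> \<in> cochains n" and l: "l \<in> M.tup (Suc n)"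
  have q: "\<phi> (quotients n l) \<in> carrier A" using cochain_closed[OF \<phi> quotients_tuples[OF l]] .
  have l0: "l ! 0 \<in> carrier P" using tup_nth[OF l] by simp
  then show "homog n \<phi> l \<in> ab_in A ` carrier A"
    using q by (auto simp: homog_def intro: action_closed)
  fix s assume s: "s \<in> carrier P"
  have "M.shift s l ! 0 = s \<otimes>\<^bsub>P\<^esub> l ! 0" using l by (auto simp: M.shift_def M.tup_def)
  then show "homog n \<phi> (M.shift s l) = ab_map A (a s) (homog n \<phi> l)"
    using s q l0 by (simp add: homog_def quotients_shift[OF l s] action_mult
        ab_map_in[OF comm_group_A action_hom] action_closed)
qed

lemma inhomog_cochain:
  assumes "F \<in> M.coch (Suc n) (carrier P)"
  shows "inhomog n F \<in> cochains n"
proof -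
  have "ab_coord (F (partial_products n x)) A \<in> carrier A" if "x \<in> tuples P n" for x
    using M.coch_V[OF assms partial_products_tup[OF that]] by (auto simp: ab_coord_in_same[OF comm_group_A])
  then show ?thesis by (simp add: cochain_group_def inhomog_def)
qed

lemma homog_inhomog:
  assumes "F \<in> M.coch (Suc n) (carrier P)" and l: "l \<in> M.tup (Suc n)"
  shows "homog n (inhomog n F) l = F l"
proof -
  let ?p = "partial_products n (quotients n l)"
  have q: "quotients n l \<in> tuples P n" by (rule quotients_tuples[OF l])
  have p: "?p \<in> M.tup (Suc n)" by (rule partial_products_tup[OF q])
  have l0: "l ! 0 \<in> carrier P" using tup_nth[OF l] by simp
  obtain x where x: "x \<in> carrier A" "F ?p = ab_in A x" using M.coch_V[OF assms(1) p] by blast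
  have "homog n (inhomog n F) l = ab_in A (a (l ! 0) x)"
    using q x by (simp add: homog_def inhomog_def ab_coord_in_same[OF comm_group_A])
  also have "\<dots> = ab_map A (a (l ! 0)) (F ?p)"
    using x by (simp add: ab_map_in[OF comm_group_A action_hom[OF l0]])
  also have "\<dots> = F (M.shift (l ! 0) ?p)" using M.coch_shift[OF assms(1) p l0] by simp
  finally show ?thesis using shift_partial_products[OF l] by simp
qed

lemma homog_partial_products:
  assumes "\<phi> \<in> cochains n" "x \<in> tuples P n"
  shows "ab_coord (homog n \<phi> (partial_products n x)) A = \<phi> x"
  using assms cochain_closed[OF assms]
  by (simp add: homog_def quotients_partial_products partial_products_nth action_one
      ab_coord_in_same[OF comm_group_A])

text \<open>Identities for the inhomogeneous coboundary, such as additivity and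
  \<open>d d = 0\<close>, are proved by passing to homogeneous cochains, where they hold for
  \<open>cdiff\<close>.\<close>

lemma homog_inject:
  assumes "\<phi> \<in> cochains n" "\<psi> \<in> cochains n" "\<And>l. l \<in> M.tup (Suc n) \<Longrightarrow> homog n \<phi> l = homog n \<psi> l"
  shows "\<phi> = \<psi>"
proof (rule PiE_ext[where k = "tuples P n" and s = "\<lambda>_. carrier A"])
  show "\<phi> \<in> (\<Pi>\<^sub>E x\<in>tuples P n. carrier A)" "\<psi> \<in> (\<Pi>\<^sub>E x\<in>tuples P n. carrier A)"
    using assms by (auto simp: cochain_group_def)
  show "\<phi> x = \<psi> x" if "x \<in> tuples P n" for x
    using assms that partial_products_tup[OF that] homog_partial_products by metis
qed

lemma homog_mult:
  assumes "\<phi> \<in> cochains n" "\<psi> \<in> cochains n" "l \<in> M.tup (Suc n)"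
  shows "homog n (\<phi> \<otimes>\<^bsub>cochain_group P A n\<^esub> \<psi>) l = homog n \<phi> l + homog n \<psi> l"
proof -
  have q: "quotients n l \<in> tuples P n" by (rule quotients_tuples[OF assms(3)])
  have l0: "l ! 0 \<in> carrier P" using tup_nth[OF assms(3)] by simp
  have c: "\<phi> (quotients n l) \<in> carrier A" "\<psi> (quotients n l) \<in> carrier A"
    using assms cochain_closed q by auto
  then show ?thesis
    using q action_hom[OF l0] action_closed[OF l0]
    by (simp add: homog_def cochain_group_def hom_mult ab_in_mult[OF comm_group_A])
qed

lemma coboundary_closed:
  assumes "\<phi> \<in> cochains n"
  shows "\<delta> n \<phi> \<in> cochains (Suc n)"
proof -
  have "\<delta> n \<phi> x \<in> carrier A" if x: "x \<in> tuples P (Suc n)" for x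
  proof -
    have c: "x i \<in> carrier P" if "i \<le> n" for i using tuples_nth[OF x] that by simp
    have t: "(\<lambda>i\<in>{..<n}. x (Suc i)) \<in> tuples P n" "(\<lambda>i\<in>{..<n}. x i) \<in> tuples P n"
      "(\<lambda>i\<in>{..<n}. if i < j then x i else if i = j then x j \<otimes>\<^bsub>P\<^esub> x (Suc j) else x (Suc i)) \<in> tuples P n" for j
      using c by (auto simp: tuples_def)
    show ?thesis
      using x cochain_closed[OF assms] t action_closed[OF c[of 0]]
      by (simp add: coboundary_def A.finprod_closed Pi_def)
  qed
  then show ?thesis by (auto simp: cochain_group_def coboundary_def)
qed

text \<open>Omitting the first entry of \<open>l\<close> changes the leading element from
  \<open>l_0\<close> to \<open>l_0 x_0\<close> and so produces the term with the action. Omitting an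
  inner entry multiplies two neighbouring quotients, and omitting the last one drops a
  quotient.\<close>

lemma cdiff_homog:
  assumes \<phi>: "\<phi> \<in> cochains n" and l: "l \<in> M.tup (Suc (Suc n))"
  shows "cdiff (homog n \<phi>) l = homog (Suc n) (\<delta> n \<phi>) l"
proof -
  let ?sg = "\<lambda>j::nat. if even j then id else uminus :: 'b ab_prod \<Rightarrow> 'b ab_prod"
  let ?x = "quotients (Suc n) l"
  have len: "length l = Suc (Suc n)" using l by (simp add: M.tup_def)
  have c: "l ! i \<in> carrier P" if "i \<le> Suc n" for i using tup_nth[OF l] that by simp
  have x: "?x \<in> tuples P (Suc n)" by (rule quotients_tuples[OF l])
  have xc: "?x i \<in> carrier P" if "i \<le> n" for i using tuples_nth[OF x] that by simp
  have x_eq: "?x i = inv\<^bsub>P\<^esub> (l ! i) \<otimes>\<^bsub>P\<^esub> l ! Suc i" if "i \<le> n" for i using that by (simp add: quotients_def)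
  define merge where "merge j = (\<lambda>i\<in>{..<n}. if i < j then ?x i else if i = j then ?x j \<otimes>\<^bsub>P\<^esub> ?x (Suc j) else ?x (Suc i))" for j
  have t: "(\<lambda>i\<in>{..<n}. ?x (Suc i)) \<in> tuples P n" "(\<lambda>i\<in>{..<n}. ?x i) \<in> tuples P n" "merge j \<in> tuples P n" for j
    using xc by (auto simp: tuples_def merge_def)
  note \<phi>c = cochain_closed[OF \<phi> t(1)] cochain_closed[OF \<phi> t(2)] cochain_closed[OF \<phi> t(3)]
  \<comment> \<open>The action of the first entry followed by the embedding into the additive type.
    It turns the products and the powers with exponent \<open>1\<close> or \<open>- 1\<close> of the
    inhomogeneous formula into signed sums.\<close>
  define \<theta> where "\<theta> y = ab_in A (a (l ! 0) y)" for y
  have \<theta>_mult: "\<theta> (y \<otimes>\<^bsub>A\<^esub> z) = \<theta> y + \<theta> z" if "y \<in> carrier A" "z \<in> carrier A" for y z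
    using that action_hom[OF c[of 0]] action_closed[OF c[of 0]]
    by (simp add: \<theta>_def hom_mult ab_in_mult[OF comm_group_A])
  have \<theta>_one: "\<theta> \<one>\<^bsub>A\<^esub> = 0" using \<theta>_mult[of "\<one>\<^bsub>A\<^esub>" "\<one>\<^bsub>A\<^esub>"] by simp
  have \<theta>_inv: "\<theta> (inv\<^bsub>A\<^esub> y) = - \<theta> y" if "y \<in> carrier A" for y
    using \<theta>_mult[of "inv\<^bsub>A\<^esub> y" y] that by (simp add: \<theta>_one eq_neg_iff_add_eq_0)
  have \<theta>_pow: "\<theta> (y [^]\<^bsub>A\<^esub> ((- 1) ^ j :: int)) = ?sg j (\<theta> y)" if "y \<in> carrier A" for y j
    using that by (cases "even j") (simp_all add: A.int_pow_neg \<theta>_inv)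
  have \<theta>_prod: "finite J \<Longrightarrow> (\<And>j. j \<in> J \<Longrightarrow> g j \<in> carrier A) \<Longrightarrow> \<theta> (finprod A g J) = (\<Sum>j\<in>J. \<theta> (g j))" for J and g :: "nat \<Rightarrow> 'b"
    by (induction J rule: finite_induct) (auto simp: \<theta>_one \<theta>_mult Pi_def)
  let ?del = "\<lambda>j. take j l @ drop (Suc j) l"
  have del_nth: "?del j ! i = (if i < j then l ! i else l ! Suc i)" if "j \<le> Suc n" "i \<le> n" for i j
    using that len by (simp add: nth_append)
  have first: "homog n \<phi> (?del 0) = \<theta> (a (?x 0) (\<phi> (\<lambda>i\<in>{..<n}. ?x (Suc i))))"
  proof -
    have "quotients n (?del 0) = (\<lambda>i\<in>{..<n}. ?x (Suc i))"
      by (rule ext) (simp add: quotients_def len)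
    moreover have "a (l ! Suc 0) y = a (l ! 0) (a (?x 0) y)" if "y \<in> carrier A" for y
    proof -
      have "l ! Suc 0 = l ! 0 \<otimes>\<^bsub>P\<^esub> ?x 0" using c[of 0] c[of 1] by (simp add: x_eq P.inv_mult_cancel)
      then show ?thesis using action_mult[OF c[of 0] xc[of 0] that] by simp
    qed
    ultimately show ?thesis using \<phi>c(1) del_nth[of 0 0] by (simp add: homog_def \<theta>_def)
  qed
  have middle: "homog n \<phi> (?del (Suc j)) = \<theta> (\<phi> (merge j))" if j: "j < n" for j
  proof -
    have "quotients n (?del (Suc j)) = merge j"
    proof (rule ext)
      fix i
      show "quotients n (?del (Suc j)) i = merge j i"
      proof (cases "i < n")
        case True
        have m: "?x j \<otimes>\<^bsub>P\<^esub> ?x (Suc j) = inv\<^bsub>P\<^esub> (l ! j) \<otimes>\<^bsub>P\<^esub> l ! Suc (Suc j)"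
          using j c by (simp add: x_eq P.m_assoc P.inv_mult_cancel)
        consider "i < j" | "i = j" | "i > j" by linarith
        then show ?thesis
          by cases (use True j m del_nth[of "Suc j" i] del_nth[of "Suc j" "Suc i"] in
              \<open>simp_all add: quotients_def merge_def\<close>)
      qed (simp add: quotients_def merge_def)
    qed
    then show ?thesis using del_nth[of "Suc j" 0] j by (simp add: homog_def \<theta>_def)
  qed
  have last: "homog n \<phi> (?del (Suc n)) = \<theta> (\<phi> (\<lambda>i\<in>{..<n}. ?x i))"
  proof -
    have "quotients n (?del (Suc n)) = (\<lambda>i\<in>{..<n}. ?x i)"
      by (rule ext) (simp add: quotients_def del_nth del: drop_Suc take_Suc)
    then show ?thesis using del_nth[of "Suc n" 0] by (simp add: homog_def \<theta>_def)
  qed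
  have "cdiff (homog n \<phi>) l = (\<Sum>j<Suc (Suc n). ?sg j (homog n \<phi> (?del j)))"
    by (simp add: cdiff_sum len)
  also have "\<dots> = homog n \<phi> (?del 0) + (\<Sum>j<n. ?sg (Suc j) (homog n \<phi> (?del (Suc j)))) +
      ?sg (Suc n) (homog n \<phi> (?del (Suc n)))"
    by (subst sum.lessThan_Suc_shift) (simp add: add.assoc)
  also have "(\<Sum>j<n. ?sg (Suc j) (homog n \<phi> (?del (Suc j)))) = (\<Sum>j<n. ?sg (Suc j) (\<theta> (\<phi> (merge j))))"
    by (rule sum.cong) (simp_all add: middle)
  also have "homog n \<phi> (?del 0) + \<dots> + ?sg (Suc n) (homog n \<phi> (?del (Suc n))) =
      \<theta> (a (?x 0) (\<phi> (\<lambda>i\<in>{..<n}. ?x (Suc i)))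
        \<otimes>\<^bsub>A\<^esub> (\<Otimes>\<^bsub>A\<^esub>j\<in>{..<n}. \<phi> (merge j) [^]\<^bsub>A\<^esub> ((- 1) ^ Suc j :: int))
        \<otimes>\<^bsub>A\<^esub> \<phi> (\<lambda>i\<in>{..<n}. ?x i) [^]\<^bsub>A\<^esub> ((- 1) ^ Suc n :: int))"
    unfolding first last using \<phi>c action_closed[OF xc[of 0] \<phi>c(1)]
    by (simp add: \<theta>_mult \<theta>_prod \<theta>_pow first last A.finprod_closed Pi_def del: power_Suc)
  also have "\<dots> = homog (Suc n) (\<delta> n \<phi>) l"
    using x by (simp add: homog_def \<theta>_def coboundary_def merge_def)
  finally show ?thesis .
qed

end

context module_action
begin

lemma comm_group_cochains: "comm_group (cochain_group P A n)"
proof -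
  interpret C: group "cochain_group P A n"
    unfolding cochain_group_def by (simp add: A.group_axioms)
  show ?thesis
  proof (rule C.group_comm_groupI)
    fix \<phi> \<psi> assume *: "\<phi> \<in> cochains n" "\<psi> \<in> cochains n"
    have "\<phi> x \<otimes>\<^bsub>A\<^esub> \<psi> x = \<psi> x \<otimes>\<^bsub>A\<^esub> \<phi> x" if "x \<in> tuples P n" for x
      using cochain_closed[OF *(1) that] cochain_closed[OF *(2) that] by (rule A.m_comm)
    then show "\<phi> \<otimes>\<^bsub>cochain_group P A n\<^esub> \<psi> = \<psi> \<otimes>\<^bsub>cochain_group P A n\<^esub> \<phi>"
      by (simp add: cochain_group_def cong: restrict_cong)
  qed
qed

lemma one_cochain: "\<one>\<^bsub>cochain_group P A n\<^esub> = (\<lambda>x\<in>tuples P n. \<one>\<^bsub>A\<^esub>)"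
  by (simp add: cochain_group_def)

lemma one_cochain_closed: "\<one>\<^bsub>cochain_group P A n\<^esub> \<in> cochains n"
  using comm_group.axioms(2)[OF comm_group_cochains] by (simp add: group.is_monoid monoid.one_closed)

lemma mult_cochain_closed:
  "\<phi> \<in> cochains n \<Longrightarrow> \<psi> \<in> cochains n \<Longrightarrow> \<phi> \<otimes>\<^bsub>cochain_group P A n\<^esub> \<psi> \<in> cochains n"
  using comm_group.axioms(2)[OF comm_group_cochains] by (simp add: group.is_monoid monoid.m_closed)

lemma homog_one:
  assumes "l \<in> M.tup (Suc n)"
  shows "homog n \<one>\<^bsub>cochain_group P A n\<^esub> l = 0"
  using homog_mult[OF one_cochain_closed one_cochain_closed assms] mult_cochain_closed
  by (simp add: group.is_monoid comm_group.axioms(2)[OF comm_group_cochains] monoid.l_one one_cochain_closed)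

lemma coboundary_hom: "\<delta> n \<in> hom (cochain_group P A n) (cochain_group P A (Suc n))"
proof (rule homI)
  fix \<phi> \<psi> assume *: "\<phi> \<in> cochains n" "\<psi> \<in> cochains n"
  note m = mult_cochain_closed[OF *]
  show "\<delta> n (\<phi> \<otimes>\<^bsub>cochain_group P A n\<^esub> \<psi>) = \<delta> n \<phi> \<otimes>\<^bsub>cochain_group P A (Suc n)\<^esub> \<delta> n \<psi>"
  proof (rule homog_inject[OF coboundary_closed[OF m]])
    show "\<delta> n \<phi> \<otimes>\<^bsub>cochain_group P A (Suc n)\<^esub> \<delta> n \<psi> \<in> cochains (Suc n)"
      using * by (intro mult_cochain_closed coboundary_closed)
    fix l assume l: "l \<in> M.tup (Suc (Suc n))"
    have "homog (Suc n) (\<delta> n (\<phi> \<otimes>\<^bsub>cochain_group P A n\<^esub> \<psi>)) l = cdiff (\<lambda>l. homog n \<phi> l + homog n \<psi> l) l"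
      unfolding cdiff_homog[OF m l, symmetric] by (rule M.cdiff_tup_cong[OF l homog_mult[OF *]])
    then show "homog (Suc n) (\<delta> n (\<phi> \<otimes>\<^bsub>cochain_group P A n\<^esub> \<psi>)) l =
        homog (Suc n) (\<delta> n \<phi> \<otimes>\<^bsub>cochain_group P A (Suc n)\<^esub> \<delta> n \<psi>) l"
      using * l by (simp add: cdiff_add cdiff_homog homog_mult coboundary_closed)
  qed
qed (rule coboundary_closed)

lemma coboundary_coboundary:
  assumes "\<phi> \<in> cochains n"
  shows "\<delta> (Suc n) (\<delta> n \<phi>) = \<one>\<^bsub>cochain_group P A (Suc (Suc n))\<^esub>"
proof (rule homog_inject)
  note c = coboundary_closed[OF assms]
  show "\<delta> (Suc n) (\<delta> n \<phi>) \<in> cochains (Suc (Suc n))" by (rule coboundary_closed[OF c])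
  show "\<one>\<^bsub>cochain_group P A (Suc (Suc n))\<^esub> \<in> cochains (Suc (Suc n))" by (rule one_cochain_closed)
  fix l assume l: "l \<in> M.tup (Suc (Suc (Suc n)))"
  have "homog (Suc (Suc n)) (\<delta> (Suc n) (\<delta> n \<phi>)) l = cdiff (cdiff (homog n \<phi>)) l"
    unfolding cdiff_homog[OF c l, symmetric]
    by (rule M.cdiff_tup_cong[OF l]) (rule cdiff_homog[OF assms, symmetric])
  then show "homog (Suc (Suc n)) (\<delta> (Suc n) (\<delta> n \<phi>)) l =
      homog (Suc (Suc n)) \<one>\<^bsub>cochain_group P A (Suc (Suc n))\<^esub> l"
    using l by (simp add: cdiff_cdiff homog_one)
qed

section \<open>Inhomogeneous cochains modulo a normal subgroup\<close>

definition factors_in :: "'g set \<Rightarrow> nat \<Rightarrow> ((nat \<Rightarrow> 'g) \<Rightarrow> 'b) \<Rightarrow> bool" where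
  "factors_in N n \<phi> \<longleftrightarrow> (\<forall>x\<in>tuples P n. \<forall>y\<in>tuples P n.
     (\<forall>i<n. N #>\<^bsub>P\<^esub> x i = N #>\<^bsub>P\<^esub> y i) \<longrightarrow> \<phi> x = \<phi> y)"

lemma coset_inv_mult:
  assumes N: "N \<lhd> P" and c: "u \<in> carrier P" "u' \<in> carrier P" "v \<in> carrier P" "v' \<in> carrier P"
    and eq: "N #>\<^bsub>P\<^esub> u = N #>\<^bsub>P\<^esub> u'" "N #>\<^bsub>P\<^esub> v = N #>\<^bsub>P\<^esub> v'"
  shows "N #>\<^bsub>P\<^esub> (inv\<^bsub>P\<^esub> u \<otimes>\<^bsub>P\<^esub> v) = N #>\<^bsub>P\<^esub> (inv\<^bsub>P\<^esub> u' \<otimes>\<^bsub>P\<^esub> v')"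
proof -
  interpret N: normal N P by fact
  have "(N #>\<^bsub>P\<^esub> inv\<^bsub>P\<^esub> u) = (N #>\<^bsub>P\<^esub> inv\<^bsub>P\<^esub> u')"
    using N.rcos_inv[OF c(1)] N.rcos_inv[OF c(2)] eq(1) by simp
  then show ?thesis
    using N.rcos_sum[of "inv\<^bsub>P\<^esub> u" v] N.rcos_sum[of "inv\<^bsub>P\<^esub> u'" v'] c eq(2) by simp
qed

lemma coset_mult:
  assumes N: "N \<lhd> P" and c: "u \<in> carrier P" "u' \<in> carrier P" "v \<in> carrier P" "v' \<in> carrier P"
    and eq: "N #>\<^bsub>P\<^esub> u = N #>\<^bsub>P\<^esub> u'" "N #>\<^bsub>P\<^esub> v = N #>\<^bsub>P\<^esub> v'"
  shows "N #>\<^bsub>P\<^esub> (u \<otimes>\<^bsub>P\<^esub> v) = N #>\<^bsub>P\<^esub> (u' \<otimes>\<^bsub>P\<^esub> v')"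
  using normal.rcos_sum[OF N c(1,3)] normal.rcos_sum[OF N c(2,4)] eq by simp

lemma cosets_nth:
  assumes "M.cosets N l = M.cosets N l'" "i < length l"
  shows "N #>\<^bsub>P\<^esub> (l ! i) = N #>\<^bsub>P\<^esub> (l' ! i)"
proof -
  have "M.cosets N l ! i = M.cosets N l' ! i" using assms(1) by simp
  then show ?thesis using assms(2) M.cosets_length[OF assms(1)] by (simp add: M.cosets_def)
qed

lemma factors_full:
  "M.factors N n n f \<longleftrightarrow> (\<forall>l\<in>M.tup n. \<forall>l'\<in>M.tup n. M.cosets N l = M.cosets N l' \<longrightarrow> f l = f l')"
proof
  assume *: "M.factors N n n f"
  show "\<forall>l\<in>M.tup n. \<forall>l'\<in>M.tup n. M.cosets N l = M.cosets N l' \<longrightarrow> f l = f l'"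
  proof (intro ballI impI)
    fix l l' assume l: "l \<in> M.tup n" "l' \<in> M.tup n" "M.cosets N l = M.cosets N l'"
    have "length l = n" using l(1) by (simp add: M.tup_def)
    then have "f (l @ []) = f (l' @ [])"
      by (rule M.factorsD[OF * l(3)]) (simp_all add: l)
    then show "f l = f l'" by simp
  qed
next
  assume *: "\<forall>l\<in>M.tup n. \<forall>l'\<in>M.tup n. M.cosets N l = M.cosets N l' \<longrightarrow> f l = f l'"
  show "M.factors N n n f"
    unfolding M.factors_def
  proof (intro allI impI, elim conjE)
    fix ys ys' zs assume ys: "length ys = n" "ys @ zs \<in> M.tup n" "ys' @ zs \<in> M.tup n" "M.cosets N ys = M.cosets N ys'"
    have "zs = []" using ys(1,2) by (simp add: M.tup_def)
    then have "ys \<in> M.tup n" "ys' \<in> M.tup n" using ys(2,3) by simp_all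
    then have "f ys = f ys'" using * ys(4) by blast
    then show "f (ys @ zs) = f (ys' @ zs)" by (simp add: \<open>zs = []\<close>)
  qed
qed

text \<open>The homogeneous cochain contains the action of the first entry, so the quotients alone
  do not suffice: \<open>N\<close> also has to act trivially on the module.\<close>

lemma homog_factors:
  assumes \<phi>: "\<phi> \<in> cochains n" "factors_in N n \<phi>" and N: "N \<lhd> P"
    and triv: "\<And>h x. h \<in> N \<Longrightarrow> x \<in> carrier A \<Longrightarrow> a h x = x"
  shows "M.factors N (Suc n) (Suc n) (homog n \<phi>)"
  unfolding factors_full
proof (intro ballI impI)
  fix l l' assume l: "l \<in> M.tup (Suc n)" "l' \<in> M.tup (Suc n)" "M.cosets N l = M.cosets N l'"
  have Ns: "subgroup N P" using N by (simp add: normal_imp_subgroup)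
  have len: "length l = Suc n" using l by (simp add: M.tup_def)
  have c: "l ! i \<in> carrier P" "l' ! i \<in> carrier P" "N #>\<^bsub>P\<^esub> (l ! i) = N #>\<^bsub>P\<^esub> (l' ! i)" if "i \<le> n" for i
    using tup_nth[OF l(1)] tup_nth[OF l(2)] cosets_nth[OF l(3)] that len by auto
  have "\<phi> (quotients n l) = \<phi> (quotients n l')"
  proof -
    have "\<forall>i<n. N #>\<^bsub>P\<^esub> quotients n l i = N #>\<^bsub>P\<^esub> quotients n l' i"
    proof (intro allI impI)
      fix i assume i: "i < n"
      then have "N #>\<^bsub>P\<^esub> (inv\<^bsub>P\<^esub> (l ! i) \<otimes>\<^bsub>P\<^esub> l ! Suc i) = N #>\<^bsub>P\<^esub> (inv\<^bsub>P\<^esub> (l' ! i) \<otimes>\<^bsub>P\<^esub> l' ! Suc i)"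
        using c[of i] c[of "Suc i"] by (intro coset_inv_mult[OF N]) auto
      then show "N #>\<^bsub>P\<^esub> quotients n l i = N #>\<^bsub>P\<^esub> quotients n l' i" using i by (simp add: quotients_def)
    qed
    then show ?thesis
      using \<phi>(2) quotients_tuples[OF l(1)] quotients_tuples[OF l(2)] unfolding factors_in_def by blast
  qed
  moreover have "a (l ! 0) y = a (l' ! 0) y" if y: "y \<in> carrier A" for y
  proof -
    have h: "l ! 0 \<otimes>\<^bsub>P\<^esub> inv\<^bsub>P\<^esub> (l' ! 0) \<in> N" using c[of 0] by (intro P.r_coset_eqD Ns) auto
    have "a (l ! 0) y = a ((l ! 0 \<otimes>\<^bsub>P\<^esub> inv\<^bsub>P\<^esub> (l' ! 0)) \<otimes>\<^bsub>P\<^esub> l' ! 0) y"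
      using c[of 0] by (simp add: P.m_assoc)
    also have "\<dots> = a (l' ! 0) y"
      using c[of 0] triv[OF h] y by (simp add: action_mult[of "l ! 0 \<otimes>\<^bsub>P\<^esub> inv\<^bsub>P\<^esub> (l' ! 0)"] action_closed)
    finally show ?thesis .
  qed
  ultimately show "homog n \<phi> l = homog n \<phi> l'"
    using cochain_closed[OF \<phi>(1) quotients_tuples[OF l(2)]] by (simp add: homog_def)
qed

lemma inhomog_factors:
  assumes F: "M.factors N (Suc n) (Suc n) F" and N: "N \<lhd> P"
  shows "factors_in N n (inhomog n F)"
  unfolding factors_in_def
proof (intro ballI impI)
  fix x y assume x: "x \<in> tuples P n" and y: "y \<in> tuples P n" and eq: "\<forall>i<n. N #>\<^bsub>P\<^esub> x i = N #>\<^bsub>P\<^esub> y i"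
  have "i \<le> n \<Longrightarrow> N #>\<^bsub>P\<^esub> partial_product x i = N #>\<^bsub>P\<^esub> partial_product y i" for i
  proof (induction i)
    case (Suc i)
    then show ?case
      using eq partial_product_closed[OF x] partial_product_closed[OF y] tuples_nth[OF x] tuples_nth[OF y]
      by (simp add: coset_mult[OF N])
  qed simp
  then have "M.cosets N (partial_products n x) = M.cosets N (partial_products n y)"
    by (intro nth_equalityI) (auto simp: M.cosets_def partial_products_nth)
  then have "F (partial_products n x) = F (partial_products n y)"
    using F partial_products_tup[OF x] partial_products_tup[OF y] unfolding factors_full by blast
  then show "inhomog n F x = inhomog n F y" using x y by (simp add: inhomog_def)
qed

lemma action_kernel:
  obtains N where "N \<lhd> P" "P.fin_ind N (carrier P)" "\<And>h x. h \<in> N \<Longrightarrow> x \<in> carrier A \<Longrightarrow> a h x = x"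
proof -
  define N where "N = {h \<in> carrier P. \<forall>x\<in>carrier A. a h x = x}"
  have inv: "a (inv\<^bsub>P\<^esub> h) x = x" if "h \<in> N" "x \<in> carrier A" for h x
  proof -
    have h: "h \<in> carrier P" "a h x = x" using that by (auto simp: N_def)
    then have "a (inv\<^bsub>P\<^esub> h) x = a (inv\<^bsub>P\<^esub> h \<otimes>\<^bsub>P\<^esub> h) x" using that by (subst action_mult) auto
    then show ?thesis using h that by (simp add: action_one)
  qed
  have sub: "subgroup N P"
  proof (rule P.subgroupI)
    have "\<one>\<^bsub>P\<^esub> \<in> N" by (simp add: N_def action_one)
    then show "N \<noteq> {}" by blast
    show "inv\<^bsub>P\<^esub> h \<in> N" if "h \<in> N" for h
      using that inv[OF that] by (auto simp: N_def)
  qed (auto simp: N_def action_mult)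
  have "N \<lhd> P"
  proof (rule P.normal_invI[OF sub])
    fix g h assume g: "g \<in> carrier P" and h: "h \<in> N"
    have "a (g \<otimes>\<^bsub>P\<^esub> h \<otimes>\<^bsub>P\<^esub> inv\<^bsub>P\<^esub> g) x = x" if x: "x \<in> carrier A" for x
    proof -
      have hc: "h \<in> carrier P" and ht: "\<And>y. y \<in> carrier A \<Longrightarrow> a h y = y" using h by (auto simp: N_def)
      have "a (g \<otimes>\<^bsub>P\<^esub> h \<otimes>\<^bsub>P\<^esub> inv\<^bsub>P\<^esub> g) x = a g (a h (a (inv\<^bsub>P\<^esub> g) x))"
        using g hc x by (simp add: action_mult action_closed)
      also have "\<dots> = a g (a (inv\<^bsub>P\<^esub> g) x)" using g x ht by (simp add: action_closed)
      also have "\<dots> = x" using g x by (simp add: action_one flip: action_mult)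
      finally show ?thesis .
    qed
    then show "g \<otimes>\<^bsub>P\<^esub> h \<otimes>\<^bsub>P\<^esub> inv\<^bsub>P\<^esub> g \<in> N" using g h by (auto simp: N_def)
  qed
  moreover have "P.fin_ind N (carrier P)"
  proof (rule P.fin_indI[where \<kappa> = "\<lambda>h. restrict (a h) (carrier A)"])
    have "(\<lambda>h. restrict (a h) (carrier A)) ` carrier P \<subseteq> (\<Pi>\<^sub>E x\<in>carrier A. carrier A)"
      by (auto simp: action_closed)
    then show "finite ((\<lambda>h. restrict (a h) (carrier A)) ` carrier P)"
      by (rule finite_subset) (auto intro!: finite_PiE finite_A)
    fix g h assume gh: "g \<in> carrier P" "h \<in> carrier P" "restrict (a g) (carrier A) = restrict (a h) (carrier A)"
    have "a (g \<otimes>\<^bsub>P\<^esub> inv\<^bsub>P\<^esub> h) x = x" if x: "x \<in> carrier A" for x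
    proof -
      have y: "a (inv\<^bsub>P\<^esub> h) x \<in> carrier A" using gh x by (simp add: action_closed)
      have "a g (a (inv\<^bsub>P\<^esub> h) x) = a h (a (inv\<^bsub>P\<^esub> h) x)"
        using fun_cong[OF gh(3), of "a (inv\<^bsub>P\<^esub> h) x"] y by simp
      then show ?thesis using gh x by (simp add: action_mult action_one flip: action_mult)
    qed
    then show "g \<otimes>\<^bsub>P\<^esub> inv\<^bsub>P\<^esub> h \<in> N" using gh by (simp add: N_def)
  qed (use sub P.subgroup_self in \<open>auto simp: N_def\<close>)
  ultimately show ?thesis by (rule that) (simp add: N_def)
qed

text \<open>\<open>effaceable_factors\<close> carried over to inhomogeneous cochains.
  \<open>K\<close> is fixed before \<open>\<phi>\<close>, which both the finiteness and the
  comparison with the completion exploit.\<close>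

theorem effaceable_factors_in:
  assumes eff: "M.effaceable (carrier P)" and N: "N \<lhd> P" "P.fin_ind N (carrier P)"
  obtains K where "K \<lhd> P" "P.fin_ind K (carrier P)"
    "\<And>\<phi>. \<phi> \<in> cochains (Suc m) \<Longrightarrow> factors_in N (Suc (Suc m)) (\<delta> (Suc m) \<phi>) \<Longrightarrow>
      \<exists>\<psi>\<in>cochains m. \<exists>\<chi>\<in>cochains (Suc m). factors_in K (Suc m) \<chi> \<and>
        \<phi> = \<chi> \<otimes>\<^bsub>cochain_group P A (Suc m)\<^esub> \<delta> m \<psi>"
proof -
  obtain N0 where N0: "N0 \<lhd> P" "P.fin_ind N0 (carrier P)" "\<And>h x. h \<in> N0 \<Longrightarrow> x \<in> carrier A \<Longrightarrow> a h x = x"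
    using action_kernel by blast
  \<comment> \<open>\<open>N\<close> is intersected with a subgroup acting trivially, as the passage
    to homogeneous cochains requires.\<close>
  let ?N = "N \<inter> N0"
  have N': "?N \<lhd> P" "P.fin_ind ?N (carrier P)"
    using P.normal_subgroup_intersect N N0 P.fin_ind_Int by blast+
  obtain K where K: "K \<lhd> P" "P.fin_ind K (carrier P)" "K \<subseteq> ?N"
    and red: "\<And>f. f \<in> M.coch (Suc (Suc m)) (carrier P) \<Longrightarrow>
      M.factors ?N (Suc (Suc (Suc m))) (Suc (Suc (Suc m))) (cdiff f) \<Longrightarrow>
      \<exists>g \<in> M.coch (Suc m) (carrier P). M.factors K (Suc (Suc m)) (Suc (Suc m)) (\<lambda>xs. f xs - cdiff g xs)"
    using M.effaceable_factors[OF eff N', of "Suc m"] by blast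
  have "\<exists>\<psi>\<in>cochains m. \<exists>\<chi>\<in>cochains (Suc m). factors_in K (Suc m) \<chi> \<and>
        \<phi> = \<chi> \<otimes>\<^bsub>cochain_group P A (Suc m)\<^esub> \<delta> m \<psi>"
    if \<phi>: "\<phi> \<in> cochains (Suc m)" "factors_in N (Suc (Suc m)) (\<delta> (Suc m) \<phi>)" for \<phi>
  proof -
    let ?f = "homog (Suc m) \<phi>"
    note f = homog_coch[OF \<phi>(1)]
    have "factors_in ?N (Suc (Suc m)) (\<delta> (Suc m) \<phi>)"
      unfolding factors_in_def
    proof (intro ballI impI)
      fix x y assume x: "x \<in> tuples P (Suc (Suc m))" and y: "y \<in> tuples P (Suc (Suc m))"
        and eq: "\<forall>i<Suc (Suc m). ?N #>\<^bsub>P\<^esub> x i = ?N #>\<^bsub>P\<^esub> y i"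
      have "N #>\<^bsub>P\<^esub> x i = N #>\<^bsub>P\<^esub> y i" if i: "i < Suc (Suc m)" for i
      proof (rule P.r_coset_eqI[OF normal_imp_subgroup[OF N(1)] tuples_nth[OF x i] tuples_nth[OF y i]])
        show "x i \<otimes>\<^bsub>P\<^esub> inv\<^bsub>P\<^esub> y i \<in> N"
          using P.r_coset_eqD[OF normal_imp_subgroup[OF N'(1)] tuples_nth[OF x i] tuples_nth[OF y i]] eq i by blast
      qed
      then show "\<delta> (Suc m) \<phi> x = \<delta> (Suc m) \<phi> y" using \<phi>(2) x y unfolding factors_in_def by blast
    qed
    then have "M.factors ?N (Suc (Suc (Suc m))) (Suc (Suc (Suc m))) (homog (Suc (Suc m)) (\<delta> (Suc m) \<phi>))"
      using N0(3) by (intro homog_factors coboundary_closed \<phi> N') auto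
    then have "M.factors ?N (Suc (Suc (Suc m))) (Suc (Suc (Suc m))) (cdiff ?f)"
      unfolding factors_full using cdiff_homog[OF \<phi>(1)] by metis
    then obtain g where g: "g \<in> M.coch (Suc m) (carrier P)"
      "M.factors K (Suc (Suc m)) (Suc (Suc m)) (\<lambda>xs. ?f xs - cdiff g xs)"
      using red[OF f] by blast
    let ?h = "\<lambda>xs. ?f xs - cdiff g xs"
    have h: "?h \<in> M.coch (Suc (Suc m)) (carrier P)"
      by (rule M.coch_diff[OF f M.cdiff_coch[OF g(1)]]) auto
    let ?\<psi> = "inhomog m g" and ?\<chi> = "inhomog (Suc m) ?h"
    have \<psi>: "?\<psi> \<in> cochains m" and \<chi>: "?\<chi> \<in> cochains (Suc m)"
      using inhomog_cochain[OF g(1)] inhomog_cochain[OF h] by auto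
    have "\<phi> = ?\<chi> \<otimes>\<^bsub>cochain_group P A (Suc m)\<^esub> \<delta> m ?\<psi>"
    proof (rule homog_inject[OF \<phi>(1) mult_cochain_closed[OF \<chi> coboundary_closed[OF \<psi>]]])
      fix l assume l: "l \<in> M.tup (Suc (Suc m))"
      have "cdiff (homog m ?\<psi>) l = cdiff g l"
        by (rule M.cdiff_tup_cong[OF l]) (rule homog_inhomog[OF g(1)])
      then show "?f l = homog (Suc m) (?\<chi> \<otimes>\<^bsub>cochain_group P A (Suc m)\<^esub> \<delta> m ?\<psi>) l"
        using homog_inhomog[OF h l] l
        by (simp add: homog_mult[OF \<chi> coboundary_closed[OF \<psi>]] flip: cdiff_homog[OF \<psi>])
    qed
    then show ?thesis using \<psi> \<chi> inhomog_factors[OF g(2) K(1)] by blast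
  qed
  then show ?thesis using that K by blast
qed

text \<open>Such a cochain is determined by its values on tuples of chosen coset representatives, of
  which there are finitely many.\<close>

lemma finite_factors_in:
  assumes "P.fin_ind N (carrier P)"
  shows "finite {\<chi> \<in> cochains n. factors_in N n \<chi>}"
proof -
  define C where "C = (\<lambda>x. N #>\<^bsub>P\<^esub> x) ` carrier P"
  have C: "finite C" using P.fin_indD(4)[OF assms] by (simp add: C_def)
  define r where "r c = (SOME x. x \<in> carrier P \<and> N #>\<^bsub>P\<^esub> x = c)" for c
  have r: "r c \<in> carrier P \<and> N #>\<^bsub>P\<^esub> r c = c" if "c \<in> C" for c
    unfolding r_def by (rule someI_ex) (use that in \<open>auto simp: C_def\<close>)
  define D where "D = ({..<n} \<rightarrow>\<^sub>E C)"
  have D: "finite D" unfolding D_def by (rule finite_PiE) (auto simp: C)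
  have rD: "(\<lambda>i\<in>{..<n}. r (c i)) \<in> tuples P n" if "c \<in> D" for c
    using that r by (auto simp: D_def tuples_def)
  define T where "T \<chi> = (\<lambda>c\<in>D. \<chi> (\<lambda>i\<in>{..<n}. r (c i)))" for \<chi> :: "(nat \<Rightarrow> 'g) \<Rightarrow> 'b"
  show ?thesis
  proof (rule inj_on_finite)
    show "T ` {\<chi> \<in> cochains n. factors_in N n \<chi>} \<subseteq> (D \<rightarrow>\<^sub>E carrier A)"
      using rD cochain_closed by (auto simp: T_def)
    show "finite (D \<rightarrow>\<^sub>E carrier A)" using D finite_A by (intro finite_PiE) auto
    show "inj_on T {\<chi> \<in> cochains n. factors_in N n \<chi>}"
    proof (rule inj_onI)
      fix \<chi> \<psi> assume a: "\<chi> \<in> {\<chi> \<in> cochains n. factors_in N n \<chi>}" "\<psi> \<in> {\<chi> \<in> cochains n. factors_in N n \<chi>}"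
        "T \<chi> = T \<psi>"
      show "\<chi> = \<psi>"
      proof (rule PiE_ext[where k = "tuples P n" and s = "\<lambda>_. carrier A"])
        show "\<chi> \<in> (\<Pi>\<^sub>E x\<in>tuples P n. carrier A)" "\<psi> \<in> (\<Pi>\<^sub>E x\<in>tuples P n. carrier A)"
          using a by (auto simp: cochain_group_def)
        fix x assume x: "x \<in> tuples P n"
        define c where "c = (\<lambda>i\<in>{..<n}. N #>\<^bsub>P\<^esub> x i)"
        have cD: "c \<in> D" using x tuples_nth by (auto simp: c_def D_def C_def)
        let ?y = "\<lambda>i\<in>{..<n}. r (c i)"
        have eq: "\<forall>i<n. N #>\<^bsub>P\<^esub> x i = N #>\<^bsub>P\<^esub> ?y i"
          using x tuples_nth r by (auto simp: c_def C_def)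
        have "\<chi> x = \<chi> ?y" "\<psi> x = \<psi> ?y"
          using a x rD[OF cD] eq unfolding factors_in_def by blast+
        moreover have "\<chi> ?y = \<psi> ?y" using fun_cong[OF a(3), of c] cD by (simp add: T_def)
        ultimately show "\<chi> x = \<psi> x" by simp
      qed
    qed
  qed
qed

end

section \<open>The profinite completion\<close>

context group
begin

lemma finite_index_normals_iff: "N \<in> finite_index_normals G \<longleftrightarrow> N \<lhd> G \<and> fin_ind N (carrier G)"
proof -
  have "rcosets N = (\<lambda>x. N #> x) ` carrier G" by (auto simp: RCOSETS_def)
  then show ?thesis
    using subgroup_self subgroup.subset[OF normal_imp_subgroup[of N G]]
    by (auto simp: finite_index_normals_def fin_ind_def normal_imp_subgroup)
qed

lemma finite_index_normals_Int:
  "M \<in> finite_index_normals G \<Longrightarrow> N \<in> finite_index_normals G \<Longrightarrow> M \<inter> N \<in> finite_index_normals G"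
  by (simp add: finite_index_normals_iff normal_subgroup_intersect fin_ind_Int)

lemma carrier_finite_index_normal: "carrier G \<in> finite_index_normals G"
  by (simp add: finite_index_normals_iff fin_ind_refl subgroup_self normal_invI)

lemma finite_index_normals_refinement:
  assumes "finite J" "J \<subseteq> finite_index_normals G"
  obtains N where "N \<in> finite_index_normals G" "\<And>M. M \<in> J \<Longrightarrow> N \<subseteq> M"
proof -
  have "\<exists>N\<in>finite_index_normals G. \<forall>M\<in>J. N \<subseteq> M" using assms
  proof (induction rule: finite_induct)
    case empty
    then show ?case using carrier_finite_index_normal by blast
  next
    case (insert M J)
    then obtain N where "N \<in> finite_index_normals G" "\<forall>M\<in>J. N \<subseteq> M" by auto
    then show ?case using finite_index_normals_Int[of M N] insert.prems
      by (intro bexI[of _ "M \<inter> N"]) auto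
  qed
  then show ?thesis using that by blast
qed

lemma finite_index_normalD:
  assumes "N \<in> finite_index_normals G"
  shows "N \<lhd> G" "subgroup N G" "N \<subseteq> carrier G"
proof -
  show N: "N \<lhd> G" using assms by (simp add: finite_index_normals_iff)
  show "subgroup N G" by (rule normal_imp_subgroup[OF N])
  then show "N \<subseteq> carrier G" by (rule subgroup.subset)
qed

lemma set_mult_coset:
  assumes "N \<in> finite_index_normals G" "M \<in> finite_index_normals G" "N \<subseteq> M" "h \<in> carrier G"
  shows "M <#> (N #> h) = M #> h"
proof -
  note N = finite_index_normalD[OF assms(1)] and M = finite_index_normalD[OF assms(2)]
  have "M <#> (N #> h) = (M <#> N) #> h"
    using N M assms(4) by (simp add: setmult_rcos_assoc)
  also have "M <#> N = M"
  proof
    show "M <#> N \<subseteq> M"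
      using assms(3) subgroup.m_closed[OF M(2)] by (auto simp: set_mult_def)
    show "M \<subseteq> M <#> N"
    proof
      fix x assume "x \<in> M"
      then have "x = x \<otimes> \<one>" using M by auto
      then show "x \<in> M <#> N" using subgroup.one_closed[OF N(2)] \<open>x \<in> M\<close> unfolding set_mult_def by blast
    qed
  qed
  finally show ?thesis .
qed

section \<open>The completion as a group\<close>

abbreviation hat :: "('a set \<Rightarrow> 'a set) monoid" where
  "hat \<equiv> profinite_completion G"

abbreviation hat_topology :: "('a set \<Rightarrow> 'a set) topology" where
  "hat_topology \<equiv> profinite_topology G"

lemma hat_carrier:
  "carrier hat = {x \<in> (\<Pi>\<^sub>E N\<in>finite_index_normals G. carrier (G Mod N)).
     \<forall>N\<in>finite_index_normals G. \<forall>M\<in>finite_index_normals G. N \<subseteq> M \<longrightarrow> M <#> x N = x M}"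
  by (simp add: profinite_completion_def)

lemma hat_mult: "x \<otimes>\<^bsub>hat\<^esub> y = (\<lambda>N\<in>finite_index_normals G. x N <#> y N)"
  by (simp add: profinite_completion_def product_group_def)

text \<open>At all levels containing \<open>N\<close>, a point of the completion coincides with a
  single group element. Calculations in the completion thereby reduce to calculations with
  cosets.\<close>

lemma hat_rep:
  assumes "x \<in> carrier hat" "N \<in> finite_index_normals G"
  obtains h where "h \<in> carrier G" "\<And>M. M \<in> finite_index_normals G \<Longrightarrow> N \<subseteq> M \<Longrightarrow> x M = M #> h"
proof -
  have "x N \<in> carrier (G Mod N)" using assms by (auto simp: hat_carrier)
  then obtain h where h: "h \<in> carrier G" "x N = N #> h" by (auto simp: carrier_FactGroup)
  have "x M = M #> h" if "M \<in> finite_index_normals G" "N \<subseteq> M" for M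
    using assms that h set_mult_coset[OF assms(2) that h(1)] by (auto simp: hat_carrier)
  then show ?thesis using that h by blast
qed

lemma hat_eq_mono:
  assumes "x \<in> carrier hat" "y \<in> carrier hat" "x N = y N" "N \<subseteq> M"
    "N \<in> finite_index_normals G" "M \<in> finite_index_normals G"
  shows "x M = y M"
proof -
  have "M <#> x N = x M" "M <#> y N = y M" using assms by (auto simp: hat_carrier)
  then show ?thesis using assms(3) by simp
qed

lemma hat_carrierI:
  assumes "x \<in> extensional (finite_index_normals G)"
    and "\<And>N. N \<in> finite_index_normals G \<Longrightarrow>
      \<exists>h\<in>carrier G. \<forall>M\<in>finite_index_normals G. N \<subseteq> M \<longrightarrow> x M = M #> h"
  shows "x \<in> carrier hat"
  unfolding hat_carrier
proof (intro CollectI conjI ballI impI)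
  show "x \<in> (\<Pi>\<^sub>E N\<in>finite_index_normals G. carrier (G Mod N))"
  proof (rule PiE_I)
    fix N assume N: "N \<in> finite_index_normals G"
    obtain h where "h \<in> carrier G" "x N = N #> h" using assms(2)[OF N] N by blast
    then show "x N \<in> carrier (G Mod N)" by (auto simp: carrier_FactGroup)
  qed (use assms(1) in \<open>auto simp: extensional_def\<close>)
  fix N M assume NM: "N \<in> finite_index_normals G" "M \<in> finite_index_normals G" "N \<subseteq> M"
  obtain h where "h \<in> carrier G" "x N = N #> h" "x M = M #> h"
    using assms(2)[OF NM(1)] NM by blast
  then show "M <#> x N = x M" using set_mult_coset[OF NM] by simp
qed

lemma completion_map_closed: "h \<in> carrier G \<Longrightarrow> completion_map G h \<in> carrier hat"
  by (rule hat_carrierI) (auto simp: completion_map_def)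

lemma hat_mult_closed:
  assumes "x \<in> carrier hat" "y \<in> carrier hat"
  shows "x \<otimes>\<^bsub>hat\<^esub> y \<in> carrier hat"
proof (rule hat_carrierI)
  fix N assume N: "N \<in> finite_index_normals G"
  obtain h where h: "h \<in> carrier G" "\<And>M. M \<in> finite_index_normals G \<Longrightarrow> N \<subseteq> M \<Longrightarrow> x M = M #> h"
    using hat_rep[OF assms(1) N] by blast
  obtain k where k: "k \<in> carrier G" "\<And>M. M \<in> finite_index_normals G \<Longrightarrow> N \<subseteq> M \<Longrightarrow> y M = M #> k"
    using hat_rep[OF assms(2) N] by blast
  have "(x \<otimes>\<^bsub>hat\<^esub> y) M = M #> (h \<otimes> k)" if "M \<in> finite_index_normals G" "N \<subseteq> M" for M
    using h k that normal.rcos_sum[OF finite_index_normalD(1)[OF that(1)]] by (simp add: hat_mult)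
  then show "\<exists>h\<in>carrier G. \<forall>M\<in>finite_index_normals G. N \<subseteq> M \<longrightarrow> (x \<otimes>\<^bsub>hat\<^esub> y) M = M #> h"
    using h k by blast
qed (simp add: hat_mult)

lemma group_hat: "group hat"
proof -
  let ?F = "finite_index_normals G"
  have factor: "group (G Mod N)" if "N \<in> ?F" for N
    using normal.factorgroup_is_group[OF finite_index_normalD(1)[OF that]] .
  have PG: "group (product_group ?F (\<lambda>N. G Mod N))"
    using factor by simp
  have hat: "hat = (product_group ?F (\<lambda>N. G Mod N))\<lparr>carrier := carrier hat\<rparr>"
    by (simp add: profinite_completion_def)
  have "subgroup (carrier hat) (product_group ?F (\<lambda>N. G Mod N))"
  proof (rule group.subgroupI[OF PG])
    show "carrier hat \<subseteq> carrier (product_group ?F (\<lambda>N. G Mod N))" by (auto simp: hat_carrier)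
    show "carrier hat \<noteq> {}" using completion_map_closed[OF one_closed] by blast
    show "x \<otimes>\<^bsub>product_group ?F (\<lambda>N. G Mod N)\<^esub> y \<in> carrier hat" if "x \<in> carrier hat" "y \<in> carrier hat" for x y
      using hat_mult_closed[OF that] by (simp add: hat_mult)
    fix x assume x: "x \<in> carrier hat"
    have xP: "x \<in> (\<Pi>\<^sub>E N\<in>?F. carrier (G Mod N))" using x by (simp add: hat_carrier)
    show "inv\<^bsub>product_group ?F (\<lambda>N. G Mod N)\<^esub> x \<in> carrier hat"
    proof (rule hat_carrierI)
      fix N assume N: "N \<in> ?F"
      obtain h where h: "h \<in> carrier G" "\<And>M. M \<in> ?F \<Longrightarrow> N \<subseteq> M \<Longrightarrow> x M = M #> h"
        using hat_rep[OF x N] by blast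
      have "(inv\<^bsub>product_group ?F (\<lambda>N. G Mod N)\<^esub> x) M = M #> inv h" if M: "M \<in> ?F" "N \<subseteq> M" for M
      proof -
        interpret Q: normal M G by (rule finite_index_normalD(1)[OF M(1)])
        have "(inv\<^bsub>product_group ?F (\<lambda>N. G Mod N)\<^esub> x) M = inv\<^bsub>G Mod M\<^esub> (M #> h)"
          using xP factor M h(2)[OF M] by simp
        also have "\<dots> = M #> inv h"
          using h(1) by (subst Q.inv_FactGroup) (auto simp: carrier_FactGroup Q.rcos_inv)
        finally show ?thesis .
      qed
      then show "\<exists>h\<in>carrier G. \<forall>M\<in>?F. N \<subseteq> M \<longrightarrow> (inv\<^bsub>product_group ?F (\<lambda>N. G Mod N)\<^esub> x) M = M #> h"
        using h(1) by blast
    qed (use xP factor in simp)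
  qed
  then show ?thesis using group.subgroup_imp_group[OF PG] hat by metis
qed

lemma completion_map_hom: "completion_map G \<in> hom G hat"
proof (rule homI)
  fix h k assume hk: "h \<in> carrier G" "k \<in> carrier G"
  have "N #> (h \<otimes> k) = (N #> h) <#> (N #> k)" if "N \<in> finite_index_normals G" for N
    using normal.rcos_sum[OF finite_index_normalD(1)[OF that] hk] by simp
  then show "completion_map G (h \<otimes> k) = completion_map G h \<otimes>\<^bsub>hat\<^esub> completion_map G k"
    by (auto simp: completion_map_def hat_mult fun_eq_iff)
qed (rule completion_map_closed)

section \<open>The topology of the completion\<close>

lemma topspace_hat: "topspace hat_topology = carrier hat"
  by (auto simp: profinite_topology_def hat_carrier)

lemma continuous_coordinate:
  assumes "N \<in> finite_index_normals G"
  shows "continuous_map (product_topology (\<lambda>N. discrete_topology (carrier (G Mod N))) (finite_index_normals G))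
    (discrete_topology UNIV) (\<lambda>x. x N)"
proof -
  let ?X = "product_topology (\<lambda>N. discrete_topology (carrier (G Mod N))) (finite_index_normals G)"
  have "continuous_map ?X (discrete_topology (carrier (G Mod N))) (\<lambda>x. x N)"
    by (rule continuous_map_product_projection[OF assms])
  then have "continuous_map ?X (subtopology (discrete_topology UNIV) (carrier (G Mod N))) (\<lambda>x. x N)"
    by (simp add: subtopology_discrete_topology)
  then show ?thesis by (rule continuous_map_into_fulltopology)
qed

text \<open>Each compatibility condition compares two coordinates and is closed, so the completion
  is closed in a product of finite discrete spaces.\<close>

lemma compact_space_hat: "compact_space hat_topology"
proof -
  let ?F = "finite_index_normals G"
  let ?X = "product_topology (\<lambda>N. discrete_topology (carrier (G Mod N))) ?F"
  have "finite (carrier (G Mod N))" if "N \<in> ?F" for N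
    using that by (auto simp: finite_index_normals_def FactGroup_def)
  then have X: "compact_space ?X"
    by (simp add: compact_space_product_topology compact_space_discrete_topology)
  let ?C = "\<lambda>(N, M). {x \<in> topspace ?X. M <#> x N = x M}"
  let ?I = "{(N, M). N \<in> ?F \<and> M \<in> ?F \<and> N \<subseteq> M}"
  have eq: "carrier hat = \<Inter>(insert (topspace ?X) (?C ` ?I))" unfolding hat_carrier by auto
  have "closedin ?X (\<Inter>(insert (topspace ?X) (?C ` ?I)))"
  proof (rule closedin_Inter)
    fix S assume "S \<in> insert (topspace ?X) (?C ` ?I)"
    then consider "S = topspace ?X" | N M where "N \<in> ?F" "M \<in> ?F" "S = {x \<in> topspace ?X. M <#> x N = x M}" by auto
    then show "closedin ?X S"
    proof cases
      case 1
      then show ?thesis by (simp only: closedin_topspace)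
    next
      case (2 N M)
      have "continuous_map ?X (discrete_topology UNIV) (\<lambda>x. M <#> x N)"
        using continuous_map_discrete_bin[OF continuous_coordinate[OF 2(1)] continuous_coordinate[OF 2(1)], of "\<lambda>u v. M <#> u"] .
      then show ?thesis unfolding 2(3) by (rule closedin_discrete_eq) (rule continuous_coordinate[OF 2(2)])
    qed
  qed auto
  then have "closedin ?X (carrier hat)" unfolding eq .
  then have "compactin ?X (carrier hat)" using X by (rule closedin_compact_space[rotated])
  then show ?thesis unfolding profinite_topology_def by (rule compact_space_subtopology)
qed

lemma openin_cylinder:
  assumes "N \<in> finite_index_normals G"
  shows "openin hat_topology {g \<in> carrier hat. g N = Y}"
proof -
  have "continuous_map hat_topology (discrete_topology UNIV) (\<lambda>g. g N)"
    unfolding profinite_topology_def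
    by (rule continuous_map_from_subtopology[OF continuous_coordinate[OF assms]])
  from openin_continuous_map_preimage[OF this, of "{Y}"] show ?thesis by (simp add: topspace_hat)
qed

text \<open>A basic open set of the product restricts finitely many coordinates. One level below all
  of them determines these coordinates, since the points are compatible families.\<close>

lemma cylinder_basis:
  assumes "openin hat_topology U" "g \<in> U"
  obtains N where "N \<in> finite_index_normals G" "{g' \<in> carrier hat. g' N = g N} \<subseteq> U"
proof -
  let ?F = "finite_index_normals G"
  let ?D = "\<lambda>N. discrete_topology (carrier (G Mod N))"
  obtain V where V: "openin (product_topology ?D ?F) V" "U = V \<inter> carrier hat"
    using assms(1) by (auto simp: profinite_topology_def openin_subtopology)
  obtain W where W: "finite {N \<in> ?F. W N \<noteq> topspace (?D N)}" "g \<in> (\<Pi>\<^sub>E N\<in>?F. W N)" "(\<Pi>\<^sub>E N\<in>?F. W N) \<subseteq> V"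
  proof -
    have "g \<in> V" using V(2) assms(2) by simp
    from bspec[OF V(1)[unfolded openin_product_topology_alt] this] show ?thesis using that by auto
  qed
  obtain N where N: "N \<in> ?F" "\<And>M. M \<in> {N \<in> ?F. W N \<noteq> topspace (?D N)} \<Longrightarrow> N \<subseteq> M"
    using finite_index_normals_refinement[OF W(1)] by blast
  have gc: "g \<in> carrier hat" using V(2) assms(2) by simp
  have "{g' \<in> carrier hat. g' N = g N} \<subseteq> U"
  proof
    fix g' assume g': "g' \<in> {g' \<in> carrier hat. g' N = g N}"
    have "g' \<in> (\<Pi>\<^sub>E N\<in>?F. W N)"
    proof (rule PiE_I)
      fix M assume M: "M \<in> ?F"
      show "g' M \<in> W M"
      proof (cases "W M = topspace (?D M)")
        case True
        then show ?thesis using g' M by (auto simp: hat_carrier)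
      next
        case False
        then have "g' M = g M" using N M g' gc hat_eq_mono[of g' g N M] by auto
        then show ?thesis using W(2) M by (auto dest: PiE_mem)
      qed
    qed (use g' in \<open>auto simp: hat_carrier PiE_def extensional_def\<close>)
    then show "g' \<in> U" using V(2) W(3) g' by auto
  qed
  then show ?thesis using that N(1) by blast
qed

lemma topspace_tuples: "topspace (product_topology (\<lambda>_. hat_topology) {..<n}) = tuples hat n"
  by (simp add: tuples_def topspace_hat)

lemma openin_tuple_cylinder:
  assumes "N \<in> finite_index_normals G"
  shows "openin (product_topology (\<lambda>_. hat_topology) {..<n}) {y \<in> tuples hat n. \<forall>i<n. y i N = x i N}"
proof -
  have "{y \<in> tuples hat n. \<forall>i<n. y i N = x i N} = (\<Pi>\<^sub>E i\<in>{..<n}. {g \<in> carrier hat. g N = x i N})"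
    by (auto simp: tuples_def PiE_def Pi_def)
  then show ?thesis using openin_cylinder[OF assms] by (simp add: openin_PiE)
qed

text \<open>Locally a suitable \<open>N\<close> exists by continuity; one \<open>N\<close> serves all tuples by compactness.\<close>

lemma continuous_factors:
  assumes "continuous_map (product_topology (\<lambda>_. hat_topology) {..<n}) (discrete_topology D) f"
  obtains N where "N \<in> finite_index_normals G"
    "\<forall>x\<in>tuples hat n. \<forall>y\<in>tuples hat n. (\<forall>i<n. x i N = y i N) \<longrightarrow> f x = f y"
proof -
  let ?F = "finite_index_normals G"
  let ?X = "product_topology (\<lambda>_::nat. hat_topology) {..<n}"
  define cyl where "cyl N x = {y \<in> tuples hat n. \<forall>i<n. y i N = x i N}" for N and x :: "nat \<Rightarrow> 'a set \<Rightarrow> 'a set"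
  have "\<exists>N\<in>?F. \<forall>y\<in>cyl N x. f y = f x" if x: "x \<in> tuples hat n" for x
  proof -
    have "f x \<in> D" using assms x topspace_tuples by (auto simp: continuous_map_def)
    then have "openin ?X {y \<in> topspace ?X. f y \<in> {f x}}"
      by (intro openin_continuous_map_preimage[OF assms]) auto
    moreover have "x \<in> {y \<in> topspace ?X. f y \<in> {f x}}" using x topspace_tuples by simp
    ultimately obtain U where U: "\<And>i. i < n \<Longrightarrow> openin hat_topology (U i)" "x \<in> (\<Pi>\<^sub>E i\<in>{..<n}. U i)"
      "(\<Pi>\<^sub>E i\<in>{..<n}. U i) \<subseteq> {y \<in> topspace ?X. f y \<in> {f x}}"
    proof -
      assume "openin ?X {y \<in> topspace ?X. f y \<in> {f x}}" "x \<in> {y \<in> topspace ?X. f y \<in> {f x}}"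
      from bspec[OF this(1)[unfolded openin_product_topology_alt] this(2)] show ?thesis
        using that by (auto simp only: lessThan_iff)
    qed
    have "\<exists>N\<in>?F. {g \<in> carrier hat. g N = x i N} \<subseteq> U i" if i: "i < n" for i
    proof -
      have "x i \<in> U i" using U(2) i by auto
      then obtain N where "N \<in> ?F" "{g \<in> carrier hat. g N = x i N} \<subseteq> U i"
        by (rule cylinder_basis[OF U(1)[OF i]])
      then show ?thesis by blast
    qed
    then have "\<forall>i\<in>{..<n}. \<exists>N. N \<in> ?F \<and> {g \<in> carrier hat. g N = x i N} \<subseteq> U i" by blast
    from bchoice[OF this] obtain N where
      N: "\<And>i. i < n \<Longrightarrow> N i \<in> ?F \<and> {g \<in> carrier hat. g (N i) = x i (N i)} \<subseteq> U i" by blast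
    have sub: "N ` {..<n} \<subseteq> ?F" using N by auto
    obtain M where M: "M \<in> ?F" "\<And>i. i < n \<Longrightarrow> M \<subseteq> N i"
      using finite_index_normals_refinement[OF finite_imageI[OF finite_lessThan] sub]
      by (metis imageI lessThan_iff)
    have "f y = f x" if y: "y \<in> cyl M x" for y
    proof -
      have "y \<in> (\<Pi>\<^sub>E i\<in>{..<n}. U i)"
      proof (rule PiE_I)
        fix i assume "i \<in> {..<n}"
        then have i: "i < n" by simp
        have c: "y i \<in> carrier hat" "x i \<in> carrier hat" using x y i by (auto simp: cyl_def tuples_def)
        have "y i (N i) = x i (N i)"
          using hat_eq_mono[OF c, of M "N i"] y i M N by (simp add: cyl_def)
        then show "y i \<in> U i" using N[OF i] c by auto
      qed (use y in \<open>auto simp: cyl_def tuples_def PiE_def extensional_def\<close>)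
      then show ?thesis using U(3) by auto
    qed
    then show ?thesis using M(1) by blast
  qed
  then obtain N where N: "\<And>x. x \<in> tuples hat n \<Longrightarrow> N x \<in> ?F \<and> (\<forall>y\<in>cyl (N x) x. f y = f x)" by metis
  have "compact_space ?X" using compact_space_hat by (simp add: compact_space_product_topology)
  moreover have "openin ?X (cyl (N x) x)" if "x \<in> tuples hat n" for x
    unfolding cyl_def using N[OF that] by (intro openin_tuple_cylinder) auto
  moreover have "topspace ?X \<subseteq> \<Union>((\<lambda>x. cyl (N x) x) ` tuples hat n)"
    unfolding topspace_tuples by (auto simp: cyl_def)
  ultimately obtain C where C: "finite C" "C \<subseteq> (\<lambda>x. cyl (N x) x) ` tuples hat n" "topspace ?X \<subseteq> \<Union>C"
  proof -
    assume X: "compact_space ?X" and op: "\<And>x. x \<in> tuples hat n \<Longrightarrow> openin ?X (cyl (N x) x)"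
      and cov: "topspace ?X \<subseteq> \<Union>((\<lambda>x. cyl (N x) x) ` tuples hat n)"
    have "\<exists>C. finite C \<and> C \<subseteq> (\<lambda>x. cyl (N x) x) ` tuples hat n \<and> topspace ?X \<subseteq> \<Union>C"
      by (rule compactinD[OF X[unfolded compact_space_def] _ cov]) (use op in blast)
    then show ?thesis using that by blast
  qed
  obtain J where J: "finite J" "J \<subseteq> tuples hat n" "C = (\<lambda>x. cyl (N x) x) ` J"
    using C(1,2) by (meson finite_subset_image)
  have sub: "N ` J \<subseteq> ?F" using N J(2) by auto
  obtain M where M: "M \<in> ?F" "\<And>x. x \<in> J \<Longrightarrow> M \<subseteq> N x"
    using finite_index_normals_refinement[OF finite_imageI[OF J(1)] sub] by (metis imageI)
  show ?thesis
  proof (rule that[OF M(1)], intro ballI impI)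
    fix x y assume xy: "x \<in> tuples hat n" "y \<in> tuples hat n" "\<forall>i<n. x i M = y i M"
    then have "x \<in> \<Union>C" using C(3) topspace_tuples by blast
    \<comment> \<open>The tuple \<open>y\<close> agrees with \<open>x\<close> at the common level,
      hence at the level belonging to \<open>z\<close>; both lie in the same cylinder, on which
      \<open>f\<close> is constant.\<close>
    then obtain z where z: "z \<in> J" "x \<in> cyl (N z) z" using J(3) by blast
    have zt: "z \<in> tuples hat n" using z J(2) by blast
    have "y i (N z) = z i (N z)" if i: "i < n" for i
    proof -
      have "x i \<in> carrier hat" "y i \<in> carrier hat" using xy i by (auto simp: tuples_def)
      then have "x i (N z) = y i (N z)"
        using hat_eq_mono[of "x i" "y i" M "N z"] xy(3) i M z N[OF zt] by blast
      then show ?thesis using z(2) i by (simp add: cyl_def)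
    qed
    then have "y \<in> cyl (N z) z" using xy(2) by (simp add: cyl_def)
    then show "f x = f y" using N[OF zt] z(2) by simp
  qed
qed

lemma factors_continuous:
  assumes "N \<in> finite_index_normals G" "f \<in> tuples hat n \<rightarrow> D"
    and "\<And>x y. x \<in> tuples hat n \<Longrightarrow> y \<in> tuples hat n \<Longrightarrow> (\<And>i. i < n \<Longrightarrow> x i N = y i N) \<Longrightarrow> f x = f y"
  shows "continuous_map (product_topology (\<lambda>_. hat_topology) {..<n}) (discrete_topology D) f"
  unfolding continuous_map_def
proof (intro conjI allI impI)
  let ?X = "product_topology (\<lambda>_::nat. hat_topology) {..<n}"
  show "f \<in> topspace ?X \<rightarrow> topspace (discrete_topology D)" using assms(2) by (simp only: topspace_tuples topspace_discrete_topology)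
  fix U
  have "{x \<in> topspace ?X. f x \<in> U} = (\<Union>x\<in>{x \<in> tuples hat n. f x \<in> U}. {y \<in> tuples hat n. \<forall>i<n. y i N = x i N})"
  proof (intro equalityI subsetI)
    fix x assume "x \<in> {x \<in> topspace ?X. f x \<in> U}"
    then show "x \<in> (\<Union>x\<in>{x \<in> tuples hat n. f x \<in> U}. {y \<in> tuples hat n. \<forall>i<n. y i N = x i N})"
      unfolding topspace_tuples by blast
  next
    fix y assume "y \<in> (\<Union>x\<in>{x \<in> tuples hat n. f x \<in> U}. {y \<in> tuples hat n. \<forall>i<n. y i N = x i N})"
    then obtain x where x: "x \<in> tuples hat n" "f x \<in> U" "y \<in> tuples hat n" "\<forall>i<n. y i N = x i N" by blast
    have "f y = f x" by (rule assms(3)[OF x(3,1)]) (use x(4) in blast)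
    then show "y \<in> {x \<in> topspace ?X. f x \<in> U}" unfolding topspace_tuples using x by simp
  qed
  then show "openin ?X {x \<in> topspace ?X. f x \<in> U}"
    using openin_tuple_cylinder[OF assms(1)] by (simp only: openin_clauses) blast
qed

end

section \<open>Comparison of the cohomology groups\<close>

lemma carrier_Mod_subgroup:
  "carrier (C\<lparr>carrier := Z\<rparr> Mod B) = (\<lambda>z. B #>\<^bsub>C\<^esub> z) ` Z"
  by (auto simp: carrier_FactGroup r_coset_def)

text \<open>The map of quotients is written as in \<open>cohomology_map\<close>. Injectivity and
  surjectivity are reduced to conditions on representatives, which can be checked on
  cochains.\<close>

lemma Mod_iso:
  assumes C': "comm_group C'" and C: "comm_group C"
    and Z': "subgroup Z' C'" and B': "subgroup B' C'" "B' \<subseteq> Z'"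
    and Z: "subgroup Z C" and B: "subgroup B C" "B \<subseteq> Z"
    and p: "p \<in> hom C' C" "p ` Z' \<subseteq> Z" "p ` B' \<subseteq> B"
    and inj: "\<And>f. f \<in> Z' \<Longrightarrow> p f \<in> B \<Longrightarrow> f \<in> B'"
    and surj: "\<And>z. z \<in> Z \<Longrightarrow> \<exists>f\<in>Z'. \<exists>b\<in>B. z = p f \<otimes>\<^bsub>C\<^esub> b"
  shows "(\<lambda>X. B <#>\<^bsub>C\<^esub> p ` X) \<in> iso (C'\<lparr>carrier := Z'\<rparr> Mod B') (C\<lparr>carrier := Z\<rparr> Mod B)"
proof -
  interpret C': comm_group C' by fact
  interpret C: comm_group C by fact
  interpret p: group_hom C' C p by unfold_locales (rule p(1))
  note cZ' = subgroup.mem_carrier[OF Z'] and cB' = subgroup.mem_carrier[OF B'(1)]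
  note cZ = subgroup.mem_carrier[OF Z] and cB = subgroup.mem_carrier[OF B(1)]
  have NB': "B' \<lhd> C'" and NB: "B \<lhd> C"
    using C'.subgroup_imp_normal[OF B'(1)] C.subgroup_imp_normal[OF B(1)] .
  let ?h = "\<lambda>X. B <#>\<^bsub>C\<^esub> p ` X"
  \<comment> \<open>On a full coset the map takes the expected value: the factor \<open>B\<close>
    absorbs the image of \<open>B'\<close>.\<close>
  have h: "?h (B' #>\<^bsub>C'\<^esub> f) = B #>\<^bsub>C\<^esub> p f" if f: "f \<in> Z'" for f
  proof
    note fc = cZ'[OF f]
    show "?h (B' #>\<^bsub>C'\<^esub> f) \<subseteq> B #>\<^bsub>C\<^esub> p f"
    proof
      fix y assume "y \<in> ?h (B' #>\<^bsub>C'\<^esub> f)"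
      then obtain b b' where b: "b \<in> B" "b' \<in> B'" "y = b \<otimes>\<^bsub>C\<^esub> p (b' \<otimes>\<^bsub>C'\<^esub> f)"
        by (auto simp: set_mult_def r_coset_def)
      have "y = (b \<otimes>\<^bsub>C\<^esub> p b') \<otimes>\<^bsub>C\<^esub> p f"
        using b cB cB' fc by (simp add: C.m_assoc)
      moreover have "b \<otimes>\<^bsub>C\<^esub> p b' \<in> B" using b p(3) by (intro subgroup.m_closed[OF B(1)]) auto
      ultimately show "y \<in> B #>\<^bsub>C\<^esub> p f" by (auto simp: r_coset_def)
    qed
    show "B #>\<^bsub>C\<^esub> p f \<subseteq> ?h (B' #>\<^bsub>C'\<^esub> f)"
    proof
      fix y assume "y \<in> B #>\<^bsub>C\<^esub> p f"
      then obtain b where "b \<in> B" "y = b \<otimes>\<^bsub>C\<^esub> p f" by (auto simp: r_coset_def)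
      then show "y \<in> ?h (B' #>\<^bsub>C'\<^esub> f)"
        using C'.rcos_self[OF fc B'(1)] unfolding set_mult_def by blast
    qed
  qed
  have mult': "(B' #>\<^bsub>C'\<^esub> f) <#>\<^bsub>C'\<^esub> (B' #>\<^bsub>C'\<^esub> g) = B' #>\<^bsub>C'\<^esub> (f \<otimes>\<^bsub>C'\<^esub> g)" if "f \<in> Z'" "g \<in> Z'" for f g
    using normal.rcos_sum[OF NB'] that cZ' by simp
  have mult: "(B #>\<^bsub>C\<^esub> f) <#>\<^bsub>C\<^esub> (B #>\<^bsub>C\<^esub> g) = B #>\<^bsub>C\<^esub> (f \<otimes>\<^bsub>C\<^esub> g)" if "f \<in> Z" "g \<in> Z" for f g
    using normal.rcos_sum[OF NB] that cZ by simp
  have sm: "set_mult (K\<lparr>carrier := Y\<rparr>) = set_mult K" for K :: "('x, 'y) monoid_scheme" and Y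
    by (simp add: set_mult_def fun_eq_iff)
  show ?thesis
  proof (rule isoI)
    show "?h \<in> hom (C'\<lparr>carrier := Z'\<rparr> Mod B') (C\<lparr>carrier := Z\<rparr> Mod B)"
    proof (rule homI)
      fix X assume "X \<in> carrier (C'\<lparr>carrier := Z'\<rparr> Mod B')"
      then show "?h X \<in> carrier (C\<lparr>carrier := Z\<rparr> Mod B)"
        unfolding carrier_Mod_subgroup using h p(2) by auto
    next
      fix X Y assume "X \<in> carrier (C'\<lparr>carrier := Z'\<rparr> Mod B')" "Y \<in> carrier (C'\<lparr>carrier := Z'\<rparr> Mod B')"
      then obtain f g where f: "f \<in> Z'" "X = B' #>\<^bsub>C'\<^esub> f" and g: "g \<in> Z'" "Y = B' #>\<^bsub>C'\<^esub> g"
        unfolding carrier_Mod_subgroup by blast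
      have fg: "f \<otimes>\<^bsub>C'\<^esub> g \<in> Z'" using f g subgroup.m_closed[OF Z'] by blast
      have "?h (X <#>\<^bsub>C'\<^esub> Y) = B #>\<^bsub>C\<^esub> (p f \<otimes>\<^bsub>C\<^esub> p g)"
        using f g mult' h[OF fg] cZ' by simp
      also have "\<dots> = ?h X <#>\<^bsub>C\<^esub> ?h Y"
        using f g h mult[of "p f" "p g"] p(2) by auto
      finally show "?h (X \<otimes>\<^bsub>C'\<lparr>carrier := Z'\<rparr> Mod B'\<^esub> Y) = ?h X \<otimes>\<^bsub>C\<lparr>carrier := Z\<rparr> Mod B\<^esub> ?h Y"
        by (simp add: sm)
    qed
    show "bij_betw ?h (carrier (C'\<lparr>carrier := Z'\<rparr> Mod B')) (carrier (C\<lparr>carrier := Z\<rparr> Mod B))"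
      unfolding bij_betw_def
    proof
      show "inj_on ?h (carrier (C'\<lparr>carrier := Z'\<rparr> Mod B'))"
      proof (rule inj_onI)
        fix X Y assume "X \<in> carrier (C'\<lparr>carrier := Z'\<rparr> Mod B')" "Y \<in> carrier (C'\<lparr>carrier := Z'\<rparr> Mod B')"
        then obtain f g where f: "f \<in> Z'" "X = B' #>\<^bsub>C'\<^esub> f" and g: "g \<in> Z'" "Y = B' #>\<^bsub>C'\<^esub> g"
          unfolding carrier_Mod_subgroup by blast
        assume "?h X = ?h Y"
        then have "B #>\<^bsub>C\<^esub> p f = B #>\<^bsub>C\<^esub> p g" using f g h by simp
        then have "p f \<otimes>\<^bsub>C\<^esub> inv\<^bsub>C\<^esub> (p g) \<in> B" using f g cZ' by (intro C.r_coset_eqD B) auto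
        then have "p (f \<otimes>\<^bsub>C'\<^esub> inv\<^bsub>C'\<^esub> g) \<in> B" using f g cZ' by simp
        then have "f \<otimes>\<^bsub>C'\<^esub> inv\<^bsub>C'\<^esub> g \<in> B'"
          using f g by (intro inj) (auto intro: subgroup.m_closed[OF Z'] subgroup.m_inv_closed[OF Z'])
        then show "X = Y" using f g cZ' by (simp add: C'.r_coset_eqI[OF B'(1)])
      qed
      show "?h ` carrier (C'\<lparr>carrier := Z'\<rparr> Mod B') = carrier (C\<lparr>carrier := Z\<rparr> Mod B)"
        unfolding carrier_Mod_subgroup
      proof
        show "?h ` ((\<lambda>z. B' #>\<^bsub>C'\<^esub> z) ` Z') \<subseteq> (\<lambda>z. B #>\<^bsub>C\<^esub> z) ` Z" using h p(2) by auto
        show "(\<lambda>z. B #>\<^bsub>C\<^esub> z) ` Z \<subseteq> ?h ` ((\<lambda>z. B' #>\<^bsub>C'\<^esub> z) ` Z')"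
        proof
          fix X assume "X \<in> (\<lambda>z. B #>\<^bsub>C\<^esub> z) ` Z"
          then obtain z where z: "z \<in> Z" "X = B #>\<^bsub>C\<^esub> z" by blast
          obtain f b where f: "f \<in> Z'" "b \<in> B" "z = p f \<otimes>\<^bsub>C\<^esub> b" using surj[OF z(1)] by blast
          have "z \<otimes>\<^bsub>C\<^esub> inv\<^bsub>C\<^esub> (p f) = b"
            using f cZ' cB by (simp add: C.m_comm[of "p f" b] C.m_assoc)
          then have "X = B #>\<^bsub>C\<^esub> p f"
            using z f cZ cZ' by (simp add: C.r_coset_eqI[OF B(1)])
          then show "X \<in> ?h ` ((\<lambda>z. B' #>\<^bsub>C'\<^esub> z) ` Z')" using f(1) h by auto
        qed
      qed
    qed
  qed
qed

section \<open>Modules over the completion and pullback of cochains\<close>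

locale profinite_module = group G for G :: "('a, 'm) monoid_scheme" (structure) +
  fixes A :: "'b monoid" and act :: "('a set \<Rightarrow> 'a set) \<Rightarrow> 'b \<Rightarrow> 'b"
  assumes discrete: "discrete_module (profinite_completion G) (profinite_topology G) A act"
    and finite: "finite (carrier A)"

sublocale profinite_module \<subseteq> hat: module_action "profinite_completion G" A act
  by (rule module_action.intro) (use discrete finite group_hat in \<open>auto simp: discrete_module_def\<close>)

sublocale profinite_module \<subseteq> base: module_action G A "act \<circ> completion_map G"
proof (rule module_action.intro)
  show "act \<circ> completion_map G \<in> hom G (AutoGroup A)"
    by (rule Group.hom_compose[OF completion_map_hom hat.action])
qed (use discrete finite is_group in \<open>auto simp: discrete_module_def\<close>)

context profinite_module
begin

abbreviation cont :: "nat \<Rightarrow> ((nat \<Rightarrow> 'a set \<Rightarrow> 'a set) \<Rightarrow> 'b) set" where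
  "cont \<equiv> continuous_cochains hat hat_topology A"

abbreviation pull :: "nat \<Rightarrow> ((nat \<Rightarrow> 'a set \<Rightarrow> 'a set) \<Rightarrow> 'b) \<Rightarrow> (nat \<Rightarrow> 'a) \<Rightarrow> 'b" where
  "pull \<equiv> pullback_cochain G (completion_map G)"

definition factors_at :: "'a set \<Rightarrow> nat \<Rightarrow> ((nat \<Rightarrow> 'a set \<Rightarrow> 'a set) \<Rightarrow> 'b) \<Rightarrow> bool" where
  "factors_at N n f \<longleftrightarrow> (\<forall>x\<in>tuples hat n. \<forall>y\<in>tuples hat n. (\<forall>i<n. x i N = y i N) \<longrightarrow> f x = f y)"

lemma factors_at_mono:
  assumes "factors_at N n f" "M \<subseteq> N" "M \<in> finite_index_normals G" "N \<in> finite_index_normals G"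
  shows "factors_at M n f"
  unfolding factors_at_def
proof (intro ballI impI)
  fix x y assume xy: "x \<in> tuples hat n" "y \<in> tuples hat n" "\<forall>i<n. x i M = y i M"
  have "x i N = y i N" if i: "i < n" for i
    using hat_eq_mono[OF hat.tuples_nth[OF xy(1) i] hat.tuples_nth[OF xy(2) i]] xy(3) i assms by blast
  then show "f x = f y" using assms(1) xy unfolding factors_at_def by blast
qed

text \<open>Compactness turns continuity of a cochain into constancy at one level \<open>N\<close>;
  continuous cochains are handled in this form from here on.\<close>

lemma cont_iff:
  "f \<in> cont n \<longleftrightarrow> f \<in> hat.cochains n \<and> (\<exists>N\<in>finite_index_normals G. factors_at N n f)"
proof
  assume f: "f \<in> cont n"
  then have "continuous_map (product_topology (\<lambda>_. hat_topology) {..<n}) (discrete_topology (carrier A)) f"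
    by (simp add: continuous_cochains_def)
  then obtain N where N: "N \<in> finite_index_normals G"
    "\<forall>x\<in>tuples hat n. \<forall>y\<in>tuples hat n. (\<forall>i<n. x i N = y i N) \<longrightarrow> f x = f y"
    by (rule continuous_factors)
  have "factors_at N n f" unfolding factors_at_def by (rule N(2))
  then show "f \<in> hat.cochains n \<and> (\<exists>N\<in>finite_index_normals G. factors_at N n f)"
    using f N(1) by (auto simp: continuous_cochains_def)
next
  assume f: "f \<in> hat.cochains n \<and> (\<exists>N\<in>finite_index_normals G. factors_at N n f)"
  then obtain N where N: "N \<in> finite_index_normals G" "factors_at N n f" by blast
  have "continuous_map (product_topology (\<lambda>_. hat_topology) {..<n}) (discrete_topology (carrier A)) f"
  proof (rule factors_continuous[OF N(1)])
    show "f \<in> tuples hat n \<rightarrow> carrier A" using f hat.cochain_closed by blast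
    show "f x = f y" if "x \<in> tuples hat n" "y \<in> tuples hat n" "\<And>i. i < n \<Longrightarrow> x i N = y i N" for x y
      using N(2) that unfolding factors_at_def by blast
  qed
  then show "f \<in> cont n" using f by (simp add: continuous_cochains_def)
qed

text \<open>For fixed \<open>x\<close>, continuity of the action makes the orbit map a continuous
  function of one group variable, constant at some level. The module is finite, so one level
  suffices for all \<open>x\<close>.\<close>

lemma action_factors:
  obtains N where "N \<in> finite_index_normals G"
    "\<And>g g' x. g \<in> carrier hat \<Longrightarrow> g' \<in> carrier hat \<Longrightarrow> g N = g' N \<Longrightarrow> x \<in> carrier A \<Longrightarrow> act g x = act g' x"
proof -
  let ?F = "finite_index_normals G"
  have "\<exists>N\<in>?F. \<forall>g\<in>carrier hat. \<forall>g'\<in>carrier hat. g N = g' N \<longrightarrow> act g x = act g' x" if x: "x \<in> carrier A" for x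
  proof -
    \<comment> \<open>Tuples of length one are used in order to apply
      \<open>continuous_factors\<close>.\<close>
    let ?X = "product_topology (\<lambda>_::nat. hat_topology) {..<1}"
    have "continuous_map ?X (prod_topology hat_topology (discrete_topology (carrier A))) (\<lambda>y. (y 0, x))"
      using x by (auto simp: continuous_map_pairwise o_def intro: continuous_map_product_projection)
    moreover have "continuous_map (prod_topology hat_topology (discrete_topology (carrier A)))
        (discrete_topology (carrier A)) (\<lambda>(g, a). act g a)"
      using discrete by (simp add: discrete_module_def)
    ultimately have "continuous_map ?X (discrete_topology (carrier A)) ((\<lambda>(g, a). act g a) \<circ> (\<lambda>y. (y 0, x)))"
      by (rule continuous_map_compose)
    then obtain N where N: "N \<in> ?F"
      "\<forall>y\<in>tuples hat 1. \<forall>z\<in>tuples hat 1. (\<forall>i<1. y i N = z i N) \<longrightarrow>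
        ((\<lambda>(g, a). act g a) \<circ> (\<lambda>y. (y 0, x))) y = ((\<lambda>(g, a). act g a) \<circ> (\<lambda>y. (y 0, x))) z"
      by (rule continuous_factors)
    have "act g x = act g' x" if "g \<in> carrier hat" "g' \<in> carrier hat" "g N = g' N" for g g'
      using bspec[OF bspec[OF N(2), of "\<lambda>i\<in>{..<1}. g"], of "\<lambda>i\<in>{..<1}. g'"] that by (simp add: tuples_def)
    then show ?thesis using N(1) by blast
  qed
  then have "\<forall>x\<in>carrier A. \<exists>N. N \<in> ?F \<and> (\<forall>g\<in>carrier hat. \<forall>g'\<in>carrier hat. g N = g' N \<longrightarrow> act g x = act g' x)"
    by blast
  from bchoice[OF this] obtain N where N: "\<And>x. x \<in> carrier A \<Longrightarrow> N x \<in> ?F"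
    "\<And>x g g'. x \<in> carrier A \<Longrightarrow> g \<in> carrier hat \<Longrightarrow> g' \<in> carrier hat \<Longrightarrow> g (N x) = g' (N x) \<Longrightarrow> act g x = act g' x"
    by blast
  have sub: "N ` carrier A \<subseteq> ?F" using N by blast
  obtain M where M: "M \<in> ?F" "\<And>x. x \<in> carrier A \<Longrightarrow> M \<subseteq> N x"
    using finite_index_normals_refinement[OF finite_imageI[OF finite] sub] by (metis imageI)
  show ?thesis
  proof (rule that[OF M(1)])
    fix g g' x assume g: "g \<in> carrier hat" "g' \<in> carrier hat" "g M = g' M" and x: "x \<in> carrier A"
    show "act g x = act g' x"
      using N(2)[OF x g(1,2) hat_eq_mono[OF g M(2)[OF x] M(1) N(1)[OF x]]] .
  qed
qed

text \<open>Two levels are involved, one for \<open>f\<close> and one for the action on its values;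
  the coboundary is constant at their intersection.\<close>

lemma coboundary_cont:
  assumes "f \<in> cont n"
  shows "hat.\<delta> n f \<in> cont (Suc n)"
proof -
  obtain N where f: "f \<in> hat.cochains n" and N: "N \<in> finite_index_normals G" "factors_at N n f"
    using assms unfolding cont_iff by blast
  obtain N' where N': "N' \<in> finite_index_normals G"
    "\<And>g g' x. g \<in> carrier hat \<Longrightarrow> g' \<in> carrier hat \<Longrightarrow> g N' = g' N' \<Longrightarrow> x \<in> carrier A \<Longrightarrow> act g x = act g' x"
    using action_factors by metis
  let ?M = "N \<inter> N'"
  have M: "?M \<in> finite_index_normals G" using N(1) N'(1) by (rule finite_index_normals_Int)
  have "factors_at ?M (Suc n) (hat.\<delta> n f)"
    unfolding factors_at_def
  proof (intro ballI impI)
    fix x y assume x: "x \<in> tuples hat (Suc n)" and y: "y \<in> tuples hat (Suc n)"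
      and eq: "\<forall>i<Suc n. x i ?M = y i ?M"
    have c: "x i \<in> carrier hat" "y i \<in> carrier hat" if "i \<le> n" for i
      using hat.tuples_nth[OF x] hat.tuples_nth[OF y] that by auto
    have eqN: "x i N = y i N" "x i N' = y i N'" if "i \<le> n" for i
      using hat_eq_mono[OF c[OF that], of ?M N] hat_eq_mono[OF c[OF that], of ?M N'] eq that M N(1) N'(1) by auto
    have f_eq: "f u = f v" if "u \<in> tuples hat n" "v \<in> tuples hat n" "\<And>i. i < n \<Longrightarrow> u i N = v i N" for u v
      using N(2) that unfolding factors_at_def by blast
    define m where "m z j = (\<lambda>i\<in>{..<n}. if i < j then z i else if i = j then z j \<otimes>\<^bsub>hat\<^esub> z (Suc j) else z (Suc i))"
      for z :: "nat \<Rightarrow> 'a set \<Rightarrow> 'a set" and j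
    have mt: "m x j \<in> tuples hat n" "m y j \<in> tuples hat n" for j
      using c by (auto simp: m_def tuples_def hat_mult_closed)
    have m_eq: "f (m x j) = f (m y j)" for j
      by (rule f_eq[OF mt]) (use eqN N(1) in \<open>auto simp: m_def hat_mult\<close>)
    have t: "(\<lambda>i\<in>{..<n}. x (Suc i)) \<in> tuples hat n" "(\<lambda>i\<in>{..<n}. y (Suc i)) \<in> tuples hat n"
      "(\<lambda>i\<in>{..<n}. x i) \<in> tuples hat n" "(\<lambda>i\<in>{..<n}. y i) \<in> tuples hat n"
      using c by (auto simp: tuples_def)
    have first: "f (\<lambda>i\<in>{..<n}. x (Suc i)) = f (\<lambda>i\<in>{..<n}. y (Suc i))"
      by (rule f_eq[OF t(1,2)]) (use eqN in auto)
    have last: "f (\<lambda>i\<in>{..<n}. x i) = f (\<lambda>i\<in>{..<n}. y i)"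
      by (rule f_eq[OF t(3,4)]) (use eqN in auto)
    have "act (x 0) u = act (y 0) u" if "u \<in> carrier A" for u
      using N'(2)[OF c[of 0] eqN(2)[of 0] that] by simp
    then have "act (x 0) (f (\<lambda>i\<in>{..<n}. x (Suc i))) = act (y 0) (f (\<lambda>i\<in>{..<n}. y (Suc i)))"
      unfolding first using hat.cochain_closed[OF f t(2)] by blast
    then show "hat.\<delta> n f x = hat.\<delta> n f y"
      using x y last m_eq by (simp add: coboundary_def flip: m_def)
  qed
  then show ?thesis using M hat.coboundary_closed[OF f] unfolding cont_iff by blast
qed

lemma cont_subgroup: "subgroup (cont n) (cochain_group hat A n)"
proof -
  interpret C: comm_group "cochain_group hat A n" by (rule hat.comm_group_cochains)
  show ?thesis
  proof (rule C.subgroupI)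
    show "cont n \<subseteq> hat.cochains n" using cont_iff by blast
    have "factors_at (carrier G) n \<one>\<^bsub>cochain_group hat A n\<^esub>"
      by (simp add: factors_at_def hat.one_cochain)
    then have "\<one>\<^bsub>cochain_group hat A n\<^esub> \<in> cont n"
      unfolding cont_iff using carrier_finite_index_normal C.one_closed by blast
    then show "cont n \<noteq> {}" by blast
  next
    fix f assume "f \<in> cont n"
    then obtain N where f: "f \<in> hat.cochains n" and N: "N \<in> finite_index_normals G" "factors_at N n f"
      unfolding cont_iff by blast
    have "inv\<^bsub>cochain_group hat A n\<^esub> f = (\<lambda>x\<in>tuples hat n. inv\<^bsub>A\<^esub> f x)"
      using f hat.A.group_axioms unfolding cochain_group_def by (subst inv_product_group) auto
    then have "factors_at N n (inv\<^bsub>cochain_group hat A n\<^esub> f)"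
      unfolding factors_at_def
    proof (intro ballI impI)
      fix x y assume xy: "x \<in> tuples hat n" "y \<in> tuples hat n" "\<forall>i<n. x i N = y i N"
      then have "f x = f y" using N(2) unfolding factors_at_def by blast
      then show "(inv\<^bsub>cochain_group hat A n\<^esub> f) x = (inv\<^bsub>cochain_group hat A n\<^esub> f) y"
        using xy(1,2) \<open>inv\<^bsub>cochain_group hat A n\<^esub> f = _\<close> by simp
    qed
    then show "inv\<^bsub>cochain_group hat A n\<^esub> f \<in> cont n"
      unfolding cont_iff using N(1) C.inv_closed[OF f] by blast
  next
    fix f g assume "f \<in> cont n" "g \<in> cont n"
    then obtain N N' where f: "f \<in> hat.cochains n" and N: "N \<in> finite_index_normals G" "factors_at N n f"
      and g: "g \<in> hat.cochains n" and N': "N' \<in> finite_index_normals G" "factors_at N' n g"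
      unfolding cont_iff by blast
    have M: "N \<inter> N' \<in> finite_index_normals G" using N(1) N'(1) by (rule finite_index_normals_Int)
    have fg: "factors_at (N \<inter> N') n f" "factors_at (N \<inter> N') n g"
      using factors_at_mono[OF N(2) _ M N(1)] factors_at_mono[OF N'(2) _ M N'(1)] by auto
    have "factors_at (N \<inter> N') n (f \<otimes>\<^bsub>cochain_group hat A n\<^esub> g)"
      unfolding factors_at_def
    proof (intro ballI impI)
      fix x y assume xy: "x \<in> tuples hat n" "y \<in> tuples hat n" "\<forall>i<n. x i (N \<inter> N') = y i (N \<inter> N')"
      then have "f x = f y" "g x = g y" using fg unfolding factors_at_def by blast+
      then show "(f \<otimes>\<^bsub>cochain_group hat A n\<^esub> g) x = (f \<otimes>\<^bsub>cochain_group hat A n\<^esub> g) y"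
        using xy(1,2) by (simp add: cochain_group_def)
    qed
    then show "f \<otimes>\<^bsub>cochain_group hat A n\<^esub> g \<in> cont n"
      unfolding cont_iff using M C.m_closed[OF f g] by blast
  qed
qed

lemma completion_tuple: "x \<in> tuples G n \<Longrightarrow> (\<lambda>i\<in>{..<n}. completion_map G (x i)) \<in> tuples hat n"
  by (auto simp: tuples_def intro!: completion_map_closed)

lemma pull_hom: "pull n \<in> hom (cochain_group hat A n) (cochain_group G A n)"
proof (rule homI)
  show "pull n f \<in> base.cochains n" if "f \<in> hat.cochains n" for f
    using hat.cochain_closed[OF that completion_tuple] by (auto simp: pullback_cochain_def cochain_group_def)
  show "pull n (f \<otimes>\<^bsub>cochain_group hat A n\<^esub> g) = pull n f \<otimes>\<^bsub>cochain_group G A n\<^esub> pull n g" for f g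
    using completion_tuple by (auto simp: pullback_cochain_def cochain_group_def fun_eq_iff)
qed

lemma pull_closed: "f \<in> hat.cochains n \<Longrightarrow> pull n f \<in> base.cochains n"
  using pull_hom by (auto simp: hom_def)

lemma pull_coboundary:
  assumes f: "f \<in> hat.cochains n"
  shows "pull (Suc n) (hat.\<delta> n f) = base.\<delta> n (pull n f)"
proof (rule ext)
  fix x
  show "pull (Suc n) (hat.\<delta> n f) x = base.\<delta> n (pull n f) x"
  proof (cases "x \<in> tuples G (Suc n)")
    case False
    then show ?thesis by (simp add: pullback_cochain_def coboundary_def)
  next
    case True
    let ?c = "completion_map G"
    let ?x = "\<lambda>i\<in>{..<Suc n}. ?c (x i)"
    have xc: "x i \<in> carrier G" if "i \<le> n" for i using base.tuples_nth[OF True] that by simp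
    have t: "(\<lambda>i\<in>{..<n}. x (Suc i)) \<in> tuples G n" "(\<lambda>i\<in>{..<n}. x i) \<in> tuples G n"
      using xc by (auto simp: tuples_def)
    have first: "(\<lambda>i\<in>{..<n}. ?x (Suc i)) = (\<lambda>i\<in>{..<n}. ?c ((\<lambda>i\<in>{..<n}. x (Suc i)) i))"
      and last: "(\<lambda>i\<in>{..<n}. ?x i) = (\<lambda>i\<in>{..<n}. ?c ((\<lambda>i\<in>{..<n}. x i) i))"
      by (auto simp: fun_eq_iff)
    define m where "m j = (\<lambda>i\<in>{..<n}. if i < j then x i else if i = j then x j \<otimes> x (Suc j) else x (Suc i))" for j
    have mt: "m j \<in> tuples G n" for j using xc by (auto simp: tuples_def m_def)
    have middle: "(\<lambda>i\<in>{..<n}. if i < j then ?x i else if i = j then ?x j \<otimes>\<^bsub>hat\<^esub> ?x (Suc j) else ?x (Suc i)) =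
        (\<lambda>i\<in>{..<n}. ?c (m j i))" if "j < n" for j
      using that xc hom_mult[OF completion_map_hom] by (auto simp: fun_eq_iff m_def)
    have prod: "(\<Otimes>\<^bsub>A\<^esub>j\<in>{..<n}. f (\<lambda>i\<in>{..<n}. if i < j then ?x i else if i = j then ?x j \<otimes>\<^bsub>hat\<^esub> ?x (Suc j) else ?x (Suc i))
          [^]\<^bsub>A\<^esub> ((- 1) ^ Suc j :: int)) =
        (\<Otimes>\<^bsub>A\<^esub>j\<in>{..<n}. pull n f (m j) [^]\<^bsub>A\<^esub> ((- 1) ^ Suc j :: int))"
    proof (rule hat.A.finprod_cong')
      show "(\<lambda>j. pull n f (m j) [^]\<^bsub>A\<^esub> ((- 1) ^ Suc j :: int)) \<in> {..<n} \<rightarrow> carrier A"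
        using base.cochain_closed[OF pull_closed[OF f] mt] by auto
      fix j assume "j \<in> {..<n}"
      then show "f (\<lambda>i\<in>{..<n}. if i < j then ?x i else if i = j then ?x j \<otimes>\<^bsub>hat\<^esub> ?x (Suc j) else ?x (Suc i))
          [^]\<^bsub>A\<^esub> ((- 1) ^ Suc j :: int) = pull n f (m j) [^]\<^bsub>A\<^esub> ((- 1) ^ Suc j :: int)"
        using mt[of j] by (simp only: middle lessThan_iff) (simp add: pullback_cochain_def)
    qed simp
    have "pull (Suc n) (hat.\<delta> n f) x = hat.\<delta> n f ?x" using True by (simp add: pullback_cochain_def)
    also have "\<dots> = act (?x 0) (f (\<lambda>i\<in>{..<n}. ?x (Suc i)))
       \<otimes>\<^bsub>A\<^esub> (\<Otimes>\<^bsub>A\<^esub>j\<in>{..<n}. f (\<lambda>i\<in>{..<n}. if i < j then ?x i else if i = j then ?x j \<otimes>\<^bsub>hat\<^esub> ?x (Suc j) else ?x (Suc i))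
          [^]\<^bsub>A\<^esub> ((- 1) ^ Suc j :: int))
       \<otimes>\<^bsub>A\<^esub> f (\<lambda>i\<in>{..<n}. ?x i) [^]\<^bsub>A\<^esub> ((- 1) ^ Suc n :: int)"
      unfolding coboundary_def by (rule restrict_apply') (rule completion_tuple[OF True])
    also have "\<dots> = act (?c (x 0)) (pull n f (\<lambda>i\<in>{..<n}. x (Suc i)))
       \<otimes>\<^bsub>A\<^esub> (\<Otimes>\<^bsub>A\<^esub>j\<in>{..<n}. pull n f (m j) [^]\<^bsub>A\<^esub> ((- 1) ^ Suc j :: int))
       \<otimes>\<^bsub>A\<^esub> pull n f (\<lambda>i\<in>{..<n}. x i) [^]\<^bsub>A\<^esub> ((- 1) ^ Suc n :: int)"
      unfolding prod first last using t by (simp add: pullback_cochain_def)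
    also have "\<dots> = base.\<delta> n (pull n f) x"
      using True by (simp add: coboundary_def m_def)
    finally show ?thesis .
  qed
qed

text \<open>The group is dense in its completion: at a level where both cochains are constant, every
  tuple of the completion agrees with one that comes from the group.\<close>

lemma pull_inject:
  assumes "f \<in> cont n" "g \<in> cont n" "pull n f = pull n g"
  shows "f = g"
proof -
  obtain N N' where f: "f \<in> hat.cochains n" and N: "N \<in> finite_index_normals G" "factors_at N n f"
    and g: "g \<in> hat.cochains n" and N': "N' \<in> finite_index_normals G" "factors_at N' n g"
    using assms(1,2) unfolding cont_iff by blast
  have M: "N \<inter> N' \<in> finite_index_normals G" using N(1) N'(1) by (rule finite_index_normals_Int)
  have fg: "factors_at (N \<inter> N') n f" "factors_at (N \<inter> N') n g"
    using factors_at_mono[OF N(2) _ M N(1)] factors_at_mono[OF N'(2) _ M N'(1)] by auto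
  show ?thesis
  proof (rule PiE_ext[where k = "tuples hat n" and s = "\<lambda>_. carrier A"])
    show "f \<in> (\<Pi>\<^sub>E x\<in>tuples hat n. carrier A)" "g \<in> (\<Pi>\<^sub>E x\<in>tuples hat n. carrier A)"
      using f g by (auto simp: cochain_group_def)
    fix x assume x: "x \<in> tuples hat n"
    have "\<forall>i\<in>{..<n}. \<exists>h. h \<in> carrier G \<and> x i (N \<inter> N') = (N \<inter> N') #> h"
      using hat_rep[OF hat.tuples_nth[OF x] M] M by (metis lessThan_iff subset_refl)
    from bchoice[OF this] obtain h where
      h: "\<And>i. i < n \<Longrightarrow> h i \<in> carrier G \<and> x i (N \<inter> N') = (N \<inter> N') #> h i" by blast
    let ?h = "\<lambda>i\<in>{..<n}. h i"
    have ht: "?h \<in> tuples G n" using h by (auto simp: tuples_def)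
    let ?y = "\<lambda>i\<in>{..<n}. completion_map G (?h i)"
    have y: "?y \<in> tuples hat n" by (rule completion_tuple[OF ht])
    have eq: "\<forall>i<n. x i (N \<inter> N') = ?y i (N \<inter> N')" using h M by (simp add: completion_map_def)
    have "f x = f ?y" "g x = g ?y" using fg x y eq unfolding factors_at_def by blast+
    moreover have "f ?y = g ?y" using fun_cong[OF assms(3), of ?h] ht by (simp add: pullback_cochain_def)
    ultimately show "f x = g x" by simp
  qed
qed

lemma pull_factors_in:
  assumes "f \<in> cont n"
  obtains N where "N \<in> finite_index_normals G" "base.factors_in N n (pull n f)"
proof -
  obtain N where N: "N \<in> finite_index_normals G" "factors_at N n f"
    using assms unfolding cont_iff by blast
  have "base.factors_in N n (pull n f)"
    unfolding base.factors_in_def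
  proof (intro ballI impI)
    fix x y assume x: "x \<in> tuples G n" and y: "y \<in> tuples G n" and eq: "\<forall>i<n. N #> x i = N #> y i"
    have "f (\<lambda>i\<in>{..<n}. completion_map G (x i)) = f (\<lambda>i\<in>{..<n}. completion_map G (y i))"
    proof -
      have "\<forall>i<n. (\<lambda>i\<in>{..<n}. completion_map G (x i)) i N = (\<lambda>i\<in>{..<n}. completion_map G (y i)) i N"
        using eq N(1) by (simp add: completion_map_def)
      then show ?thesis using N(2) completion_tuple[OF x] completion_tuple[OF y] unfolding factors_at_def by blast
    qed
    then show "pull n f x = pull n f y" using x y by (simp add: pullback_cochain_def)
  qed
  then show ?thesis using that N(1) by blast
qed

text \<open>A cochain that factors through \<open>N\<close> is extended to the completion by reading
  the coordinate at \<open>N\<close> and choosing representatives; the choice is immaterial at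
  elements of the group.\<close>

lemma pull_surj:
  assumes "\<chi> \<in> base.cochains n" "N \<in> finite_index_normals G" "base.factors_in N n \<chi>"
  obtains f where "f \<in> cont n" "pull n f = \<chi>"
proof -
  define r where "r c = (SOME h. h \<in> carrier G \<and> N #> h = c)" for c
  have r: "r (x N) \<in> carrier G \<and> N #> r (x N) = x N" if x: "x \<in> carrier hat" for x
  proof -
    obtain h where "h \<in> carrier G" "x N = N #> h" using hat_rep[OF x assms(2)] assms(2) by (metis subset_refl)
    then have "\<exists>h. h \<in> carrier G \<and> N #> h = x N" by auto
    then show ?thesis unfolding r_def by (rule someI_ex)
  qed
  define f where "f = (\<lambda>x\<in>tuples hat n. \<chi> (\<lambda>i\<in>{..<n}. r (x i N)))"
  have t: "(\<lambda>i\<in>{..<n}. r (x i N)) \<in> tuples G n" if "x \<in> tuples hat n" for x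
    using r hat.tuples_nth[OF that] by (auto simp: tuples_def)
  have "f \<in> hat.cochains n"
    using base.cochain_closed[OF assms(1) t] by (auto simp: f_def cochain_group_def)
  moreover have "factors_at N n f"
    unfolding factors_at_def
  proof (intro ballI impI)
    fix x y assume xy: "x \<in> tuples hat n" "y \<in> tuples hat n" "\<forall>i<n. x i N = y i N"
    then have "(\<lambda>i\<in>{..<n}. r (x i N)) = (\<lambda>i\<in>{..<n}. r (y i N))" by (auto simp: fun_eq_iff)
    then show "f x = f y" using xy by (simp add: f_def)
  qed
  ultimately have "f \<in> cont n" unfolding cont_iff using assms(2) by blast
  moreover have "pull n f = \<chi>"
  proof (rule PiE_ext[where k = "tuples G n" and s = "\<lambda>_. carrier A"])
    show "pull n f \<in> (\<Pi>\<^sub>E x\<in>tuples G n. carrier A)" "\<chi> \<in> (\<Pi>\<^sub>E x\<in>tuples G n. carrier A)"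
      using pull_closed[OF \<open>f \<in> hat.cochains n\<close>] assms(1) by (auto simp: cochain_group_def)
    fix x assume x: "x \<in> tuples G n"
    let ?y = "\<lambda>i\<in>{..<n}. completion_map G (x i)"
    let ?z = "\<lambda>i\<in>{..<n}. r (?y i N)"
    have y: "?y \<in> tuples hat n" by (rule completion_tuple[OF x])
    have "\<forall>i<n. N #> ?z i = N #> x i"
      using r[OF hat.tuples_nth[OF y]] assms(2) by (simp add: completion_map_def)
    then have "\<chi> ?z = \<chi> x" using assms(3) t[OF y] x unfolding base.factors_in_def by blast
    then show "pull n f x = \<chi> x" using x y by (simp add: pullback_cochain_def f_def)
  qed
  ultimately show ?thesis by (rule that)
qed

end

section \<open>The comparison of cohomology groups\<close>

context profinite_module
begin

abbreviation base_boundaries :: "nat \<Rightarrow> ((nat \<Rightarrow> 'a) \<Rightarrow> 'b) set" where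
  "base_boundaries \<equiv> coboundaries G A (act \<circ> completion_map G) (\<lambda>n. carrier (cochain_group G A n))"

abbreviation base_cocycles :: "nat \<Rightarrow> ((nat \<Rightarrow> 'a) \<Rightarrow> 'b) set" where
  "base_cocycles \<equiv> cocycles G A (act \<circ> completion_map G) (\<lambda>n. carrier (cochain_group G A n))"

abbreviation cont_boundaries :: "nat \<Rightarrow> ((nat \<Rightarrow> 'a set \<Rightarrow> 'a set) \<Rightarrow> 'b) set" where
  "cont_boundaries \<equiv> coboundaries hat A act cont"

abbreviation cont_cocycles :: "nat \<Rightarrow> ((nat \<Rightarrow> 'a set \<Rightarrow> 'a set) \<Rightarrow> 'b) set" where
  "cont_cocycles \<equiv> cocycles hat A act cont"

lemma boundary_closed: "b \<in> base_boundaries n \<Longrightarrow> b \<in> base.cochains n"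
  by (cases n) (auto simp: coboundaries_def base.one_cochain_closed intro: base.coboundary_closed)

lemma coboundary_one: "base.\<delta> n \<one>\<^bsub>cochain_group G A n\<^esub> = \<one>\<^bsub>cochain_group G A (Suc n)\<^esub>"
  by (rule hom_one[OF base.coboundary_hom])
    (rule comm_group.axioms(2)[OF base.comm_group_cochains])+

lemma coboundary_boundary:
  "b \<in> base_boundaries n \<Longrightarrow> base.\<delta> n b = \<one>\<^bsub>cochain_group G A (Suc n)\<^esub>"
  by (cases n) (auto simp: coboundaries_def coboundary_one base.coboundary_coboundary)

lemma boundaries_subgroup: "subgroup (base_boundaries n) (cochain_group G A n)"
proof (cases n)
  case 0
  then show ?thesis
    using group.triv_subgroup[OF comm_group.axioms(2)[OF base.comm_group_cochains]]
    by (simp add: coboundaries_def)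
next
  case (Suc m)
  interpret h: group_hom "cochain_group G A m" "cochain_group G A (Suc m)" "base.\<delta> m"
    using base.coboundary_hom comm_group.axioms(2)[OF base.comm_group_cochains]
    by (simp add: group_hom_def group_hom_axioms_def)
  show ?thesis using h.img_is_subgroup Suc by (simp add: coboundaries_def)
qed

lemma cocycles_subgroup: "subgroup (base_cocycles n) (cochain_group G A n)"
proof -
  interpret h: group_hom "cochain_group G A n" "cochain_group G A (Suc n)" "base.\<delta> n"
    using base.coboundary_hom comm_group.axioms(2)[OF base.comm_group_cochains]
    by (simp add: group_hom_def group_hom_axioms_def)
  show ?thesis using h.subgroup_kernel by (simp add: cocycles_def kernel_def)
qed

lemma boundaries_cocycles: "base_boundaries n \<subseteq> base_cocycles n"
  using boundary_closed coboundary_boundary by (auto simp: cocycles_def)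

lemma cont_closed: "f \<in> cont n \<Longrightarrow> f \<in> hat.cochains n"
  by (simp add: cont_iff)

lemma one_cont: "\<one>\<^bsub>cochain_group hat A n\<^esub> \<in> cont n"
  by (rule subgroup.one_closed[OF cont_subgroup])

lemma cont_boundaries_subgroup: "subgroup (cont_boundaries n) (cochain_group hat A n)"
proof (cases n)
  case 0
  then show ?thesis
    using group.triv_subgroup[OF comm_group.axioms(2)[OF hat.comm_group_cochains]]
    by (simp add: coboundaries_def)
next
  case (Suc m)
  interpret h: group_hom "cochain_group hat A m" "cochain_group hat A (Suc m)" "hat.\<delta> m"
    using hat.coboundary_hom comm_group.axioms(2)[OF hat.comm_group_cochains]
    by (simp add: group_hom_def group_hom_axioms_def)
  show ?thesis using h.subgroup_img_is_subgroup[OF cont_subgroup] Suc by (simp add: coboundaries_def)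
qed

lemma cont_cocycles_subgroup: "subgroup (cont_cocycles n) (cochain_group hat A n)"
proof -
  interpret h: group_hom "cochain_group hat A n" "cochain_group hat A (Suc n)" "hat.\<delta> n"
    using hat.coboundary_hom comm_group.axioms(2)[OF hat.comm_group_cochains]
    by (simp add: group_hom_def group_hom_axioms_def)
  have "cont_cocycles n = cont n \<inter> kernel (cochain_group hat A n) (cochain_group hat A (Suc n)) (hat.\<delta> n)"
    using cont_closed by (auto simp: cocycles_def kernel_def)
  then show ?thesis using h.G.subgroups_Inter_pair[OF cont_subgroup h.subgroup_kernel] by simp
qed

lemma pull_one: "pull n \<one>\<^bsub>cochain_group hat A n\<^esub> = \<one>\<^bsub>cochain_group G A n\<^esub>"
  by (rule hom_one[OF pull_hom])
    (rule comm_group.axioms(2)[OF base.comm_group_cochains] comm_group.axioms(2)[OF hat.comm_group_cochains])+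

lemma cont_boundaries_cocycles: "cont_boundaries n \<subseteq> cont_cocycles n"
proof
  fix b assume b: "b \<in> cont_boundaries n"
  show "b \<in> cont_cocycles n"
  proof (cases n)
    case 0
    have "hat.\<delta> n \<one>\<^bsub>cochain_group hat A n\<^esub> = \<one>\<^bsub>cochain_group hat A (Suc n)\<^esub>"
      by (rule hom_one[OF hat.coboundary_hom])
        (rule comm_group.axioms(2)[OF hat.comm_group_cochains])+
    then show ?thesis using b 0 one_cont[of n] by (simp add: coboundaries_def cocycles_def)
  next
    case (Suc m)
    then obtain f where "f \<in> cont m" "b = hat.\<delta> m f" using b by (auto simp: coboundaries_def)
    then show ?thesis
      using Suc coboundary_cont[of f m] hat.coboundary_coboundary[OF cont_closed, of f m] by (simp add: cocycles_def)
  qed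
qed

lemma pull_cocycle_iff:
  assumes "f \<in> cont n"
  shows "pull n f \<in> base_cocycles n \<longleftrightarrow> f \<in> cont_cocycles n"
proof -
  have "pull (Suc n) (hat.\<delta> n f) = base.\<delta> n (pull n f)" by (rule pull_coboundary[OF cont_closed[OF assms]])
  moreover have "hat.\<delta> n f = \<one>\<^bsub>cochain_group hat A (Suc n)\<^esub> \<longleftrightarrow>
      pull (Suc n) (hat.\<delta> n f) = pull (Suc n) \<one>\<^bsub>cochain_group hat A (Suc n)\<^esub>"
    using pull_inject[OF coboundary_cont[OF assms] one_cont] by metis
  ultimately show ?thesis
    using assms pull_closed[OF cont_closed[OF assms]] by (simp add: cocycles_def pull_one)
qed

text \<open>In degree 0 the empty tuple is the only argument and every cochain factors already;
  higher degrees are \<open>effaceable_factors_in\<close>. It is applied with the whole group as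
  \<open>N\<close> for cocycles, and with the level of a continuous cocycle for its
  primitives.\<close>

lemma reduce_cochain:
  assumes eff: "base.M.effaceable (carrier G)" and N: "N \<in> finite_index_normals G"
  obtains K where "K \<in> finite_index_normals G"
    "\<forall>\<phi>\<in>base.cochains n. base.factors_in N (Suc n) (base.\<delta> n \<phi>) \<longrightarrow>
      (\<exists>\<chi>\<in>base.cochains n. \<exists>b\<in>base_boundaries n. base.factors_in K n \<chi> \<and> \<phi> = \<chi> \<otimes>\<^bsub>cochain_group G A n\<^esub> b)"
proof (cases n)
  case 0
  have "\<phi> = \<phi> \<otimes>\<^bsub>cochain_group G A 0\<^esub> \<one>\<^bsub>cochain_group G A 0\<^esub>" if "\<phi> \<in> base.cochains 0" for \<phi>
    using that comm_group.axioms(2)[OF base.comm_group_cochains, of 0]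
    by (simp add: group.is_monoid monoid.r_one)
  moreover have "base.factors_in N 0 \<phi>" for \<phi> by (auto simp: base.factors_in_def tuples_def)
  ultimately show ?thesis using that[OF N] 0 by (auto simp: coboundaries_def)
next
  case (Suc m)
  have N': "N \<lhd> G" "fin_ind N (carrier G)" using N by (auto simp: finite_index_normals_iff)
  obtain K where K: "K \<lhd> G" "fin_ind K (carrier G)" and
    red: "\<And>\<phi>. \<phi> \<in> base.cochains (Suc m) \<Longrightarrow> base.factors_in N (Suc (Suc m)) (base.\<delta> (Suc m) \<phi>) \<Longrightarrow>
      \<exists>\<psi>\<in>base.cochains m. \<exists>\<chi>\<in>base.cochains (Suc m). base.factors_in K (Suc m) \<chi> \<and>
        \<phi> = \<chi> \<otimes>\<^bsub>cochain_group G A (Suc m)\<^esub> base.\<delta> m \<psi>"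
    using base.effaceable_factors_in[OF eff N', of m] by blast
  show ?thesis
  proof (rule that[of K])
    show "K \<in> finite_index_normals G" using K by (simp add: finite_index_normals_iff)
    show "\<forall>\<phi>\<in>base.cochains n. base.factors_in N (Suc n) (base.\<delta> n \<phi>) \<longrightarrow>
      (\<exists>\<chi>\<in>base.cochains n. \<exists>b\<in>base_boundaries n. base.factors_in K n \<chi> \<and> \<phi> = \<chi> \<otimes>\<^bsub>cochain_group G A n\<^esub> b)"
    proof (intro ballI impI)
      fix \<phi> assume "\<phi> \<in> base.cochains n" "base.factors_in N (Suc n) (base.\<delta> n \<phi>)"
      then obtain \<psi> \<chi> where "\<psi> \<in> base.cochains m" "\<chi> \<in> base.cochains n" "base.factors_in K n \<chi>"
        "\<phi> = \<chi> \<otimes>\<^bsub>cochain_group G A n\<^esub> base.\<delta> m \<psi>"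
        using red[of \<phi>] Suc by blast
      then show "\<exists>\<chi>\<in>base.cochains n. \<exists>b\<in>base_boundaries n. base.factors_in K n \<chi> \<and> \<phi> = \<chi> \<otimes>\<^bsub>cochain_group G A n\<^esub> b"
        using Suc by (auto simp: coboundaries_def)
    qed
  qed
qed

lemma one_factors: "base.factors_in N n \<one>\<^bsub>cochain_group G A n\<^esub>"
  by (auto simp: base.factors_in_def base.one_cochain)

lemma coboundary_mult_boundary:
  assumes "\<chi> \<in> base.cochains n" "b \<in> base_boundaries n"
  shows "base.\<delta> n (\<chi> \<otimes>\<^bsub>cochain_group G A n\<^esub> b) = base.\<delta> n \<chi>"
proof -
  interpret C: comm_group "cochain_group G A (Suc n)" by (rule base.comm_group_cochains)
  show ?thesis
    using hom_mult[OF base.coboundary_hom assms(1) boundary_closed[OF assms(2)]]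
      coboundary_boundary[OF assms(2)] base.coboundary_closed[OF assms(1)] by simp
qed

text \<open>Every class is represented by a cochain that factors through the same \<open>K\<close>,
  and there are finitely many of these.\<close>

lemma finite_cohomology:
  assumes "base.M.effaceable (carrier G)"
  shows "finite (carrier (group_cohomology G A (act \<circ> completion_map G) n))"
proof -
  interpret C: comm_group "cochain_group G A n" by (rule base.comm_group_cochains)
  obtain K where K: "K \<in> finite_index_normals G"
    and red: "\<forall>\<phi>\<in>base.cochains n. base.factors_in (carrier G) (Suc n) (base.\<delta> n \<phi>) \<longrightarrow>
      (\<exists>\<chi>\<in>base.cochains n. \<exists>b\<in>base_boundaries n. base.factors_in K n \<chi> \<and> \<phi> = \<chi> \<otimes>\<^bsub>cochain_group G A n\<^esub> b)"
    using reduce_cochain[OF assms carrier_finite_index_normal, of n] by blast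
  let ?S = "{\<chi> \<in> base.cochains n. base.factors_in K n \<chi>}"
  have "carrier (group_cohomology G A (act \<circ> completion_map G) n) =
      (\<lambda>z. base_boundaries n #>\<^bsub>cochain_group G A n\<^esub> z) ` base_cocycles n"
    by (simp only: group_cohomology_def cohomology_def carrier_Mod_subgroup)
  also have "\<dots> \<subseteq> (\<lambda>z. base_boundaries n #>\<^bsub>cochain_group G A n\<^esub> z) ` ?S"
  proof
    fix X assume "X \<in> (\<lambda>z. base_boundaries n #>\<^bsub>cochain_group G A n\<^esub> z) ` base_cocycles n"
    then obtain z where z: "z \<in> base_cocycles n" "X = base_boundaries n #>\<^bsub>cochain_group G A n\<^esub> z" by blast
    have "z \<in> base.cochains n" "base.factors_in (carrier G) (Suc n) (base.\<delta> n z)"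
      using z(1) one_factors by (auto simp: cocycles_def)
    then obtain \<chi> b where \<chi>: "\<chi> \<in> base.cochains n" "b \<in> base_boundaries n" "base.factors_in K n \<chi>"
      "z = \<chi> \<otimes>\<^bsub>cochain_group G A n\<^esub> b" using red by blast
    have "b \<in> base.cochains n" using \<chi>(2) by (rule boundary_closed)
    then have "z \<otimes>\<^bsub>cochain_group G A n\<^esub> inv\<^bsub>cochain_group G A n\<^esub> \<chi> = b"
      using \<chi>(1,4) by (simp add: C.m_comm[of \<chi> b] C.m_assoc)
    then have "X = base_boundaries n #>\<^bsub>cochain_group G A n\<^esub> \<chi>"
      unfolding z(2) using \<chi> \<open>z \<in> base.cochains n\<close> by (intro C.r_coset_eqI boundaries_subgroup) auto
    then show "X \<in> (\<lambda>z. base_boundaries n #>\<^bsub>cochain_group G A n\<^esub> z) ` ?S" using \<chi> by blast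
  qed
  finally show ?thesis
    using base.finite_factors_in[of K n] K by (auto simp: finite_index_normals_iff intro: finite_subset)
qed

lemma cohomology_map_iso:
  assumes eff: "base.M.effaceable (carrier G)"
  shows "cohomology_map G (completion_map G) A act n \<in>
    iso (continuous_cohomology hat hat_topology A act n) (group_cohomology G A (act \<circ> completion_map G) n)"
proof -
  interpret C: comm_group "cochain_group G A n" by (rule base.comm_group_cochains)
  have pull_Z: "pull n f \<in> base_cocycles n" if "f \<in> cont_cocycles n" for f
    using pull_cocycle_iff[of f n] that by (simp add: cocycles_def)
  have pull_B: "pull n b \<in> base_boundaries n" if b: "b \<in> cont_boundaries n" for b
  proof (cases n)
    case 0
    then show ?thesis using b pull_one[of 0] by (simp add: coboundaries_def)
  next
    case (Suc m)
    then obtain f where "f \<in> cont m" "b = hat.\<delta> m f" using b by (auto simp: coboundaries_def)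
    then show ?thesis
      using Suc pull_coboundary[OF cont_closed, of f m] pull_closed[OF cont_closed, of f m]
      by (simp add: coboundaries_def)
  qed
  have inj: "f \<in> cont_boundaries n" if f: "f \<in> cont_cocycles n" "pull n f \<in> base_boundaries n" for f
  proof -
    have fc: "f \<in> cont n" using f(1) by (simp add: cocycles_def)
    show ?thesis
    proof (cases n)
      case 0
      then have "pull n f = pull n \<one>\<^bsub>cochain_group hat A n\<^esub>" using f(2) pull_one by (simp add: coboundaries_def)
      then have "f = \<one>\<^bsub>cochain_group hat A n\<^esub>" by (rule pull_inject[OF fc one_cont])
      then show ?thesis using 0 by (simp add: coboundaries_def)
    next
      case (Suc m)
      obtain g where g: "g \<in> base.cochains m" "pull n f = base.\<delta> m g"
        using f(2) Suc by (auto simp: coboundaries_def)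
      obtain N where N: "N \<in> finite_index_normals G" "base.factors_in N n (pull n f)"
        by (rule pull_factors_in[OF fc])
      \<comment> \<open>Injectivity: the coboundary of \<open>g\<close> factors through
        \<open>N\<close>, so \<open>g\<close> may be replaced, up to a boundary that
        \<open>\<delta>\<close> kills, by a cochain that extends to the completion.\<close>
      obtain K where K: "K \<in> finite_index_normals G"
        and red: "\<forall>\<phi>\<in>base.cochains m. base.factors_in N (Suc m) (base.\<delta> m \<phi>) \<longrightarrow>
          (\<exists>\<chi>\<in>base.cochains m. \<exists>b\<in>base_boundaries m. base.factors_in K m \<chi> \<and> \<phi> = \<chi> \<otimes>\<^bsub>cochain_group G A m\<^esub> b)"
        by (rule reduce_cochain[OF eff N(1)])
      obtain \<chi> b where \<chi>: "\<chi> \<in> base.cochains m" "b \<in> base_boundaries m" "base.factors_in K m \<chi>"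
        "g = \<chi> \<otimes>\<^bsub>cochain_group G A m\<^esub> b" using red g N(2) Suc by auto
      obtain h where h: "h \<in> cont m" "pull m h = \<chi>" by (rule pull_surj[OF \<chi>(1) K \<chi>(3)])
      have "pull n f = base.\<delta> m \<chi>" using g(2) \<chi>(4) coboundary_mult_boundary[OF \<chi>(1,2)] by simp
      also have "\<dots> = pull n (hat.\<delta> m h)" using pull_coboundary[OF cont_closed[OF h(1)]] h(2) Suc by simp
      finally have "f = hat.\<delta> m h" using pull_inject[OF fc, of "hat.\<delta> m h"] coboundary_cont[OF h(1)] Suc by simp
      then show ?thesis using h(1) Suc by (simp add: coboundaries_def)
    qed
  qed
  have surj: "\<exists>f\<in>cont_cocycles n. \<exists>b\<in>base_boundaries n. z = pull n f \<otimes>\<^bsub>cochain_group G A n\<^esub> b"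
    if z: "z \<in> base_cocycles n" for z
  proof -
    \<comment> \<open>Surjectivity: the coboundary of a cocycle is trivial and factors through the
      quotient by the whole group, so the cocycle is cohomologous to one that extends to the
      completion.\<close>
    obtain K where K: "K \<in> finite_index_normals G"
      and red: "\<forall>\<phi>\<in>base.cochains n. base.factors_in (carrier G) (Suc n) (base.\<delta> n \<phi>) \<longrightarrow>
        (\<exists>\<chi>\<in>base.cochains n. \<exists>b\<in>base_boundaries n. base.factors_in K n \<chi> \<and> \<phi> = \<chi> \<otimes>\<^bsub>cochain_group G A n\<^esub> b)"
      by (rule reduce_cochain[OF eff carrier_finite_index_normal])
    have zc: "z \<in> base.cochains n" "base.factors_in (carrier G) (Suc n) (base.\<delta> n z)"
      using z one_factors by (auto simp: cocycles_def)
    then obtain \<chi> b where \<chi>: "\<chi> \<in> base.cochains n" "b \<in> base_boundaries n" "base.factors_in K n \<chi>"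
      "z = \<chi> \<otimes>\<^bsub>cochain_group G A n\<^esub> b" using red by blast
    obtain f where f: "f \<in> cont n" "pull n f = \<chi>" by (rule pull_surj[OF \<chi>(1) K \<chi>(3)])
    have "base.\<delta> n \<chi> = \<one>\<^bsub>cochain_group G A (Suc n)\<^esub>"
      using z \<chi>(4) coboundary_mult_boundary[OF \<chi>(1,2)] by (simp add: cocycles_def)
    then have "f \<in> cont_cocycles n"
      using pull_cocycle_iff[OF f(1)] f(2) \<chi>(1) by (simp add: cocycles_def)
    then show ?thesis using \<chi> f by blast
  qed
  have "(\<lambda>X. base_boundaries n <#>\<^bsub>cochain_group G A n\<^esub> pull n ` X) \<in>
      iso ((cochain_group hat A n)\<lparr>carrier := cont_cocycles n\<rparr> Mod cont_boundaries n)
        ((cochain_group G A n)\<lparr>carrier := base_cocycles n\<rparr> Mod base_boundaries n)"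
    by (rule Mod_iso[OF hat.comm_group_cochains base.comm_group_cochains cont_cocycles_subgroup
          cont_boundaries_subgroup cont_boundaries_cocycles cocycles_subgroup boundaries_subgroup
          boundaries_cocycles pull_hom])
      (use pull_Z pull_B inj surj in auto)
  moreover have "cohomology_map G (completion_map G) A act n =
      (\<lambda>X. base_boundaries n <#>\<^bsub>cochain_group G A n\<^esub> pull n ` X)"
    by (rule ext) (simp add: cohomology_map_def)
  ultimately show ?thesis
    by (simp add: continuous_cohomology_def group_cohomology_def cohomology_def)
qed

end

theorem theorem3p6:
  fixes G :: "('a, 'm) monoid_scheme" and \<phi> :: "'a \<Rightarrow> 'a"
  assumes "polycyclic_group G"
    and "\<phi> \<in> hom G G"
  shows "in_class_G TYPE('b) (ascending_hnn G \<phi>)"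
  unfolding in_class_G_def
proof (intro conjI allI impI; (elim conjE)?)
  let ?H = "ascending_hnn G \<phi>"
  show H: "group ?H" by (rule group_ascending_hnn)
  fix n :: nat and A :: "'b monoid" and act
  assume "discrete_module (profinite_completion ?H) (profinite_topology ?H) A act" "finite (carrier A)"
  then interpret profinite_module ?H A act
    using H by (simp add: profinite_module_def profinite_module_axioms_def)
  have eff: "base.M.effaceable (carrier ?H)"
    by (rule effaceable_ascending_hnn[OF assms base.fin_module])
  show "finite (carrier (group_cohomology ?H A (act \<circ> completion_map ?H) n))"
    by (rule finite_cohomology[OF eff])
  show "cohomology_map ?H (completion_map ?H) A act n \<in>
      iso (continuous_cohomology (profinite_completion ?H) (profinite_topology ?H) A act n)
        (group_cohomology ?H A (act \<circ> completion_map ?H) n)"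
    by (rule cohomology_map_iso[OF eff])
qed

end
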